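(* Let $\Gamma$ be a cancelation monoid and let $A=\bigoplus_{\gamma\in\Gamma}A_\gamma$ be a $\Gamma$-graded local ring that is left gr-Noetherian. Then, up to a graded isomorphism (of chain complexes), every finitely generated $\Gamma$-graded $A$-module $M$ has a unique minimal gr-free resolution.
   Context: Rings are associative with identity $1$, not necessarily commutative; modules are unitary left modules. A cancelation monoid is a (not necessarily commutative) monoid with neutral element $e$ satisfying the left and right cancelation laws. A $\Gamma$-graded ring is a ring $A=\bigoplus_{\gamma\in\Gamma}A_\gamma$ (additive subgroups) with $A_{\gamma_1}A_{\gamma_2}\subseteq A_{\gamma_1\gamma_2}$; a $\Gamma$-graded $A$-module is a module $M=\bigoplus_{\gamma\in\Gamma}M_\gamma$ (additive subgroups) with $A_{\gamma_1}M_{\gamma_2}\subseteq M_{\gamma_1\gamma_2}$. Homogeneous elements are the nonzero elements of the components; a graded ideal is one generated by homogeneous elements; a graded homomorphism preserves degrees: $\varphi(M_\gamma)\subseteq N_\gamma$. $A$ is left gr-Noetherian if every graded left ideal is finitely generated. A $\Gamma$-graded local ring is a $\Gamma$-graded ring $A$ whose degree-$e$ part $A_e$ is a local ring (it has a unique maximal left ideal, which is also its unique maximal right and two-sided ideal); its maximal graded ideal $\mathfrak{M}$ is the two-sided ideal generated by all non-invertible homogeneous elements, which is the unique maximal graded (left, right and two-sided) ideal of $A$. A gr-free $A$-module is a $\Gamma$-graded $A$-module with a free $A$-basis consisting of homogeneous elements; its gr-rank is the cardinality of such a basis. A minimal gr-free resolution of a finitely generated $\Gamma$-graded $A$-module $M$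 is an exact sequence of $\Gamma$-graded modules and graded homomorphisms $$\cdots\to F_n\xrightarrow{\varphi_n}F_{n-1}\to\cdots\xrightarrow{\varphi_2}F_1\xrightarrow{\varphi_1}F_0\xrightarrow{\varphi_0}M\to 0$$ such that each $F_n$ ($n\ge 0$) is gr-free of finite gr-rank and $\operatorname{Im}\varphi_n\subseteq\mathfrak{M}F_{n-1}$ for all $n\ge 1$. *)

theory Defs
  imports "HOL-Algebra.Algebra"
begin

section \<open>Left modules over a not necessarily commutative ring\<close>

text \<open>The library locale \<open>module\<close> requires a commutative ring of scalars.  As there, the
  multiplicative fields of the record underlying a module are irrelevant.\<close>

locale left_module = R?: ring R + M?: abelian_group M
  for R :: "('a, 'r) ring_scheme" (structure) and M :: "('a, 'b, 'm) module_scheme" (structure) +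
  assumes smult_closed:
      "\<lbrakk>a \<in> carrier R; x \<in> carrier M\<rbrakk> \<Longrightarrow> a \<odot>\<^bsub>M\<^esub> x \<in> carrier M"
    and smult_l_distr:
      "\<lbrakk>a \<in> carrier R; b \<in> carrier R; x \<in> carrier M\<rbrakk> \<Longrightarrow>
        (a \<oplus> b) \<odot>\<^bsub>M\<^esub> x = a \<odot>\<^bsub>M\<^esub> x \<oplus>\<^bsub>M\<^esub> b \<odot>\<^bsub>M\<^esub> x"
    and smult_r_distr:
      "\<lbrakk>a \<in> carrier R; x \<in> carrier M; y \<in> carrier M\<rbrakk> \<Longrightarrow>
        a \<odot>\<^bsub>M\<^esub> (x \<oplus>\<^bsub>M\<^esub> y) = a \<odot>\<^bsub>M\<^esub> x \<oplus>\<^bsub>M\<^esub> a \<odot>\<^bsub>M\<^esub> y"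
    and smult_assoc:
      "\<lbrakk>a \<in> carrier R; b \<in> carrier R; x \<in> carrier M\<rbrakk> \<Longrightarrow>
        (a \<otimes> b) \<odot>\<^bsub>M\<^esub> x = a \<odot>\<^bsub>M\<^esub> (b \<odot>\<^bsub>M\<^esub> x)"
    and smult_one:
      "x \<in> carrier M \<Longrightarrow> \<one> \<odot>\<^bsub>M\<^esub> x = x"

definition module_span :: "('a, 'r) ring_scheme \<Rightarrow> ('a, 'b, 'm) module_scheme \<Rightarrow> 'b set \<Rightarrow> 'b set"
  where "module_span A M S = \<Inter> {N. submodule N A M \<and> S \<subseteq> N}"

definition fin_gen_module :: "('a, 'r) ring_scheme \<Rightarrow> ('a, 'b, 'm) module_scheme \<Rightarrow> bool"
  where "fin_gen_module A M \<longleftrightarrow>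
    (\<exists>S. finite S \<and> S \<subseteq> carrier M \<and> module_span A M S = carrier M)"

definition module_hom ::
  "('a, 'r) ring_scheme \<Rightarrow> ('a, 'b, 'm) module_scheme \<Rightarrow> ('a, 'c, 'n) module_scheme \<Rightarrow> ('b \<Rightarrow> 'c) set"
  where "module_hom A M N = {f \<in> carrier M \<rightarrow> carrier N.
    (\<forall>x\<in>carrier M. \<forall>y\<in>carrier M. f (x \<oplus>\<^bsub>M\<^esub> y) = f x \<oplus>\<^bsub>N\<^esub> f y) \<and>
    (\<forall>a\<in>carrier A. \<forall>x\<in>carrier M. f (a \<odot>\<^bsub>M\<^esub> x) = a \<odot>\<^bsub>N\<^esub> f x)}"

text \<open>Uniqueness of the coefficient family is meaningful because families are extensional,
  i.e. undefined outside \<open>B\<close>.\<close>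

definition free_basis :: "('a, 'r) ring_scheme \<Rightarrow> ('a, 'b, 'm) module_scheme \<Rightarrow> 'b set \<Rightarrow> bool"
  where "free_basis A M B \<longleftrightarrow> B \<subseteq> carrier M \<and>
    (\<forall>x\<in>carrier M. \<exists>!c. c \<in> B \<rightarrow>\<^sub>E carrier A \<and> finite {b \<in> B. c b \<noteq> \<zero>\<^bsub>A\<^esub>} \<and>
       x = finsum M (\<lambda>b. c b \<odot>\<^bsub>M\<^esub> b) {b \<in> B. c b \<noteq> \<zero>\<^bsub>A\<^esub>})"

definition ideal_mult_module ::
  "('a, 'b, 'm) module_scheme \<Rightarrow> 'a set \<Rightarrow> 'b set"
  where "ideal_mult_module M I =
    generate (add_monoid M) {a \<odot>\<^bsub>M\<^esub> x | a x. a \<in> I \<and> x \<in> carrier M}"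


section \<open>Left ideals and local rings\<close>

definition regular_module :: "('a, 'r) ring_scheme \<Rightarrow> ('a, 'a) module"
  where "regular_module A =
    \<lparr>carrier = carrier A, monoid.mult = monoid.mult A, monoid.one = monoid.one A,
     ring.zero = ring.zero A, ring.add = ring.add A,
     module.smult = monoid.mult A\<rparr>"

definition left_ideal :: "'a set \<Rightarrow> ('a, 'r) ring_scheme \<Rightarrow> bool"
  where "left_ideal I A \<longleftrightarrow> submodule I A (regular_module A)"

definition left_ideal_gen :: "('a, 'r) ring_scheme \<Rightarrow> 'a set \<Rightarrow> 'a set"
  where "left_ideal_gen A S = \<Inter> {I. left_ideal I A \<and> S \<subseteq> I}"

definition maximal_left_ideal :: "'a set \<Rightarrow> ('a, 'r) ring_scheme \<Rightarrow> bool"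
  where "maximal_left_ideal I A \<longleftrightarrow> left_ideal I A \<and> I \<noteq> carrier A \<and>
    (\<forall>J. left_ideal J A \<and> I \<subseteq> J \<longrightarrow> J = I \<or> J = carrier A)"

definition local_ring :: "('a, 'r) ring_scheme \<Rightarrow> bool"
  where "local_ring A \<longleftrightarrow> ring A \<and> (\<exists>!I. maximal_left_ideal I A)"


section \<open>Graded rings and graded modules\<close>

text \<open>Components are only constrained, and only used, at degrees in the carrier of the grading
  monoid.\<close>

record ('a, 'g) gr_ring = "'a ring" +
  rcomp :: "'g \<Rightarrow> 'a set"

record ('a, 'b, 'g) gr_module = "('a, 'b) module" +
  mcomp :: "'g \<Rightarrow> 'b set"

definition direct_decomp :: "('b, 'r) ring_scheme \<Rightarrow> 'g set \<Rightarrow> ('g \<Rightarrow> 'b set) \<Rightarrow> bool"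
  where "direct_decomp M I C \<longleftrightarrow>
    (\<forall>i\<in>I. subgroup (C i) (add_monoid M)) \<and>
    (\<forall>x\<in>carrier M. \<exists>!c. c \<in> (\<Pi>\<^sub>E i\<in>I. C i) \<and> finite {i \<in> I. c i \<noteq> \<zero>\<^bsub>M\<^esub>} \<and>
       x = finsum M c {i \<in> I. c i \<noteq> \<zero>\<^bsub>M\<^esub>})"

definition graded_ring :: "('g, 'k) monoid_scheme \<Rightarrow> ('a, 'g) gr_ring \<Rightarrow> bool"
  where "graded_ring \<Gamma> A \<longleftrightarrow> ring A \<and> direct_decomp A (carrier \<Gamma>) (rcomp A) \<and>
    (\<forall>\<gamma>\<in>carrier \<Gamma>. \<forall>\<delta>\<in>carrier \<Gamma>. \<forall>a\<in>rcomp A \<gamma>. \<forall>b\<in>rcomp A \<delta>.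
       a \<otimes>\<^bsub>A\<^esub> b \<in> rcomp A (\<gamma> \<otimes>\<^bsub>\<Gamma>\<^esub> \<delta>))"

definition graded_module ::
  "('g, 'k) monoid_scheme \<Rightarrow> ('a, 'g) gr_ring \<Rightarrow> ('a, 'b, 'g) gr_module \<Rightarrow> bool"
  where "graded_module \<Gamma> A M \<longleftrightarrow> left_module A M \<and> direct_decomp M (carrier \<Gamma>) (mcomp M) \<and>
    (\<forall>\<gamma>\<in>carrier \<Gamma>. \<forall>\<delta>\<in>carrier \<Gamma>. \<forall>a\<in>rcomp A \<gamma>. \<forall>x\<in>mcomp M \<delta>.
       a \<odot>\<^bsub>M\<^esub> x \<in> mcomp M (\<gamma> \<otimes>\<^bsub>\<Gamma>\<^esub> \<delta>))"

definition homog_ring :: "('g, 'k) monoid_scheme \<Rightarrow> ('a, 'g) gr_ring \<Rightarrow> 'a set"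
  where "homog_ring \<Gamma> A = (\<Union>\<gamma>\<in>carrier \<Gamma>. rcomp A \<gamma>) - {\<zero>\<^bsub>A\<^esub>}"

definition homog_module :: "('g, 'k) monoid_scheme \<Rightarrow> ('a, 'b, 'g) gr_module \<Rightarrow> 'b set"
  where "homog_module \<Gamma> M = (\<Union>\<gamma>\<in>carrier \<Gamma>. mcomp M \<gamma>) - {\<zero>\<^bsub>M\<^esub>}"

definition graded_hom ::
  "('g, 'k) monoid_scheme \<Rightarrow> ('a, 'g) gr_ring \<Rightarrow> ('a, 'b, 'g) gr_module \<Rightarrow> ('a, 'c, 'g) gr_module \<Rightarrow>
   ('b \<Rightarrow> 'c) set"
  where "graded_hom \<Gamma> A M N =
    {f \<in> module_hom A M N. \<forall>\<gamma>\<in>carrier \<Gamma>. f ` mcomp M \<gamma> \<subseteq> mcomp N \<gamma>}"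

text \<open>The two-sided inverse is required to be a graded homomorphism as well.\<close>

definition graded_iso ::
  "('g, 'k) monoid_scheme \<Rightarrow> ('a, 'g) gr_ring \<Rightarrow> ('a, 'b, 'g) gr_module \<Rightarrow> ('a, 'c, 'g) gr_module \<Rightarrow>
   ('b \<Rightarrow> 'c) set"
  where "graded_iso \<Gamma> A M N =
    {f \<in> graded_hom \<Gamma> A M N. \<exists>g\<in>graded_hom \<Gamma> A N M.
       (\<forall>x\<in>carrier M. g (f x) = x) \<and> (\<forall>y\<in>carrier N. f (g y) = y)}"

definition graded_left_ideal ::
  "('g, 'k) monoid_scheme \<Rightarrow> ('a, 'g) gr_ring \<Rightarrow> 'a set \<Rightarrow> bool"
  where "graded_left_ideal \<Gamma> A I \<longleftrightarrow> (\<exists>S \<subseteq> homog_ring \<Gamma> A. I = left_ideal_gen A S)"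

definition left_gr_noetherian :: "('g, 'k) monoid_scheme \<Rightarrow> ('a, 'g) gr_ring \<Rightarrow> bool"
  where "left_gr_noetherian \<Gamma> A \<longleftrightarrow>
    (\<forall>I. graded_left_ideal \<Gamma> A I \<longrightarrow>
       (\<exists>S. finite S \<and> S \<subseteq> carrier A \<and> I = left_ideal_gen A S))"

definition graded_local_ring :: "('g, 'k) monoid_scheme \<Rightarrow> ('a, 'g) gr_ring \<Rightarrow> bool"
  where "graded_local_ring \<Gamma> A \<longleftrightarrow> graded_ring \<Gamma> A \<and> local_ring (A\<lparr>carrier := rcomp A \<one>\<^bsub>\<Gamma>\<^esub>\<rparr>)"

definition max_graded_ideal :: "('g, 'k) monoid_scheme \<Rightarrow> ('a, 'g) gr_ring \<Rightarrow> 'a set"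
  where "max_graded_ideal \<Gamma> A = Idl\<^bsub>A\<^esub> (homog_ring \<Gamma> A - Units A)"


section \<open>Minimal gr-free resolutions\<close>

definition gr_free_finite ::
  "('g, 'k) monoid_scheme \<Rightarrow> ('a, 'g) gr_ring \<Rightarrow> ('a, 'b, 'g) gr_module \<Rightarrow> bool"
  where "gr_free_finite \<Gamma> A F \<longleftrightarrow> graded_module \<Gamma> A F \<and>
    (\<exists>B. finite B \<and> B \<subseteq> homog_module \<Gamma> F \<and> free_basis A F B)"

text \<open>The sequence
  \<open>\<dots> \<rightarrow> F 2 \<rightarrow> F 1 \<rightarrow> F 0 \<rightarrow> M \<rightarrow> 0\<close>
  is given by the augmentation \<open>\<epsilon> : F 0 \<rightarrow> M\<close> and the differentials
  \<open>d n : F (n + 1) \<rightarrow> F n\<close>; thus \<open>\<epsilon>\<close> is the classical \<open>\<phi>\<close> of index \<open>0\<close> and \<open>d n\<close> that of index \<open>n + 1\<close>.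
  All \<open>F n\<close> share one carrier type \<open>'f\<close>; the type \<open>nat \<Rightarrow> 'a\<close> is large enough to contain a copy of every
  free module of finite rank over a ring with elements in \<open>'a\<close>.\<close>

definition minimal_gr_free_resolution ::
  "('g, 'k) monoid_scheme \<Rightarrow> ('a, 'g) gr_ring \<Rightarrow> ('a, 'b, 'g) gr_module \<Rightarrow>
   (nat \<Rightarrow> ('a, 'f, 'g) gr_module) \<Rightarrow> (nat \<Rightarrow> 'f \<Rightarrow> 'f) \<Rightarrow> ('f \<Rightarrow> 'b) \<Rightarrow> bool"
  where "minimal_gr_free_resolution \<Gamma> A M F d \<epsilon> \<longleftrightarrow>
    (\<forall>n. gr_free_finite \<Gamma> A (F n)) \<and>
    \<epsilon> \<in> graded_hom \<Gamma> A (F 0) M \<and>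
    (\<forall>n. d n \<in> graded_hom \<Gamma> A (F (Suc n)) (F n)) \<and>
    \<epsilon> ` carrier (F 0) = carrier M \<and>
    d 0 ` carrier (F 1) = {x \<in> carrier (F 0). \<epsilon> x = \<zero>\<^bsub>M\<^esub>} \<and>
    (\<forall>n. d (Suc n) ` carrier (F (Suc (Suc n))) =
       {x \<in> carrier (F (Suc n)). d n x = \<zero>\<^bsub>F n\<^esub>}) \<and>
    (\<forall>n. d n ` carrier (F (Suc n)) \<subseteq> ideal_mult_module (F n) (max_graded_ideal \<Gamma> A))"

text \<open>A graded isomorphism of resolutions of the same module \<open>M\<close> is a graded isomorphism of the
  augmented complexes that is the identity on \<open>M\<close>.\<close>

definition resolution_iso ::
  "('g, 'k) monoid_scheme \<Rightarrow> ('a, 'g) gr_ring \<Rightarrow>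
   (nat \<Rightarrow> ('a, 'f, 'g) gr_module) \<Rightarrow> (nat \<Rightarrow> 'f \<Rightarrow> 'f) \<Rightarrow> ('f \<Rightarrow> 'b) \<Rightarrow>
   (nat \<Rightarrow> ('a, 'h, 'g) gr_module) \<Rightarrow> (nat \<Rightarrow> 'h \<Rightarrow> 'h) \<Rightarrow> ('h \<Rightarrow> 'b) \<Rightarrow>
   (nat \<Rightarrow> 'f \<Rightarrow> 'h) \<Rightarrow> bool"
  where "resolution_iso \<Gamma> A F d \<epsilon> F' d' \<epsilon>' \<alpha> \<longleftrightarrow>
    (\<forall>n. \<alpha> n \<in> graded_iso \<Gamma> A (F n) (F' n)) \<and>
    (\<forall>x\<in>carrier (F 0). \<epsilon>' (\<alpha> 0 x) = \<epsilon> x) \<and>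
    (\<forall>n. \<forall>x\<in>carrier (F (Suc n)). d' n (\<alpha> (Suc n) x) = \<alpha> n (d n x))"

end

(* Take an irredundant finite family m_1, ..., m_n of homogeneous generators of M, of degrees
   delta_1, ..., delta_n, and map the free module on basis elements of these degrees onto M.  By
   cancellation, a homogeneous component of a relation between the m_i is again a relation, and it
   contains exactly one component (or none) of each coefficient.  A unit among these would express
   some m_i through the others, so the kernel lies in the maximal graded ideal times the free module.
   Because A is gr-Noetherian the kernel is again finitely generated, and the construction can be
   iterated.  For uniqueness, a graded lift between two such covers is surjective by the graded
   Nakayama lemma and splits by freeness; the splitting is itself a lift, hence surjective. *)

theory Submission
  imports Defs
begin

text \<open>Degrees in \<open>\<Gamma>\<close> cannot be divided, so a copy of \<open>A\<close>
  whose basis vector has degree \<open>\<delta>\<close> is graded through the partial operation that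
  sends \<open>\<eta> \<otimes> \<delta>\<close> to \<open>\<eta>\<close>; degrees outside
  \<open>\<Gamma> \<delta>\<close> get the zero component. Left cancellation controls the components
  of a homogeneous scalar times any vector, right cancellation those of any scalar times a
  homogeneous vector. Locality is given only for the part of degree e, and \<open>\<one> - a\<close>
  with \<open>a\<close> in the maximal graded ideal need not be invertible. Invertibility questions
  are therefore moved to degree e, where one-sided inverses turn out to be two-sided. This
  identifies the maximal graded ideal with the set of elements none of whose components is a unit,
  which is the form used for kernels and for Nakayama. The image of a cover may be a proper
  submodule of its target, so that differentials and augmentation are handled by the same lemmas. In
  the inductive step of uniqueness, \<open>d n\<close> is composed with the isomorphism already
  found, so that two covers with the same target and the same image are compared.\<close>

section \<open>Finite sums and additive maps\<close>

lemma (in abelian_group) finsum_in_subgroup: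
  assumes "subgroup H (add_monoid G)" and "\<And>i. i \<in> J \<Longrightarrow> f i \<in> H"
  shows "finsum G f J \<in> H"
proof -
  have H: "H \<subseteq> carrier G" "\<zero> \<in> H" "\<And>x y. x \<in> H \<Longrightarrow> y \<in> H \<Longrightarrow> x \<oplus> y \<in> H"
    using subgroup.subset[OF assms(1)] subgroup.one_closed[OF assms(1)]
      subgroup.m_closed[OF assms(1)] by auto
  show ?thesis
  proof (cases "finite J")
    case True
    then show ?thesis using assms(2)
    proof (induction J)
      case empty then show ?case using H by simp
    next
      case (insert i J)
      then have "f \<in> J \<rightarrow> carrier G" "f i \<in> carrier G" using H by blast+
      then show ?case using insert H by (simp add: finsum_insert)
    qed
  qed (use H in \<open>simp add: finsum_infinite\<close>)
qed

lemma (in abelian_group) additive_zero: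
  assumes "f \<in> carrier M \<rightarrow> carrier G" "abelian_group M"
    and "\<And>x y. x \<in> carrier M \<Longrightarrow> y \<in> carrier M \<Longrightarrow> f (x \<oplus>\<^bsub>M\<^esub> y) = f x \<oplus> f y"
  shows "f \<zero>\<^bsub>M\<^esub> = \<zero>"
proof -
  interpret M: abelian_group M by fact
  have "f \<zero>\<^bsub>M\<^esub> \<oplus> f \<zero>\<^bsub>M\<^esub> = f \<zero>\<^bsub>M\<^esub> \<oplus> \<zero>"
    using assms(3)[of "\<zero>\<^bsub>M\<^esub>" "\<zero>\<^bsub>M\<^esub>"] assms(1) by (auto simp: Pi_iff)
  then show ?thesis using assms(1) by (simp add: Pi_iff)
qed

lemma (in abelian_group) additive_finsum:
  assumes f: "f \<in> carrier M \<rightarrow> carrier G" and "abelian_group M"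
    and add: "\<And>x y. x \<in> carrier M \<Longrightarrow> y \<in> carrier M \<Longrightarrow> f (x \<oplus>\<^bsub>M\<^esub> y) = f x \<oplus> f y"
    and g: "g \<in> J \<rightarrow> carrier M"
  shows "f (finsum M g J) = finsum G (\<lambda>j. f (g j)) J"
proof -
  interpret M: abelian_group M by fact
  show ?thesis
  proof (cases "finite J")
    case True
    then show ?thesis using g
    proof (induction J)
      case empty then show ?case using additive_zero[OF f assms(2) add] by simp
    next
      case (insert j J)
      then have "g \<in> J \<rightarrow> carrier M" "g j \<in> carrier M" by auto
      moreover from this have "(\<lambda>j. f (g j)) \<in> J \<rightarrow> carrier G" "f (g j) \<in> carrier G"
        using f by (auto simp: Pi_iff)
      ultimately show ?case using insert
        by (simp add: finsum_insert M.finsum_insert M.finsum_closed add)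
    qed
  qed (use additive_zero[OF f assms(2) add] in \<open>simp add: finsum_infinite M.finsum_infinite\<close>)
qed

lemma (in abelian_group) finsum_mono_neutral:
  assumes "finite J" "J' \<subseteq> J" "\<And>i. i \<in> J - J' \<Longrightarrow> f i = \<zero>" "f \<in> J \<rightarrow> carrier G"
  shows "finsum G f J' = finsum G f J"
  using add.finprod_mono_neutral_cong_left[of J J' f f] assms by (auto simp: finsum_def Pi_iff)


section \<open>Homogeneous components\<close>

text \<open>The unique family promised by \<open>direct_decomp\<close> becomes a projection operator
  for each degree, so that a grading can be handled as a system of orthogonal additive
  idempotents.\<close>

definition component ::
    "('b, 'r) ring_scheme \<Rightarrow> 'g set \<Rightarrow> ('g \<Rightarrow> 'b set) \<Rightarrow> 'g \<Rightarrow> 'b \<Rightarrow> 'b"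
  where "component M I C i x =
    (THE c. c \<in> (\<Pi>\<^sub>E i\<in>I. C i) \<and> finite {i \<in> I. c i \<noteq> \<zero>\<^bsub>M\<^esub>} \<and>
       x = finsum M c {i \<in> I. c i \<noteq> \<zero>\<^bsub>M\<^esub>}) i"

locale direct_decomposition = abelian_group M for M (structure) +
  fixes I :: "'g set" and C
  assumes decomp: "direct_decomp M I C"
begin

abbreviation \<pi> where "\<pi> \<equiv> component M I C"

lemma C_subgroup: "i \<in> I \<Longrightarrow> subgroup (C i) (add_monoid M)"
  using decomp by (auto simp: direct_decomp_def)

lemma C_closed: "i \<in> I \<Longrightarrow> x \<in> C i \<Longrightarrow> x \<in> carrier M"
  using subgroup.subset[OF C_subgroup] by auto

lemma C_zero: "i \<in> I \<Longrightarrow> \<zero> \<in> C i"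
  using subgroup.one_closed[OF C_subgroup] by auto

lemma C_add: "i \<in> I \<Longrightarrow> x \<in> C i \<Longrightarrow> y \<in> C i \<Longrightarrow> x \<oplus> y \<in> C i"
  using subgroup.m_closed[OF C_subgroup] by auto

lemma component_props:
  assumes "x \<in> carrier M"
  shows "i \<in> I \<Longrightarrow> \<pi> i x \<in> C i"
    and "finite {i \<in> I. \<pi> i x \<noteq> \<zero>}"
    and "finsum M (\<lambda>i. \<pi> i x) {i \<in> I. \<pi> i x \<noteq> \<zero>} = x"
proof -
  let ?P = "\<lambda>c. c \<in> (\<Pi>\<^sub>E i\<in>I. C i) \<and> finite {i \<in> I. c i \<noteq> \<zero>} \<and>
       x = finsum M c {i \<in> I. c i \<noteq> \<zero>}"
  have "\<exists>!c. ?P c" using decomp assms by (auto simp: direct_decomp_def)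
  from theI'[OF this] have "?P (\<lambda>i. \<pi> i x)" by (simp add: component_def)
  then show "i \<in> I \<Longrightarrow> \<pi> i x \<in> C i" "finite {i \<in> I. \<pi> i x \<noteq> \<zero>}"
    "finsum M (\<lambda>i. \<pi> i x) {i \<in> I. \<pi> i x \<noteq> \<zero>} = x" by auto
qed

lemma component_closed: "x \<in> carrier M \<Longrightarrow> i \<in> I \<Longrightarrow> \<pi> i x \<in> carrier M"
  using component_props(1) C_closed by blast

text \<open>Extending \<open>f\<close> by zero to all of \<open>I\<close> gives a family which the
  uniqueness clause of \<open>direct_decomp\<close> must return. Zero values of \<open>f\<close> are
  allowed, so \<open>J\<close> may be any finite set containing the support.\<close>

lemma component_unique:
  assumes J: "finite J" "J \<subseteq> I" and f: "\<And>j. j \<in> J \<Longrightarrow> f j \<in> C j" and i: "i \<in> I"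
  shows "\<pi> i (finsum M f J) = (if i \<in> J then f i else \<zero>)"
proof -
  define x where "x = finsum M f J"
  define c where "c = (\<lambda>i\<in>I. if i \<in> J then f i else \<zero>)"
  define P where "P = (\<lambda>c. c \<in> (\<Pi>\<^sub>E i\<in>I. C i) \<and> finite {i \<in> I. c i \<noteq> \<zero>} \<and>
       x = finsum M c {i \<in> I. c i \<noteq> \<zero>})"
  have fJ: "f \<in> J \<rightarrow> carrier M" using f J C_closed by blast
  have x: "x \<in> carrier M" unfolding x_def using fJ by (rule finsum_closed)
  have S: "{i \<in> I. c i \<noteq> \<zero>} \<subseteq> J" by (auto simp: c_def split: if_splits)
  have "finsum M c {i \<in> I. c i \<noteq> \<zero>} = finsum M c J"
    using J S fJ by (intro finsum_mono_neutral) (auto simp: c_def Pi_iff)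
  also have "\<dots> = x" unfolding x_def
    using J fJ by (intro finsum_cong') (auto simp: c_def Pi_iff)
  finally have "finsum M c {i \<in> I. c i \<noteq> \<zero>} = x" .
  moreover have "c \<in> (\<Pi>\<^sub>E i\<in>I. C i)" using f C_zero by (auto simp: c_def)
  moreover have "finite {i \<in> I. c i \<noteq> \<zero>}" using finite_subset[OF S] J by auto
  ultimately have c: "P c" by (simp add: P_def)
  have "\<exists>!c. P c" using decomp x unfolding P_def direct_decomp_def by blast
  then have "(THE c. P c) = c" using c by blast
  then show ?thesis using i unfolding component_def x_def[symmetric] P_def by (simp add: c_def)
qed

lemma component_same: "i \<in> I \<Longrightarrow> x \<in> C i \<Longrightarrow> \<pi> i x = x"
  using component_unique[of "{i}" "\<lambda>_. x" i] C_closed[of i x] by (simp add: finsum_insert)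

lemma component_other: "i \<in> I \<Longrightarrow> j \<in> I \<Longrightarrow> x \<in> C j \<Longrightarrow> i \<noteq> j \<Longrightarrow> \<pi> i x = \<zero>"
  using component_unique[of "{j}" "\<lambda>_. x" i] C_closed[of j x] by (simp add: finsum_insert)

lemma component_zero: "i \<in> I \<Longrightarrow> \<pi> i \<zero> = \<zero>"
  using component_unique[of "{}" _ i] by simp

lemma component_in_iff: "i \<in> I \<Longrightarrow> x \<in> carrier M \<Longrightarrow> x \<in> C i \<longleftrightarrow> \<pi> i x = x"
  using component_same component_props(1) by metis

lemma sum_components:
  assumes "x \<in> carrier M" "finite J" "J \<subseteq> I" "\<And>i. i \<in> I \<Longrightarrow> i \<notin> J \<Longrightarrow> \<pi> i x = \<zero>"
  shows "finsum M (\<lambda>i. \<pi> i x) J = x"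
proof -
  have "finsum M (\<lambda>i. \<pi> i x) {i \<in> I. \<pi> i x \<noteq> \<zero>} = finsum M (\<lambda>i. \<pi> i x) J"
    using assms component_closed by (intro finsum_mono_neutral) auto
  then show ?thesis using component_props(3)[OF assms(1)] by simp
qed

text \<open>Both elements are expanded over the union of their supports; the termwise sum is then an
  expansion whose terms \<open>component_unique\<close> reads off.\<close>

lemma component_add:
  assumes x: "x \<in> carrier M" and y: "y \<in> carrier M" and i: "i \<in> I"
  shows "\<pi> i (x \<oplus> y) = \<pi> i x \<oplus> \<pi> i y"
proof -
  let ?J = "{i \<in> I. \<pi> i x \<noteq> \<zero>} \<union> {i \<in> I. \<pi> i y \<noteq> \<zero>}"
  have J: "finite ?J" "?J \<subseteq> I" using component_props(2) x y by auto
  have cl: "(\<lambda>i. \<pi> i x) \<in> ?J \<rightarrow> carrier M" "(\<lambda>i. \<pi> i y) \<in> ?J \<rightarrow> carrier M"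
    using x y component_closed by auto
  have "x \<oplus> y = finsum M (\<lambda>i. \<pi> i x) ?J \<oplus> finsum M (\<lambda>i. \<pi> i y) ?J"
    using sum_components[OF x J] sum_components[OF y J] by fastforce
  also have "\<dots> = finsum M (\<lambda>i. \<pi> i x \<oplus> \<pi> i y) ?J"
    using cl by (simp add: finsum_addf)
  finally have "x \<oplus> y = finsum M (\<lambda>i. \<pi> i x \<oplus> \<pi> i y) ?J" .
  moreover have "\<pi> i (finsum M (\<lambda>i. \<pi> i x \<oplus> \<pi> i y) ?J)
      = (if i \<in> ?J then \<pi> i x \<oplus> \<pi> i y else \<zero>)"
    by (rule component_unique[OF J _ i]) (use x y component_props(1) C_add in auto)
  ultimately have "\<pi> i (x \<oplus> y) = (if i \<in> ?J then \<pi> i x \<oplus> \<pi> i y else \<zero>)"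
    by (simp only:)
  then show ?thesis using i x y by (auto simp: component_closed)
qed

lemma component_component:
  "x \<in> carrier M \<Longrightarrow> i \<in> I \<Longrightarrow> j \<in> I \<Longrightarrow> \<pi> i (\<pi> j x) = (if i = j then \<pi> i x else \<zero>)"
  using component_same component_other component_props(1) by metis

lemma component_minus:
  assumes "x \<in> carrier M" "i \<in> I"
  shows "\<pi> i (\<ominus> x) = \<ominus> \<pi> i x"
proof -
  have "\<pi> i (\<ominus> x) \<oplus> \<pi> i x = \<zero>"
    using component_add[of "\<ominus> x" x i] assms component_zero by (simp add: l_neg)
  then show ?thesis using assms component_closed by (simp add: minus_equality)
qed

lemma in_subgroup_of_components:
  assumes "subgroup H (add_monoid M)" "x \<in> carrier M" "\<And>i. i \<in> I \<Longrightarrow> \<pi> i x \<in> H"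
  shows "x \<in> H"
proof -
  have "finsum M (\<lambda>i. \<pi> i x) {i \<in> I. \<pi> i x \<noteq> \<zero>} \<in> H"
    by (rule finsum_in_subgroup[OF assms(1)]) (use assms(3) in auto)
  then show ?thesis by (simp only: component_props(3)[OF assms(2)])
qed

text \<open>Reduces additive statements to homogeneous elements. Nonemptiness of \<open>I\<close>
  provides a component that contains the empty sum.\<close>

lemma homogeneous_induct [consumes 1, case_names add homog]:
  assumes x: "x \<in> carrier M"
    and add: "\<And>x y. x \<in> carrier M \<Longrightarrow> y \<in> carrier M \<Longrightarrow> P x \<Longrightarrow> P y \<Longrightarrow> P (x \<oplus> y)"
    and homog: "\<And>x i. i \<in> I \<Longrightarrow> x \<in> C i \<Longrightarrow> P x"
    and ne: "I \<noteq> {}"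
  shows "P x"
proof -
  have "P (finsum M (\<lambda>i. \<pi> i x) J)" if "finite J" "J \<subseteq> I" for J
    using that
  proof (induction J)
    case empty then show ?case using homog ne C_zero by auto
  next
    case (insert j J)
    then have "(\<lambda>i. \<pi> i x) \<in> J \<rightarrow> carrier M" "\<pi> j x \<in> carrier M" "P (\<pi> j x)"
      using x component_closed component_props(1) homog by (auto simp: Pi_iff subset_iff)
    then show ?case using insert add by (simp add: finsum_insert finsum_closed)
  qed
  from this[of "{i \<in> I. \<pi> i x \<noteq> \<zero>}"] show ?thesis using component_props[OF x] by auto
qed

end

text \<open>Orthogonal additive idempotents that sum pointwise to the identity form a grading with
  their fixed sets as components. Gradings of submodules and of free modules are obtained by
  exhibiting such projections.\<close>

lemma direct_decompI:
  fixes M (structure)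
  assumes M: "abelian_group M"
    and P: "\<And>i. i \<in> I \<Longrightarrow> P i \<in> carrier M \<rightarrow> carrier M"
    and add: "\<And>i x y. i \<in> I \<Longrightarrow> x \<in> carrier M \<Longrightarrow> y \<in> carrier M \<Longrightarrow> P i (x \<oplus> y) = P i x \<oplus> P i y"
    and C: "\<And>i. i \<in> I \<Longrightarrow> C i = {x \<in> carrier M. P i x = x}"
    and PP: "\<And>i j x. i \<in> I \<Longrightarrow> j \<in> I \<Longrightarrow> x \<in> carrier M \<Longrightarrow> P i (P j x) = (if i = j then P i x else \<zero>)"
    and sum: "\<And>x. x \<in> carrier M \<Longrightarrow> \<exists>J. finite J \<and> J \<subseteq> I \<and> (\<forall>i\<in>I - J. P i x = \<zero>) \<and>
                x = finsum M (\<lambda>i. P i x) J"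
  shows "direct_decomp M I C"
    and "i \<in> I \<Longrightarrow> x \<in> carrier M \<Longrightarrow> component M I C i x = P i x"
proof -
  interpret abelian_group M by fact
  have P0: "P i \<zero> = \<zero>" if "i \<in> I" for i
    by (rule additive_zero[OF P[OF that] M]) (use add that in auto)
  have Pcl: "P i x \<in> carrier M" if "i \<in> I" "x \<in> carrier M" for i x using P that by auto
  have PC: "P i x \<in> C i" if "i \<in> I" "x \<in> carrier M" for i x
    using C PP[of i i x] that Pcl by auto
  have PO: "P i x = (if i = j then x else \<zero>)" if "i \<in> I" "j \<in> I" "x \<in> C j" for i j x
    using C PP[of i j x] that by auto
  have ex: "\<exists>!c. c \<in> (\<Pi>\<^sub>E i\<in>I. C i) \<and> finite {i \<in> I. c i \<noteq> \<zero>} \<and>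
       x = finsum M c {i \<in> I. c i \<noteq> \<zero>}" (is "\<exists>!c. ?Q c") if x: "x \<in> carrier M" for x
  proof -
    have 1: "?Q (\<lambda>i\<in>I. P i x)"
    proof -
      obtain J where J: "finite J" "J \<subseteq> I" "\<forall>i\<in>I - J. P i x = \<zero>"
        "x = finsum M (\<lambda>i. P i x) J" using sum[OF x] by blast
      have S: "{i \<in> I. (\<lambda>i\<in>I. P i x) i \<noteq> \<zero>} \<subseteq> J" using J by auto
      have "finsum M (\<lambda>i\<in>I. P i x) {i \<in> I. (\<lambda>i\<in>I. P i x) i \<noteq> \<zero>} = finsum M (\<lambda>i\<in>I. P i x) J"
        using J S x Pcl by (intro finsum_mono_neutral) auto
      also have "\<dots> = finsum M (\<lambda>i. P i x) J"
        using J(1,2) x Pcl by (intro finsum_cong') auto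
      also have "\<dots> = x" using J by simp
      finally show ?thesis using x PC finite_subset[OF S J(1)] by auto
    qed
    have 2: "c = (\<lambda>i\<in>I. P i x)" if c: "?Q c" for c
    proof
      fix i
      let ?J = "{i \<in> I. c i \<noteq> \<zero>}"
      have cc: "c \<in> ?J \<rightarrow> carrier M" using c C by auto
      show "c i = (\<lambda>i\<in>I. P i x) i"
      proof (cases "i \<in> I")
        case i: True
        \<comment> \<open>Applying \<open>P i\<close> to the expansion kills every term except the
          one of index \<open>i\<close>. If \<open>c i\<close> is zero, that term is absent from the
          index set and the whole sum vanishes, as it should.\<close>
        have "P i x = P i (finsum M c ?J)" using c by (elim conjE) metis
        also have "\<dots> = finsum M (\<lambda>j. P i (c j)) ?J"
          by (rule additive_finsum[OF P[OF i] M _ cc]) (use add i in auto)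
        also have "\<dots> = finsum M (\<lambda>j. if i = j then c j else \<zero>) ?J"
          using i c cc by (intro finsum_cong') (auto simp: PO PiE_iff)
        also have "\<dots> = c i"
        proof (cases "i \<in> ?J")
          case True
          then show ?thesis using finsum_singleton[OF True _ cc] c by simp
        next
          case False
          have "finsum M (\<lambda>j. if i = j then c j else \<zero>) ?J = finsum M (\<lambda>j. \<zero>) ?J"
            using False by (intro finsum_cong') auto
          then show ?thesis using False i by (simp add: finsum_zero)
        qed
        finally show ?thesis using i by simp
      qed (use c in auto)
    qed
    show ?thesis using 1 2 by (intro ex1I[of _ "\<lambda>i\<in>I. P i x"])
  qed
  have sg: "subgroup (C i) (add_monoid M)" if i: "i \<in> I" for i
  proof (rule add.subgroupI)
    show "C i \<subseteq> carrier M" "C i \<noteq> {}" using C[OF i] P0[OF i] by auto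
    fix x y assume x: "x \<in> C i" and y: "y \<in> C i"
    show "x \<oplus> y \<in> C i" using x y C[OF i] add[OF i] by auto
    have xm: "x \<in> carrier M" "P i x = x" using x C[OF i] by auto
    then have "P i (\<ominus> x) \<oplus> x = \<zero>" using add[OF i, of "\<ominus> x" x] P0[OF i] by (simp add: l_neg)
    then have "\<ominus> x = P i (\<ominus> x)" using xm Pcl i by (intro minus_equality) auto
    then show "\<ominus> x \<in> C i" using C[OF i] xm by auto
  qed
  show D: "direct_decomp M I C" unfolding direct_decomp_def using ex sg by blast
  interpret direct_decomposition M I C by unfold_locales fact
  show "component M I C i x = P i x" if i: "i \<in> I" and x: "x \<in> carrier M" for i x
  proof -
    obtain J where J: "finite J" "J \<subseteq> I" "\<forall>i\<in>I - J. P i x = \<zero>"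
      "x = finsum M (\<lambda>i. P i x) J" using sum[OF x] by blast
    have "component M I C i (finsum M (\<lambda>i. P i x) J) = (if i \<in> J then P i x else \<zero>)"
      using J PC x i by (intro component_unique) auto
    then show ?thesis using J i by auto
  qed
qed

section \<open>Submodules and spans\<close>

context left_module
begin

lemma smult_zero_left: "x \<in> carrier M \<Longrightarrow> \<zero> \<odot>\<^bsub>M\<^esub> x = \<zero>\<^bsub>M\<^esub>"
  by (rule M.additive_zero[OF _ R.abelian_group_axioms, of "\<lambda>a. a \<odot>\<^bsub>M\<^esub> x"])
    (auto simp: smult_closed smult_l_distr)

lemma smult_zero_right: "a \<in> carrier R \<Longrightarrow> a \<odot>\<^bsub>M\<^esub> \<zero>\<^bsub>M\<^esub> = \<zero>\<^bsub>M\<^esub>"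
  by (rule M.additive_zero[OF _ M.abelian_group_axioms, of "\<lambda>x. a \<odot>\<^bsub>M\<^esub> x"])
    (auto simp: smult_closed smult_r_distr)

lemma smult_minus_one: "x \<in> carrier M \<Longrightarrow> (\<ominus> \<one>) \<odot>\<^bsub>M\<^esub> x = \<ominus>\<^bsub>M\<^esub> x"
  using smult_l_distr[of "\<ominus> \<one>" \<one> x]
  by (simp add: R.l_neg smult_zero_left smult_one smult_closed M.minus_equality)

lemma smult_finsum_right:
  "f \<in> J \<rightarrow> carrier M \<Longrightarrow> a \<in> carrier R \<Longrightarrow>
    a \<odot>\<^bsub>M\<^esub> finsum M f J = finsum M (\<lambda>j. a \<odot>\<^bsub>M\<^esub> f j) J"
  by (rule M.additive_finsum[OF _ M.abelian_group_axioms]) (auto simp: smult_closed smult_r_distr)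

text \<open>Closure under negatives is supplied by the scalar
  \<open>\<ominus> \<one>\<close>.\<close>

lemma submoduleI:
  assumes "N \<subseteq> carrier M" "\<zero>\<^bsub>M\<^esub> \<in> N" "\<And>x y. x \<in> N \<Longrightarrow> y \<in> N \<Longrightarrow> x \<oplus>\<^bsub>M\<^esub> y \<in> N"
    and sm: "\<And>a x. a \<in> carrier R \<Longrightarrow> x \<in> N \<Longrightarrow> a \<odot>\<^bsub>M\<^esub> x \<in> N"
  shows "submodule N R M"
proof -
  have "\<ominus>\<^bsub>M\<^esub> x \<in> N" if "x \<in> N" for x
    using sm[of "\<ominus> \<one>" x] that assms(1) smult_minus_one by auto
  then have "subgroup N (add_monoid M)" using assms by (intro M.add.subgroupI) auto
  then show ?thesis using sm by (simp add: submodule_def submodule_axioms_def)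
qed

lemma submoduleD:
  assumes "submodule N R M"
  shows "N \<subseteq> carrier M" "\<zero>\<^bsub>M\<^esub> \<in> N" "x \<in> N \<Longrightarrow> y \<in> N \<Longrightarrow> x \<oplus>\<^bsub>M\<^esub> y \<in> N"
    "a \<in> carrier R \<Longrightarrow> x \<in> N \<Longrightarrow> a \<odot>\<^bsub>M\<^esub> x \<in> N" "x \<in> N \<Longrightarrow> \<ominus>\<^bsub>M\<^esub> x \<in> N"
    "x \<in> N \<Longrightarrow> x \<in> carrier M" "subgroup N (add_monoid M)"
proof -
  show sg: "subgroup N (add_monoid M)" using assms by (simp add: submodule_def)
  show 1: "N \<subseteq> carrier M" "\<zero>\<^bsub>M\<^esub> \<in> N" "x \<in> N \<Longrightarrow> y \<in> N \<Longrightarrow> x \<oplus>\<^bsub>M\<^esub> y \<in> N"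
    "a \<in> carrier R \<Longrightarrow> x \<in> N \<Longrightarrow> a \<odot>\<^bsub>M\<^esub> x \<in> N"
    using subgroup.subset[OF sg] subgroup.one_closed[OF sg] subgroup.m_closed[OF sg]
      submodule.smult_closed[OF assms] by auto
  then show "x \<in> N \<Longrightarrow> x \<in> carrier M" by auto
  then show "x \<in> N \<Longrightarrow> \<ominus>\<^bsub>M\<^esub> x \<in> N"
    using submodule.smult_closed[OF assms, of "\<ominus> \<one>" x] smult_minus_one by auto
qed

lemma submodule_add_cancel:
  assumes N: "submodule N R M" and x: "x \<in> N" and xy: "x \<oplus>\<^bsub>M\<^esub> y \<in> N" and y: "y \<in> carrier M"
  shows "y \<in> N"
proof -
  have "y = \<ominus>\<^bsub>M\<^esub> x \<oplus>\<^bsub>M\<^esub> (x \<oplus>\<^bsub>M\<^esub> y)"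
    using submoduleD(6)[OF N x] y by (simp add: M.r_neg1)
  then show ?thesis using submoduleD(3,5)[OF N] x xy by metis
qed

lemma carrier_submodule: "submodule (carrier M) R M"
  by (rule submoduleI) (auto simp: smult_closed)

lemma submodule_Int: "submodule N R M \<Longrightarrow> submodule N' R M \<Longrightarrow> submodule (N \<inter> N') R M"
  by (rule submoduleI) (auto dest: submoduleD)

lemma span_superset: "S \<subseteq> module_span R M S"
  by (auto simp: module_span_def)

lemma span_least: "submodule N R M \<Longrightarrow> S \<subseteq> N \<Longrightarrow> module_span R M S \<subseteq> N"
  by (auto simp: module_span_def)

lemma span_submodule:
  assumes "S \<subseteq> carrier M"
  shows "submodule (module_span R M S) R M"
proof (rule submoduleI)
  show "module_span R M S \<subseteq> carrier M"
    using span_least[OF carrier_submodule assms] .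
qed (auto simp: module_span_def dest: submoduleD)

lemma span_mono: "S \<subseteq> T \<Longrightarrow> module_span R M S \<subseteq> module_span R M T"
  by (auto simp: module_span_def)

lemma span_submodule_eq: "submodule N R M \<Longrightarrow> module_span R M N = N"
  using span_superset span_least by blast

lemma span_subset_span:
  "T \<subseteq> carrier M \<Longrightarrow> S \<subseteq> module_span R M T \<Longrightarrow> module_span R M S \<subseteq> module_span R M T"
  by (rule span_least[OF span_submodule])

lemma span_empty: "module_span R M {} = {\<zero>\<^bsub>M\<^esub>}"
proof
  show "module_span R M {} \<subseteq> {\<zero>\<^bsub>M\<^esub>}"
    by (rule span_least[OF submoduleI]) (auto simp: smult_zero_right)
qed (use submoduleD(2)[OF span_submodule] in auto)

text \<open>The submodule \<open>I b + N\<close> for a left ideal \<open>I\<close>. It serves with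
  the whole ring for \<open>I\<close>, to adjoin a generator, and with the maximal graded ideal, in
  the Nakayama argument.\<close>

lemma coset_submodule:
  assumes b: "b \<in> carrier M" and N: "submodule N R M" and I: "submodule I R (regular_module R)"
  shows "submodule {a \<odot>\<^bsub>M\<^esub> b \<oplus>\<^bsub>M\<^esub> y |a y. a \<in> I \<and> y \<in> N} R M"
proof -
  have IR: "I \<subseteq> carrier R" "\<zero> \<in> I" "\<And>x y. x \<in> I \<Longrightarrow> y \<in> I \<Longrightarrow> x \<oplus> y \<in> I"
    using subgroup.subset subgroup.one_closed subgroup.m_closed submodule.axioms(1)[OF I]
    by (fastforce simp: regular_module_def)+
  have IM: "\<And>x y. x \<in> carrier R \<Longrightarrow> y \<in> I \<Longrightarrow> x \<otimes> y \<in> I"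
    using submodule.smult_closed[OF I] by (simp add: regular_module_def)
  note ND = submoduleD[OF N]
  show ?thesis
  proof (rule submoduleI)
    show "{a \<odot>\<^bsub>M\<^esub> b \<oplus>\<^bsub>M\<^esub> y |a y. a \<in> I \<and> y \<in> N} \<subseteq> carrier M"
      using IR ND b by (auto simp: smult_closed subset_iff)
    show "\<zero>\<^bsub>M\<^esub> \<in> {a \<odot>\<^bsub>M\<^esub> b \<oplus>\<^bsub>M\<^esub> y |a y. a \<in> I \<and> y \<in> N}"
      using IR(2) ND(2) b smult_zero_left by force
    fix x x' assume "x \<in> {a \<odot>\<^bsub>M\<^esub> b \<oplus>\<^bsub>M\<^esub> y |a y. a \<in> I \<and> y \<in> N}"
    then obtain a y where 1: "x = a \<odot>\<^bsub>M\<^esub> b \<oplus>\<^bsub>M\<^esub> y" "a \<in> I" "y \<in> N" by auto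
    then have 2: "a \<in> carrier R" "y \<in> carrier M" using IR ND by auto
    {
      assume "x' \<in> {a \<odot>\<^bsub>M\<^esub> b \<oplus>\<^bsub>M\<^esub> y |a y. a \<in> I \<and> y \<in> N}"
      then obtain a' y' where 3: "x' = a' \<odot>\<^bsub>M\<^esub> b \<oplus>\<^bsub>M\<^esub> y'" "a' \<in> I" "y' \<in> N" by auto
      then have 4: "a' \<in> carrier R" "y' \<in> carrier M" using IR ND by auto
      have "x \<oplus>\<^bsub>M\<^esub> x' = (a \<oplus> a') \<odot>\<^bsub>M\<^esub> b \<oplus>\<^bsub>M\<^esub> (y \<oplus>\<^bsub>M\<^esub> y')"
        using 1 2 3 4 b by (simp add: smult_l_distr smult_closed M.a_ac)
      then show "x \<oplus>\<^bsub>M\<^esub> x' \<in> {a \<odot>\<^bsub>M\<^esub> b \<oplus>\<^bsub>M\<^esub> y |a y. a \<in> I \<and> y \<in> N}"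
        using IR(3)[OF 1(2) 3(2)] ND(3)[OF 1(3) 3(3)] by blast
    }
    fix c assume c: "c \<in> carrier R"
    have "c \<odot>\<^bsub>M\<^esub> x = (c \<otimes> a) \<odot>\<^bsub>M\<^esub> b \<oplus>\<^bsub>M\<^esub> c \<odot>\<^bsub>M\<^esub> y"
      using 1 2 c b by (simp add: smult_r_distr smult_assoc smult_closed)
    then show "c \<odot>\<^bsub>M\<^esub> x \<in> {a \<odot>\<^bsub>M\<^esub> b \<oplus>\<^bsub>M\<^esub> y |a y. a \<in> I \<and> y \<in> N}"
      using IM[OF c 1(2)] ND(4)[OF c 1(3)] by blast
  qed
qed

end

lemma (in ring) regular_left_module: "left_module R (regular_module R)"
proof -
  have "abelian_group (regular_module R)"
    by (rule abelian_groupI) (auto simp: regular_module_def a_ac intro: exI[of _ "\<ominus> x" for x] l_neg)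
  then show ?thesis
    by (intro left_module.intro left_module_axioms.intro ring_axioms)
      (auto simp: regular_module_def l_distr r_distr m_assoc)
qed

lemma (in ring) left_ideal_gen_span: "left_ideal_gen R S = module_span R (regular_module R) S"
  by (simp add: left_ideal_gen_def module_span_def left_ideal_def)

text \<open>Splits off one generator, for the inductions over finite generating sets.\<close>

lemma (in left_module) span_insert:
  assumes b: "b \<in> carrier M" and Y: "Y \<subseteq> carrier M"
  shows "module_span R M (insert b Y) =
    {a \<odot>\<^bsub>M\<^esub> b \<oplus>\<^bsub>M\<^esub> y |a y. a \<in> carrier R \<and> y \<in> module_span R M Y}" (is "_ = ?S")
proof
  interpret reg: left_module R "regular_module R" by (rule R.regular_left_module)
  have I: "submodule (carrier R) R (regular_module R)"
    using reg.carrier_submodule by (simp add: regular_module_def)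
  note XD = submoduleD[OF span_submodule[OF Y]]
  show "module_span R M (insert b Y) \<subseteq> ?S"
  proof (rule span_least[OF coset_submodule[OF b span_submodule[OF Y] I]])
    have "b = \<one> \<odot>\<^bsub>M\<^esub> b \<oplus>\<^bsub>M\<^esub> \<zero>\<^bsub>M\<^esub>" using b by (simp add: smult_one)
    then have "b \<in> ?S" using XD(2) R.one_closed by blast
    moreover have "x \<in> ?S" if "x \<in> Y" for x
    proof -
      have "x = \<zero> \<odot>\<^bsub>M\<^esub> b \<oplus>\<^bsub>M\<^esub> x" using b Y that by (auto simp: smult_zero_left)
      then show ?thesis using R.zero_closed span_superset that by blast
    qed
    ultimately show "insert b Y \<subseteq> ?S" by blast
  qed
  have bX: "insert b Y \<subseteq> carrier M" using b Y by auto
  note D = submoduleD[OF span_submodule[OF bX]]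
  have "b \<in> module_span R M (insert b Y)" "module_span R M Y \<subseteq> module_span R M (insert b Y)"
    using span_superset span_mono[of Y "insert b Y"] by blast+
  then show "?S \<subseteq> module_span R M (insert b Y)" using D(3,4) by blast
qed

section \<open>Graded modules over a cancellation monoid\<close>

abbreviation rproj where "rproj \<Gamma> A \<equiv> component A (carrier \<Gamma>) (rcomp A)"
abbreviation mproj where "mproj \<Gamma> M \<equiv> component M (carrier \<Gamma>) (mcomp M)"

text \<open>By right cancellation at most one degree \<open>\<eta>\<close> satisfies \<open>\<gamma> = \<eta> \<delta>\<close>; \<open>shift_proj \<Gamma> A \<delta> \<gamma>\<close> is the
  projection to the component of that degree, so it is the coefficient of degree \<open>\<gamma>\<close> along a basis
  element of degree \<open>\<delta>\<close>.\<close>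

definition shift_proj ::
    "('g, 'k) monoid_scheme \<Rightarrow> ('a, 'g) gr_ring \<Rightarrow> 'g \<Rightarrow> 'g \<Rightarrow> 'a \<Rightarrow> 'a"
  where "shift_proj \<Gamma> A \<delta> \<gamma> a =
    (if \<exists>\<eta>\<in>carrier \<Gamma>. \<gamma> = \<eta> \<otimes>\<^bsub>\<Gamma>\<^esub> \<delta>
     then rproj \<Gamma> A (SOME \<eta>. \<eta> \<in> carrier \<Gamma> \<and> \<gamma> = \<eta> \<otimes>\<^bsub>\<Gamma>\<^esub> \<delta>) a else \<zero>\<^bsub>A\<^esub>)"

locale gr_ring_loc =
  fixes \<Gamma> :: "('g, 'k) monoid_scheme" and A :: "('a, 'g) gr_ring"
  assumes cancel: "monoid_cancel \<Gamma>" and gring: "graded_ring \<Gamma> A"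
begin

sublocale R: ring A using gring by (simp add: graded_ring_def)
sublocale G: monoid_cancel \<Gamma> by (rule cancel)
sublocale AD: direct_decomposition A "carrier \<Gamma>" "rcomp A"
  using gring by unfold_locales (simp add: graded_ring_def)

lemma Gamma_ne: "carrier \<Gamma> \<noteq> {}" using G.one_closed by blast

lemma rcomp_mult:
  "\<gamma> \<in> carrier \<Gamma> \<Longrightarrow> \<delta> \<in> carrier \<Gamma> \<Longrightarrow> a \<in> rcomp A \<gamma> \<Longrightarrow> b \<in> rcomp A \<delta> \<Longrightarrow>
    a \<otimes>\<^bsub>A\<^esub> b \<in> rcomp A (\<gamma> \<otimes>\<^bsub>\<Gamma>\<^esub> \<delta>)"
  using gring by (simp add: graded_ring_def)

text \<open>Right cancellation leaves the choice operator in \<open>shift_proj\<close> a single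
  candidate.\<close>

lemma shift_proj_mult:
  assumes "\<eta> \<in> carrier \<Gamma>" "\<delta> \<in> carrier \<Gamma>"
  shows "shift_proj \<Gamma> A \<delta> (\<eta> \<otimes>\<^bsub>\<Gamma>\<^esub> \<delta>) a = rproj \<Gamma> A \<eta> a"
proof -
  have "(SOME \<eta>'. \<eta>' \<in> carrier \<Gamma> \<and> \<eta> \<otimes>\<^bsub>\<Gamma>\<^esub> \<delta> = \<eta>' \<otimes>\<^bsub>\<Gamma>\<^esub> \<delta>) = \<eta>"
    using assms G.r_cancel by (intro some_equality) auto
  then show ?thesis using assms by (auto simp: shift_proj_def)
qed

lemma shift_proj_other: "\<not> (\<exists>\<eta>\<in>carrier \<Gamma>. \<gamma> = \<eta> \<otimes>\<^bsub>\<Gamma>\<^esub> \<delta>) \<Longrightarrow> shift_proj \<Gamma> A \<delta> \<gamma> a = \<zero>\<^bsub>A\<^esub>"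
  by (auto simp: shift_proj_def)

lemma shift_proj_closed:
  assumes "\<delta> \<in> carrier \<Gamma>" "a \<in> carrier A"
  shows "shift_proj \<Gamma> A \<delta> \<gamma> a \<in> carrier A"
proof (cases "\<exists>\<eta>\<in>carrier \<Gamma>. \<gamma> = \<eta> \<otimes>\<^bsub>\<Gamma>\<^esub> \<delta>")
  case True
  then show ?thesis using assms shift_proj_mult AD.component_closed by auto
qed (simp add: shift_proj_other)

lemma shift_proj_add:
  assumes "\<delta> \<in> carrier \<Gamma>" "a \<in> carrier A" "b \<in> carrier A"
  shows "shift_proj \<Gamma> A \<delta> \<gamma> (a \<oplus>\<^bsub>A\<^esub> b) = shift_proj \<Gamma> A \<delta> \<gamma> a \<oplus>\<^bsub>A\<^esub> shift_proj \<Gamma> A \<delta> \<gamma> b"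
proof (cases "\<exists>\<eta>\<in>carrier \<Gamma>. \<gamma> = \<eta> \<otimes>\<^bsub>\<Gamma>\<^esub> \<delta>")
  case True
  then show ?thesis using assms shift_proj_mult AD.component_add by auto
qed (simp add: shift_proj_other)

text \<open>Distinct degrees in \<open>\<Gamma> \<delta>\<close> come from distinct left factors, so
  orthogonality is inherited from the components of \<open>A\<close>; in degrees outside
  \<open>\<Gamma> \<delta>\<close> everything is zero.\<close>

lemma shift_proj_shift_proj:
  assumes \<delta>: "\<delta> \<in> carrier \<Gamma>" and a: "a \<in> carrier A"
  shows "shift_proj \<Gamma> A \<delta> \<gamma> (shift_proj \<Gamma> A \<delta> \<gamma>' a) =
    (if \<gamma> = \<gamma>' then shift_proj \<Gamma> A \<delta> \<gamma> a else \<zero>\<^bsub>A\<^esub>)"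
proof (cases "\<exists>\<eta>\<in>carrier \<Gamma>. \<gamma> = \<eta> \<otimes>\<^bsub>\<Gamma>\<^esub> \<delta>")
  case True
  then obtain \<eta> where \<eta>: "\<eta> \<in> carrier \<Gamma>" "\<gamma> = \<eta> \<otimes>\<^bsub>\<Gamma>\<^esub> \<delta>" by auto
  show ?thesis
  proof (cases "\<exists>\<eta>\<in>carrier \<Gamma>. \<gamma>' = \<eta> \<otimes>\<^bsub>\<Gamma>\<^esub> \<delta>")
    case True
    then obtain \<eta>' where "\<eta>' \<in> carrier \<Gamma>" "\<gamma>' = \<eta>' \<otimes>\<^bsub>\<Gamma>\<^esub> \<delta>" by auto
    then show ?thesis using \<eta> \<delta> a G.r_cancel shift_proj_mult AD.component_component by auto
  next
    case False
    then have "\<gamma> \<noteq> \<gamma>'" using \<eta> by auto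
    then show ?thesis using False \<eta> \<delta> shift_proj_mult AD.component_zero by (simp add: shift_proj_other)
  qed
qed (auto simp: shift_proj_other)

text \<open>\<open>J\<close> is the support of \<open>a\<close> multiplied on the right by
  \<open>\<delta>\<close>. The last clause admits every larger finite index set, so that several
  coordinates with different twists can be summed over a common one.\<close>

lemma shift_proj_sum:
  assumes \<delta>: "\<delta> \<in> carrier \<Gamma>" and a: "a \<in> carrier A"
  obtains J where "finite J" "J \<subseteq> carrier \<Gamma>" "\<And>\<gamma>. \<gamma> \<notin> J \<Longrightarrow> shift_proj \<Gamma> A \<delta> \<gamma> a = \<zero>\<^bsub>A\<^esub>"
    "\<And>J'. finite J' \<Longrightarrow> J \<subseteq> J' \<Longrightarrow> finsum A (\<lambda>\<gamma>. shift_proj \<Gamma> A \<delta> \<gamma> a) J' = a"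
proof
  let ?S = "{\<eta> \<in> carrier \<Gamma>. rproj \<Gamma> A \<eta> a \<noteq> \<zero>\<^bsub>A\<^esub>}"
  let ?J = "(\<lambda>\<eta>. \<eta> \<otimes>\<^bsub>\<Gamma>\<^esub> \<delta>) ` ?S"
  show fin: "finite ?J" using AD.component_props(2)[OF a] by simp
  show "?J \<subseteq> carrier \<Gamma>" using \<delta> by auto
  show zero: "shift_proj \<Gamma> A \<delta> \<gamma> a = \<zero>\<^bsub>A\<^esub>" if "\<gamma> \<notin> ?J" for \<gamma>
  proof (cases "\<exists>\<eta>\<in>carrier \<Gamma>. \<gamma> = \<eta> \<otimes>\<^bsub>\<Gamma>\<^esub> \<delta>")
    case True
    then obtain \<eta> where \<eta>: "\<eta> \<in> carrier \<Gamma>" "\<gamma> = \<eta> \<otimes>\<^bsub>\<Gamma>\<^esub> \<delta>" by auto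
    with that have "rproj \<Gamma> A \<eta> a = \<zero>\<^bsub>A\<^esub>" by auto
    then show ?thesis using \<eta> \<delta> shift_proj_mult by simp
  qed (simp add: shift_proj_other)
  have inj: "inj_on (\<lambda>\<eta>. \<eta> \<otimes>\<^bsub>\<Gamma>\<^esub> \<delta>) ?S" using \<delta> G.r_cancel by (auto intro!: inj_onI)
  have "finsum A (\<lambda>\<gamma>. shift_proj \<Gamma> A \<delta> \<gamma> a) ?J =
      finsum A (\<lambda>\<eta>. shift_proj \<Gamma> A \<delta> (\<eta> \<otimes>\<^bsub>\<Gamma>\<^esub> \<delta>) a) ?S"
    using inj \<delta> a by (intro R.finsum_reindex) (auto simp: shift_proj_closed)
  also have "\<dots> = finsum A (\<lambda>\<eta>. rproj \<Gamma> A \<eta> a) ?S"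
    using \<delta> a by (intro R.finsum_cong') (auto simp: shift_proj_mult AD.component_closed)
  also have "\<dots> = a" by (rule AD.component_props(3)[OF a])
  finally have sum: "finsum A (\<lambda>\<gamma>. shift_proj \<Gamma> A \<delta> \<gamma> a) ?J = a" .
  show "finsum A (\<lambda>\<gamma>. shift_proj \<Gamma> A \<delta> \<gamma> a) J' = a" if J': "finite J'" "?J \<subseteq> J'" for J'
  proof -
    have "finsum A (\<lambda>\<gamma>. shift_proj \<Gamma> A \<delta> \<gamma> a) ?J = finsum A (\<lambda>\<gamma>. shift_proj \<Gamma> A \<delta> \<gamma> a) J'"
      by (rule R.finsum_mono_neutral[OF J']) (use zero shift_proj_closed[OF \<delta> a] in auto)
    then show ?thesis using sum by (simp only:)
  qed
qed

end

text \<open>Gradedness is expressed by closure under components instead of by homogeneous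
  generators; this form passes directly to kernels, images and intersections.\<close>

definition graded_submodule ::
    "('g, 'k) monoid_scheme \<Rightarrow> ('a, 'g) gr_ring \<Rightarrow> ('a, 'b, 'g) gr_module \<Rightarrow> 'b set \<Rightarrow> bool"
  where "graded_submodule \<Gamma> A M N \<longleftrightarrow>
    submodule N A M \<and> (\<forall>x\<in>N. \<forall>\<gamma>\<in>carrier \<Gamma>. mproj \<Gamma> M \<gamma> x \<in> N)"

locale gr_mod_loc = gr_ring_loc \<Gamma> A for \<Gamma> :: "('g, 'k) monoid_scheme" and A :: "('a, 'g) gr_ring" +
  fixes M :: "('a, 'b, 'g) gr_module"
  assumes gmod: "graded_module \<Gamma> A M"
begin

sublocale left_module A M using gmod by (simp add: graded_module_def)
sublocale MD: direct_decomposition M "carrier \<Gamma>" "mcomp M"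
  using gmod by unfold_locales (simp add: graded_module_def)

lemma mcomp_smult:
  "\<gamma> \<in> carrier \<Gamma> \<Longrightarrow> \<delta> \<in> carrier \<Gamma> \<Longrightarrow> a \<in> rcomp A \<gamma> \<Longrightarrow> x \<in> mcomp M \<delta> \<Longrightarrow>
    a \<odot>\<^bsub>M\<^esub> x \<in> mcomp M (\<gamma> \<otimes>\<^bsub>\<Gamma>\<^esub> \<delta>)"
  using gmod by (simp add: graded_module_def)

lemma homog_closed: "x \<in> homog_module \<Gamma> M \<Longrightarrow> x \<in> carrier M"
  by (auto simp: homog_module_def MD.C_closed)

text \<open>By left cancellation, multiplication by an element of degree \<open>\<gamma>\<close>
  sends different degrees to different degrees, so nothing but the \<open>\<delta>\<close> component
  of \<open>x\<close> reaches degree \<open>\<gamma> \<otimes> \<delta>\<close>.\<close>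

lemma mproj_homog_smult:
  assumes \<gamma>: "\<gamma> \<in> carrier \<Gamma>" and \<delta>: "\<delta> \<in> carrier \<Gamma>" and a: "a \<in> rcomp A \<gamma>" and x: "x \<in> carrier M"
  shows "mproj \<Gamma> M (\<gamma> \<otimes>\<^bsub>\<Gamma>\<^esub> \<delta>) (a \<odot>\<^bsub>M\<^esub> x) = a \<odot>\<^bsub>M\<^esub> mproj \<Gamma> M \<delta> x"
  using x
proof (induction x rule: MD.homogeneous_induct)
  case (add x y)
  then show ?case using \<gamma> \<delta> AD.C_closed[OF \<gamma> a]
    by (simp add: smult_r_distr MD.component_add smult_closed MD.component_closed)
next
  case (homog x \<delta>')
  note ax = mcomp_smult[OF \<gamma> homog(1) a homog(2)]
  show ?case
  proof (cases "\<delta> = \<delta>'")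
    case True
    then show ?thesis using MD.component_same[OF _ ax] MD.component_same[OF homog] \<gamma> \<delta> by simp
  next
    case False
    then have "\<gamma> \<otimes>\<^bsub>\<Gamma>\<^esub> \<delta> \<noteq> \<gamma> \<otimes>\<^bsub>\<Gamma>\<^esub> \<delta>'" using G.l_cancel \<gamma> \<delta> homog by blast
    then show ?thesis using MD.component_other[OF _ _ ax] MD.component_other[OF \<delta> homog(1,2)]
        False \<gamma> \<delta> homog AD.C_closed[OF \<gamma> a] by (simp add: smult_zero_right)
  qed
qed (rule Gamma_ne)

lemma mproj_homog_smult_other:
  assumes \<gamma>: "\<gamma> \<in> carrier \<Gamma>" and \<epsilon>: "\<epsilon> \<in> carrier \<Gamma>" and a: "a \<in> rcomp A \<gamma>" and x: "x \<in> carrier M"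
    and no: "\<not> (\<exists>\<delta>\<in>carrier \<Gamma>. \<epsilon> = \<gamma> \<otimes>\<^bsub>\<Gamma>\<^esub> \<delta>)"
  shows "mproj \<Gamma> M \<epsilon> (a \<odot>\<^bsub>M\<^esub> x) = \<zero>\<^bsub>M\<^esub>"
  using x
proof (induction x rule: MD.homogeneous_induct)
  case (add x y)
  then show ?case using \<gamma> \<epsilon> AD.C_closed[OF \<gamma> a]
    by (simp add: smult_r_distr MD.component_add smult_closed)
next
  case (homog x \<delta>')
  note ax = mcomp_smult[OF \<gamma> homog(1) a homog(2)]
  then show ?case using MD.component_other[OF \<epsilon> _ ax] no \<gamma> homog by auto
qed (rule Gamma_ne)

text \<open>The counterpart for a homogeneous vector, resting on right cancellation. It is why a
  homogeneous part of a linear relation between homogeneous vectors involves at most one component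
  of each coefficient.\<close>

lemma mproj_smult_homog:
  assumes \<delta>: "\<delta> \<in> carrier \<Gamma>" and \<gamma>: "\<gamma> \<in> carrier \<Gamma>" and x: "x \<in> mcomp M \<delta>" and a: "a \<in> carrier A"
  shows "mproj \<Gamma> M \<gamma> (a \<odot>\<^bsub>M\<^esub> x) = shift_proj \<Gamma> A \<delta> \<gamma> a \<odot>\<^bsub>M\<^esub> x"
  using a
proof (induction a rule: AD.homogeneous_induct)
  case (add a b)
  then show ?case using \<gamma> \<delta> MD.C_closed[OF \<delta> x]
    by (simp add: smult_l_distr MD.component_add smult_closed shift_proj_add shift_proj_closed)
next
  case (homog a \<eta>)
  note ax = mcomp_smult[OF homog(1) \<delta> homog(2) x]
  have xM: "x \<in> carrier M" using MD.C_closed[OF \<delta> x] .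
  show ?case
  proof (cases "\<exists>\<eta>\<in>carrier \<Gamma>. \<gamma> = \<eta> \<otimes>\<^bsub>\<Gamma>\<^esub> \<delta>")
    case True
    then obtain \<eta>' where \<eta>': "\<eta>' \<in> carrier \<Gamma>" "\<gamma> = \<eta>' \<otimes>\<^bsub>\<Gamma>\<^esub> \<delta>" by auto
    then have sp: "shift_proj \<Gamma> A \<delta> \<gamma> a = rproj \<Gamma> A \<eta>' a" using \<delta> shift_proj_mult by simp
    show ?thesis
    proof (cases "\<eta> = \<eta>'")
      case True
      then show ?thesis using sp AD.component_same[OF homog] MD.component_same[OF \<gamma>] ax \<eta>' by simp
    next
      case False
      then have "\<gamma> \<noteq> \<eta> \<otimes>\<^bsub>\<Gamma>\<^esub> \<delta>" using \<eta>' homog \<delta> G.r_cancel by blast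
      moreover have "\<eta>' \<noteq> \<eta>" using False by simp
      ultimately show ?thesis using sp AD.component_other[OF \<eta>'(1) homog] MD.component_other[OF \<gamma> _ ax]
          homog \<delta> xM by (simp add: smult_zero_left)
    qed
  next
    case False
    then have "\<gamma> \<noteq> \<eta> \<otimes>\<^bsub>\<Gamma>\<^esub> \<delta>" using homog by blast
    then show ?thesis using shift_proj_other[OF False] MD.component_other[OF \<gamma> _ ax] homog \<delta> xM
      by (simp add: smult_zero_left)
  qed
qed (rule Gamma_ne)

text \<open>The elements of the span with all components in the span form a submodule: for a
  homogeneous scalar each component of the product is zero or the scalar times a component, and
  general scalars follow by additivity. The generators need not be homogeneous, so the union of a
  graded submodule with homogeneous elements is covered too.\<close>

lemma span_graded:
  assumes YM: "Y \<subseteq> carrier M"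
    and Y: "\<And>y \<gamma>. y \<in> Y \<Longrightarrow> \<gamma> \<in> carrier \<Gamma> \<Longrightarrow> mproj \<Gamma> M \<gamma> y \<in> module_span A M Y"
  shows "graded_submodule \<Gamma> A M (module_span A M Y)"
proof -
  note D = submoduleD[OF span_submodule[OF YM]]
  let ?N = "{x \<in> module_span A M Y. \<forall>\<gamma>\<in>carrier \<Gamma>. mproj \<Gamma> M \<gamma> x \<in> module_span A M Y}"
  have sm: "a \<odot>\<^bsub>M\<^esub> x \<in> ?N" if a: "a \<in> carrier A" and x: "x \<in> ?N" for a x
    using a
  proof (induction a rule: AD.homogeneous_induct)
    case (add a b)
    then show ?case using x D by (auto simp: smult_l_distr smult_closed MD.component_add)
  next
    case (homog a \<eta>)
    note aA = AD.C_closed[OF homog]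
    have "mproj \<Gamma> M \<gamma> (a \<odot>\<^bsub>M\<^esub> x) \<in> module_span A M Y" if \<gamma>: "\<gamma> \<in> carrier \<Gamma>" for \<gamma>
    proof (cases "\<exists>\<delta>\<in>carrier \<Gamma>. \<gamma> = \<eta> \<otimes>\<^bsub>\<Gamma>\<^esub> \<delta>")
      case True
      then show ?thesis using mproj_homog_smult[OF homog(1) _ homog(2)] x D aA by auto
    next
      case False
      then show ?thesis using mproj_homog_smult_other[OF homog(1) \<gamma> homog(2) _ False] x D by auto
    qed
    then show ?case using x D aA by auto
  qed (rule Gamma_ne)
  have "submodule ?N A M"
    by (rule submoduleI) (use sm D in \<open>auto simp: MD.component_zero MD.component_add\<close>)
  moreover have "Y \<subseteq> ?N" using Y span_superset by blast
  ultimately have "module_span A M Y \<subseteq> ?N" by (rule span_least)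
  then show ?thesis using span_submodule[OF YM] by (auto simp: graded_submodule_def)
qed

lemma homog_span_graded:
  "Y \<subseteq> homog_module \<Gamma> M \<Longrightarrow> graded_submodule \<Gamma> A M (module_span A M Y)"
proof (rule span_graded)
  assume Y: "Y \<subseteq> homog_module \<Gamma> M"
  then show YM: "Y \<subseteq> carrier M" using homog_closed by auto
  fix y \<gamma> assume y: "y \<in> Y" and \<gamma>: "\<gamma> \<in> carrier \<Gamma>"
  then obtain \<delta> where \<delta>: "\<delta> \<in> carrier \<Gamma>" "y \<in> mcomp M \<delta>" using Y by (auto simp: homog_module_def)
  have "y \<in> module_span A M Y" using y span_superset by blast
  then show "mproj \<Gamma> M \<gamma> y \<in> module_span A M Y"
    using MD.component_same[OF \<delta>] MD.component_other[OF \<gamma> \<delta>] submoduleD(2)[OF span_submodule[OF YM]]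
    by (cases "\<gamma> = \<delta>") auto
qed

lemma graded_submodule_Int:
  "graded_submodule \<Gamma> A M N \<Longrightarrow> graded_submodule \<Gamma> A M N' \<Longrightarrow> graded_submodule \<Gamma> A M (N \<inter> N')"
  by (auto simp: graded_submodule_def submodule_Int)

text \<open>The nonzero components of finitely many generators generate; zero components are dropped
  because homogeneous elements are nonzero by definition.\<close>

lemma fin_gen_homog:
  assumes "fin_gen_module A M"
  obtains Y where "finite Y" "Y \<subseteq> homog_module \<Gamma> M" "module_span A M Y = carrier M"
proof -
  obtain S where S: "finite S" "S \<subseteq> carrier M" "module_span A M S = carrier M"
    using assms by (auto simp: fin_gen_module_def)
  define Y where "Y = (\<Union>s\<in>S. (\<lambda>\<gamma>. mproj \<Gamma> M \<gamma> s) ` {\<gamma>\<in>carrier \<Gamma>. mproj \<Gamma> M \<gamma> s \<noteq> \<zero>\<^bsub>M\<^esub>})"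
  have fin: "finite Y" unfolding Y_def using S MD.component_props(2) by auto
  have hom: "Y \<subseteq> homog_module \<Gamma> M"
  proof
    fix y assume "y \<in> Y"
    then obtain s \<gamma> where "s \<in> S" "\<gamma> \<in> carrier \<Gamma>" "y = mproj \<Gamma> M \<gamma> s" "y \<noteq> \<zero>\<^bsub>M\<^esub>"
      by (auto simp: Y_def)
    then show "y \<in> homog_module \<Gamma> M"
      using S(2) MD.component_props(1)[of s \<gamma>] by (auto simp: homog_module_def)
  qed
  have YM: "Y \<subseteq> carrier M" using hom homog_closed by auto
  note D = submoduleD[OF span_submodule[OF YM]]
  have "s \<in> module_span A M Y" if s: "s \<in> S" for s
  proof (rule MD.in_subgroup_of_components[OF D(7)])
    fix \<gamma> assume \<gamma>: "\<gamma> \<in> carrier \<Gamma>"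
    show "mproj \<Gamma> M \<gamma> s \<in> module_span A M Y"
    proof (cases "mproj \<Gamma> M \<gamma> s = \<zero>\<^bsub>M\<^esub>")
      case False
      then have "mproj \<Gamma> M \<gamma> s \<in> Y" unfolding Y_def using s \<gamma> by blast
      then show ?thesis using span_superset by blast
    qed (use D in simp)
  qed (use s S in auto)
  then have "carrier M \<subseteq> module_span A M Y"
    using span_subset_span[OF YM, of S] S by auto
  then have "module_span A M Y = carrier M" using D(1) by auto
  then show ?thesis using that fin hom by blast
qed

end

section \<open>Local rings and graded local rings\<close>

text \<open>Zorn's lemma among the left ideals that avoid \<open>\<one>\<close>, which are exactly
  the proper ones; the union of a nonempty chain avoids \<open>\<one>\<close> as well.\<close>

lemma (in ring) maximal_left_ideal_exists:
  assumes I: "left_ideal I R" "\<one> \<notin> I"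
  shows "\<exists>J. maximal_left_ideal J R \<and> I \<subseteq> J"
proof -
  interpret reg: left_module R "regular_module R" by (rule regular_left_module)
  have [simp]: "carrier (regular_module R) = carrier R" "ring.zero (regular_module R) = \<zero>"
    "ring.add (regular_module R) = ring.add R" "module.smult (regular_module R) = monoid.mult R"
    by (auto simp: regular_module_def)
  let ?A = "{J. left_ideal J R \<and> I \<subseteq> J \<and> \<one> \<notin> J}"
  note D = reg.submoduleD[unfolded left_ideal_def[symmetric], simplified]
  have whole: "J = carrier R" if J: "left_ideal J R" "\<one> \<in> J" for J
  proof
    show "J \<subseteq> carrier R" using D(1)[OF J(1)] .
    show "carrier R \<subseteq> J" using D(4)[OF J(1) _ J(2)] by force
  qed
  have "\<exists>N\<in>?A. \<forall>J\<in>?A. N \<subseteq> J \<longrightarrow> J = N"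
  proof (rule subset_Zorn_nonempty)
    show "?A \<noteq> {}" using I by auto
    fix C assume C: "C \<noteq> {}" "subset.chain ?A C"
    have CA: "\<And>J. J \<in> C \<Longrightarrow> J \<in> ?A" using C(2) by (auto simp: subset.chain_def)
    have tot: "\<And>J K. J \<in> C \<Longrightarrow> K \<in> C \<Longrightarrow> J \<subseteq> K \<or> K \<subseteq> J"
      using C(2) by (auto simp: subset.chain_def)
    have "left_ideal (\<Union>C) R" unfolding left_ideal_def
    proof (rule reg.submoduleI, simp_all)
      show "\<Union>C \<subseteq> carrier R" using CA D(1) by blast
      show "\<exists>J\<in>C. \<zero> \<in> J" using CA D(2) C(1) by blast
      show "\<exists>J\<in>C. a \<otimes> x \<in> J" if "a \<in> carrier R" "\<exists>J\<in>C. x \<in> J" for a x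
        using CA D(4) that by blast
      fix x y assume "\<exists>J\<in>C. x \<in> J" "\<exists>J\<in>C. y \<in> J"
      then obtain J K where JK: "J \<in> C" "x \<in> J" "K \<in> C" "y \<in> K" by auto
      from tot[OF JK(1,3)] show "\<exists>J\<in>C. x \<oplus> y \<in> J"
      proof
        assume "J \<subseteq> K" then show ?thesis using JK D(3)[of K x y] CA by blast
      next
        assume "K \<subseteq> J" then show ?thesis using JK D(3)[of J x y] CA by blast
      qed
    qed
    then show "\<Union>C \<in> ?A" using CA C(1) by blast
  qed
  then obtain N where N: "N \<in> ?A" "\<forall>J\<in>?A. N \<subseteq> J \<longrightarrow> J = N" by (rule bexE)
  have "maximal_left_ideal N R" unfolding maximal_left_ideal_def
  proof (intro conjI allI impI)
    show "left_ideal N R" "N \<noteq> carrier R" using N(1) by auto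
    fix J assume "left_ideal J R \<and> N \<subseteq> J"
    then have J: "left_ideal J R" "N \<subseteq> J" by auto
    show "J = N \<or> J = carrier R"
    proof (cases "\<one> \<in> J")
      case False
      then have "J \<in> ?A" using J N(1) by auto
      then show ?thesis using N(2) J(2) by auto
    qed (use whole[OF J(1)] in simp)
  qed
  then show ?thesis using N(1) by auto
qed

text \<open>Locality is defined by maximal left ideals only, which yields left inverses outside
  \<open>m\<close>: a left ideal \<open>R x\<close> without \<open>\<one>\<close> would lie in a
  maximal one, hence in \<open>m\<close>. The work is to show that these inverses are
  two-sided.\<close>

lemma local_ring_nonunits:
  fixes R (structure)
  assumes "local_ring R"
  obtains m where "left_ideal m R" "\<one> \<notin> m" "carrier R - Units R \<subseteq> m"
proof -
  interpret ring R using assms by (simp add: local_ring_def)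
  interpret reg: left_module R "regular_module R" by (rule regular_left_module)
  have [simp]: "carrier (regular_module R) = carrier R" "ring.zero (regular_module R) = \<zero>"
    "ring.add (regular_module R) = ring.add R" "module.smult (regular_module R) = monoid.mult R"
    by (auto simp: regular_module_def)
  note D = reg.submoduleD[unfolded left_ideal_def[symmetric], simplified]
  obtain m where m: "maximal_left_ideal m R" and uniq: "\<And>J. maximal_left_ideal J R \<Longrightarrow> J = m"
    using assms by (auto simp: local_ring_def)
  have mi: "left_ideal m R" and mne: "m \<noteq> carrier R" using m by (auto simp: maximal_left_ideal_def)
  have one: "\<one> \<notin> m"
  proof
    assume "\<one> \<in> m"
    then have "carrier R \<subseteq> m" using D(4)[OF mi, of _ "\<one>"] by force
    then show False using mne D(1)[OF mi] by auto
  qed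
  have linv: "\<exists>y\<in>carrier R. y \<otimes> x = \<one>" if x: "x \<in> carrier R" "x \<notin> m" for x
  proof -
    let ?I = "{y \<otimes> x |y. y \<in> carrier R}"
    have I: "left_ideal ?I R" unfolding left_ideal_def
    proof (rule reg.submoduleI, simp_all)
      show "?I \<subseteq> carrier R" using x by auto
      show "\<exists>y. \<zero> = y \<otimes> x \<and> y \<in> carrier R" using x by (intro exI[of _ \<zero>]) auto
      fix u v assume "\<exists>y. u = y \<otimes> x \<and> y \<in> carrier R" "\<exists>y. v = y \<otimes> x \<and> y \<in> carrier R"
      then obtain y z where "u = y \<otimes> x" "y \<in> carrier R" "v = z \<otimes> x" "z \<in> carrier R" by auto
      then show "\<exists>y. u \<oplus> v = y \<otimes> x \<and> y \<in> carrier R"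
        using x by (intro exI[of _ "y \<oplus> z"]) (auto simp: l_distr)
    next
      fix u v assume "u \<in> carrier R" "\<exists>y. v = y \<otimes> x \<and> y \<in> carrier R"
      then obtain z where "u \<in> carrier R" "v = z \<otimes> x" "z \<in> carrier R" by auto
      then show "\<exists>y. u \<otimes> v = y \<otimes> x \<and> y \<in> carrier R"
        using x by (intro exI[of _ "u \<otimes> z"]) (auto simp: m_assoc)
    qed
    have "x = \<one> \<otimes> x" using x by simp
    then have "x \<in> ?I" using one_closed by blast
    then have "\<not> ?I \<subseteq> m" using x by blast
    then have "\<one> \<in> ?I" using maximal_left_ideal_exists[OF I] uniq by blast
    then show ?thesis by auto
  qed
  have "x \<in> Units R" if x: "x \<in> carrier R" "x \<notin> m" for x
  proof -
    obtain y where y: "y \<in> carrier R" "y \<otimes> x = \<one>" using linv[OF x] by auto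
    \<comment> \<open>If \<open>y\<close> were in \<open>m\<close>, then \<open>x y\<close> would be
      too, and \<open>\<one> - x y\<close> would be left invertible. But
      \<open>(\<one> - x y) x = 0\<close> because \<open>y x = \<one>\<close>, so \<open>x\<close>
      would be zero and lie in \<open>m\<close>.\<close>
    have "y \<notin> m"
    proof
      assume "y \<in> m"
      then have xy: "x \<otimes> y \<in> m" using D(4)[OF mi] x by auto
      have "\<one> \<ominus> x \<otimes> y \<notin> m"
      proof
        assume "\<one> \<ominus> x \<otimes> y \<in> m"
        then have "(\<one> \<ominus> x \<otimes> y) \<oplus> x \<otimes> y \<in> m" using D(3)[OF mi] xy by auto
        moreover have "(\<one> \<ominus> x \<otimes> y) \<oplus> x \<otimes> y = \<one>" using x y by (simp add: minus_eq a_assoc l_neg)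
        ultimately show False using one by simp
      qed
      then obtain z where z: "z \<in> carrier R" "z \<otimes> (\<one> \<ominus> x \<otimes> y) = \<one>"
        using linv[of "\<one> \<ominus> x \<otimes> y"] x y by auto
      have "(\<one> \<ominus> x \<otimes> y) \<otimes> x = x \<ominus> x \<otimes> (y \<otimes> x)"
        using x y by (simp add: minus_eq l_distr l_minus m_assoc)
      also have "\<dots> = \<zero>" using x y by (simp add: minus_eq r_neg)
      finally have "z \<otimes> ((\<one> \<ominus> x \<otimes> y) \<otimes> x) = \<zero>" using z by simp
      moreover have "z \<otimes> ((\<one> \<ominus> x \<otimes> y) \<otimes> x) = x"
        using z x y by (simp add: m_assoc[symmetric])
      ultimately show False using x D(2)[OF mi] by simp
    qed
    then obtain w where w: "w \<in> carrier R" "w \<otimes> y = \<one>" using linv y by auto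
    \<comment> \<open>\<open>y\<close> now has the left inverse \<open>w\<close> and the right
      inverse \<open>x\<close>, so the two agree.\<close>
    have "w = w \<otimes> (y \<otimes> x)" using w y by simp
    also have "\<dots> = w \<otimes> y \<otimes> x" using w(1) y(1) x by (simp only: m_assoc)
    also have "\<dots> = x" using w x by simp
    finally have "x \<otimes> y = \<one>" using w by simp
    then show ?thesis using y x by (auto simp: Units_def)
  qed
  then show ?thesis using that[OF mi one] by auto
qed

text \<open>Two nonunits lie in the proper left ideal \<open>m\<close>; so does their sum, and a
  proper left ideal contains no unit.\<close>

lemma local_ring_unit_add:
  fixes R (structure)
  assumes loc: "local_ring R" and x: "x \<in> carrier R" and y: "y \<in> carrier R" and u: "x \<oplus> y \<in> Units R"
  shows "x \<in> Units R \<or> y \<in> Units R"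
proof (rule ccontr)
  assume no: "\<not> ?thesis"
  interpret ring R using loc by (simp add: local_ring_def)
  interpret reg: left_module R "regular_module R" by (rule regular_left_module)
  obtain m where m: "left_ideal m R" "\<one> \<notin> m" "carrier R - Units R \<subseteq> m"
    using local_ring_nonunits[OF loc] .
  note D = reg.submoduleD[OF m(1)[unfolded left_ideal_def]]
  have "x \<oplus> y \<in> m" using D(3)[of x y] no m x y by (auto simp: regular_module_def)
  then have "inv (x \<oplus> y) \<otimes> (x \<oplus> y) \<in> m"
    using D(4)[of "inv (x \<oplus> y)" "x \<oplus> y"] Units_inv_closed[OF u]
    by (simp add: regular_module_def del: Units_l_inv)
  then show False using u m by simp
qed

lemma local_ring_one_not_zero:
  fixes R (structure)
  assumes loc: "local_ring R"
  shows "\<one> \<noteq> \<zero>"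
proof
  assume eq: "\<one> = \<zero>"
  interpret ring R using loc by (simp add: local_ring_def)
  interpret reg: left_module R "regular_module R" by (rule regular_left_module)
  obtain m where m: "left_ideal m R" "\<one> \<notin> m" using local_ring_nonunits[OF loc] .
  then show False using reg.submoduleD(2)[OF m(1)[unfolded left_ideal_def]] eq
    by (auto simp: regular_module_def)
qed

text \<open>With \<open>A\<close> as a graded module over itself, the formulas for components of
  scalar multiples become formulas for components of products.\<close>

definition regular_gr_module :: "('a, 'g) gr_ring \<Rightarrow> ('a, 'a, 'g) gr_module"
  where "regular_gr_module A =
    \<lparr>carrier = carrier A, monoid.mult = monoid.mult A, monoid.one = monoid.one A,
     ring.zero = ring.zero A, ring.add = ring.add A,
     module.smult = monoid.mult A, mcomp = rcomp A\<rparr>"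

text \<open>The additive monoids of \<open>A\<close> and of its regular graded module differ only in
  the extension slot of the record, which \<open>subgroup\<close> does not inspect.\<close>

lemma subgroup_more_cong:
  "subgroup H \<lparr>carrier = C, monoid.mult = m, one = z, \<dots> = u\<rparr> =
    subgroup H \<lparr>carrier = C, monoid.mult = m, one = z, \<dots> = v\<rparr>"
  by (simp add: subgroup_def m_inv_def)

lemma regular_gr_module_simps [simp]:
  "carrier (regular_gr_module A) = carrier A" "ring.zero (regular_gr_module A) = ring.zero A"
  "ring.add (regular_gr_module A) = ring.add A" "module.smult (regular_gr_module A) = monoid.mult A"
  "mcomp (regular_gr_module A) = rcomp A" "finsum (regular_gr_module A) = finsum A"
  by (auto simp: regular_gr_module_def finsum_def finprod_def fun_eq_iff)

lemma component_regular [simp]: "component (regular_gr_module A) = component A"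
  by (intro ext) (simp add: component_def)

lemma (in gr_ring_loc) regular_gr_module: "graded_module \<Gamma> A (regular_gr_module A)"
proof -
  have "abelian_group (regular_gr_module A)"
    by (rule abelian_groupI) (auto simp: R.a_ac intro: bexI[of _ "\<ominus>\<^bsub>A\<^esub> x" for x] R.l_neg)
  then have "left_module A (regular_gr_module A)"
    by (intro left_module.intro left_module_axioms.intro R.ring_axioms)
      (auto simp: R.l_distr R.r_distr R.m_assoc)
  moreover have "subgroup (rcomp A \<gamma>) (add_monoid (regular_gr_module A))" if "\<gamma> \<in> carrier \<Gamma>" for \<gamma>
    using AD.C_subgroup[OF that] by (subst (asm) subgroup_more_cong) simp
  ultimately show ?thesis
    using gring unfolding graded_module_def graded_ring_def direct_decomp_def regular_gr_module_simps
    by blast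
qed

section \<open>Homogeneous units and the maximal graded ideal\<close>

locale gr_local_loc = gr_ring_loc \<Gamma> A for \<Gamma> :: "('g, 'k) monoid_scheme" and A :: "('a, 'g) gr_ring" +
  assumes gr_local: "graded_local_ring \<Gamma> A"
begin

sublocale reg: gr_mod_loc \<Gamma> A "regular_gr_module A"
  using regular_gr_module by unfold_locales

lemmas rproj_homog_mult = reg.mproj_homog_smult[simplified]
lemmas rproj_homog_mult_other = reg.mproj_homog_smult_other[simplified]
lemmas rproj_mult_homog = reg.mproj_smult_homog[simplified]

abbreviation E where "E \<equiv> A\<lparr>carrier := rcomp A \<one>\<^bsub>\<Gamma>\<^esub>\<rparr>"

lemma E_local: "local_ring E" using gr_local by (simp add: graded_local_ring_def)

text \<open>\<open>E\<close> has the same unit as \<open>A\<close>, so its being a ring already says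
  that \<open>\<one>\<close> has degree e.\<close>

lemma one_E: "\<one>\<^bsub>A\<^esub> \<in> rcomp A \<one>\<^bsub>\<Gamma>\<^esub>"
  using E_local ring.ring_simprules(6)[of E] by (simp add: local_ring_def)

lemma one_not_zero: "\<one>\<^bsub>A\<^esub> \<noteq> \<zero>\<^bsub>A\<^esub>"
  using local_ring_one_not_zero[OF E_local] by simp

lemma E_closed: "a \<in> rcomp A \<one>\<^bsub>\<Gamma>\<^esub> \<Longrightarrow> a \<in> carrier A"
  using AD.C_closed[OF G.one_closed] by blast

lemma zero_not_unit: "\<zero>\<^bsub>A\<^esub> \<notin> Units A"
  using one_not_zero by (auto simp: Units_def)

lemma E_add_one:
  assumes "a \<in> rcomp A \<one>\<^bsub>\<Gamma>\<^esub>" "b \<in> rcomp A \<one>\<^bsub>\<Gamma>\<^esub>" "a \<oplus>\<^bsub>A\<^esub> b = \<one>\<^bsub>A\<^esub>"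
  obtains v where "v \<in> carrier A" "v \<otimes>\<^bsub>A\<^esub> a = \<one>\<^bsub>A\<^esub> \<or> v \<otimes>\<^bsub>A\<^esub> b = \<one>\<^bsub>A\<^esub>"
proof -
  have "ring E" using E_local by (simp add: local_ring_def)
  then have "a \<oplus>\<^bsub>E\<^esub> b \<in> Units E"
    using assms(3) one_E by (auto simp: Units_def intro!: bexI[of _ "\<one>\<^bsub>A\<^esub>"])
  then have "a \<in> Units E \<or> b \<in> Units E"
    using local_ring_unit_add[OF E_local] assms by simp
  then show ?thesis using that E_closed by (auto simp: Units_def)
qed

text \<open>\<open>\<one>\<close> is a nonzero element of degree e and therefore lies in no other
  component.\<close>

lemma degree_mult_one:
  assumes "\<gamma> \<in> carrier \<Gamma>" "\<delta> \<in> carrier \<Gamma>" "a \<in> rcomp A \<gamma>" "b \<in> rcomp A \<delta>" "a \<otimes>\<^bsub>A\<^esub> b = \<one>\<^bsub>A\<^esub>"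
  shows "\<gamma> \<otimes>\<^bsub>\<Gamma>\<^esub> \<delta> = \<one>\<^bsub>\<Gamma>\<^esub>"
proof (rule ccontr)
  assume "\<not> ?thesis"
  then have "rproj \<Gamma> A \<one>\<^bsub>\<Gamma>\<^esub> \<one>\<^bsub>A\<^esub> = \<zero>\<^bsub>A\<^esub>"
    using AD.component_other[of "\<one>\<^bsub>\<Gamma>\<^esub>" "\<gamma> \<otimes>\<^bsub>\<Gamma>\<^esub> \<delta>" "\<one>\<^bsub>A\<^esub>"] rcomp_mult[of \<gamma> \<delta> a b] assms by auto
  then show False using AD.component_same[OF _ one_E] one_not_zero by simp
qed

text \<open>From \<open>\<delta> \<gamma> \<delta> = \<delta>\<close> right cancellation removes the
  last factor.\<close>

lemma degree_commute:
  assumes "\<gamma> \<in> carrier \<Gamma>" "\<delta> \<in> carrier \<Gamma>" "\<gamma> \<otimes>\<^bsub>\<Gamma>\<^esub> \<delta> = \<one>\<^bsub>\<Gamma>\<^esub>"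
  shows "\<delta> \<otimes>\<^bsub>\<Gamma>\<^esub> \<gamma> = \<one>\<^bsub>\<Gamma>\<^esub>"
proof -
  have "\<delta> \<otimes>\<^bsub>\<Gamma>\<^esub> \<gamma> \<otimes>\<^bsub>\<Gamma>\<^esub> \<delta> = \<one>\<^bsub>\<Gamma>\<^esub> \<otimes>\<^bsub>\<Gamma>\<^esub> \<delta>" using assms by (simp add: G.m_assoc)
  then show ?thesis using assms G.r_cancel by blast
qed

text \<open>If \<open>a c = 1\<close>, then \<open>c a\<close> is an idempotent of the local ring of degree \<open>e\<close>, hence \<open>0\<close> or \<open>1\<close>.\<close>

lemma homog_inverse_commute:
  assumes \<gamma>: "\<gamma> \<in> carrier \<Gamma>" and \<delta>: "\<delta> \<in> carrier \<Gamma>" and a: "a \<in> rcomp A \<gamma>" and c: "c \<in> rcomp A \<delta>"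
    and ac: "a \<otimes>\<^bsub>A\<^esub> c = \<one>\<^bsub>A\<^esub>"
  shows "c \<otimes>\<^bsub>A\<^esub> a = \<one>\<^bsub>A\<^esub>"
proof -
  define e where "e = c \<otimes>\<^bsub>A\<^esub> a"
  have aA: "a \<in> carrier A" and cA: "c \<in> carrier A" using AD.C_closed a c \<gamma> \<delta> by auto
  have eE: "e \<in> rcomp A \<one>\<^bsub>\<Gamma>\<^esub>"
    using rcomp_mult[OF \<delta> \<gamma> c a] degree_commute[OF \<gamma> \<delta> degree_mult_one[OF \<gamma> \<delta> a c ac]]
    by (simp add: e_def)
  have eA: "e \<in> carrier A" using E_closed[OF eE] .
  have "e \<otimes>\<^bsub>A\<^esub> e = c \<otimes>\<^bsub>A\<^esub> (a \<otimes>\<^bsub>A\<^esub> c) \<otimes>\<^bsub>A\<^esub> a"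
    using aA cA by (simp add: e_def R.m_assoc)
  then have ee: "e \<otimes>\<^bsub>A\<^esub> e = e" using ac aA cA by (simp add: e_def)
  define f where "f = \<one>\<^bsub>A\<^esub> \<ominus>\<^bsub>A\<^esub> e"
  have fA: "f \<in> carrier A" using eA by (simp add: f_def)
  have fE: "f \<in> rcomp A \<one>\<^bsub>\<Gamma>\<^esub>"
    using AD.component_in_iff[of "\<one>\<^bsub>\<Gamma>\<^esub>" f] AD.component_same[OF _ one_E] AD.component_same[OF _ eE] eA fA
    by (simp add: f_def R.minus_eq AD.component_add AD.component_minus)
  have "e \<oplus>\<^bsub>A\<^esub> f = \<one>\<^bsub>A\<^esub>"
    using eA by (subst R.a_comm) (simp_all add: f_def R.minus_eq R.a_assoc R.l_neg)
  then obtain v where v: "v \<in> carrier A" "v \<otimes>\<^bsub>A\<^esub> e = \<one>\<^bsub>A\<^esub> \<or> v \<otimes>\<^bsub>A\<^esub> f = \<one>\<^bsub>A\<^esub>"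
    using E_add_one[OF eE fE] by blast
  have "e = \<one>\<^bsub>A\<^esub>" using v(2)
  proof
    assume ve: "v \<otimes>\<^bsub>A\<^esub> e = \<one>\<^bsub>A\<^esub>"
    have "e = v \<otimes>\<^bsub>A\<^esub> e \<otimes>\<^bsub>A\<^esub> e" using ve eA by simp
    also have "\<dots> = v \<otimes>\<^bsub>A\<^esub> e" using v eA ee by (simp add: R.m_assoc)
    finally show ?thesis using ve by simp
  next
    assume vf: "v \<otimes>\<^bsub>A\<^esub> f = \<one>\<^bsub>A\<^esub>"
    have "f \<otimes>\<^bsub>A\<^esub> e = \<zero>\<^bsub>A\<^esub>"
      using eA ee by (simp add: f_def R.minus_eq R.l_distr R.l_minus R.r_neg)
    then have "v \<otimes>\<^bsub>A\<^esub> f \<otimes>\<^bsub>A\<^esub> e = \<zero>\<^bsub>A\<^esub>" using v fA eA by (simp add: R.m_assoc)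
    then have e0: "e = \<zero>\<^bsub>A\<^esub>" using vf eA by simp
    \<comment> \<open>The case \<open>e = 0\<close> is impossible: inserting \<open>e = c a\<close>
      into the square of \<open>a c = \<one>\<close> would give \<open>\<one> = 0\<close>.\<close>
    have "\<one>\<^bsub>A\<^esub> = (a \<otimes>\<^bsub>A\<^esub> c) \<otimes>\<^bsub>A\<^esub> (a \<otimes>\<^bsub>A\<^esub> c)" using ac by simp
    also have "\<dots> = a \<otimes>\<^bsub>A\<^esub> e \<otimes>\<^bsub>A\<^esub> c" using aA cA by (simp add: e_def R.m_assoc)
    also have "\<dots> = \<zero>\<^bsub>A\<^esub>" using e0 aA cA by simp
    finally show ?thesis using one_not_zero by simp
  qed
  then show ?thesis by (simp add: e_def)
qed

text \<open>The component of \<open>u\<close> in the degree complementary to \<open>\<gamma>\<close>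
  is already a right inverse, and homogeneous inverses commute. If no complementary degree existed,
  \<open>a u\<close> would have no part of degree e.\<close>

lemma right_inverse_unit:
  assumes \<gamma>: "\<gamma> \<in> carrier \<Gamma>" and a: "a \<in> rcomp A \<gamma>" and u: "u \<in> carrier A" "a \<otimes>\<^bsub>A\<^esub> u = \<one>\<^bsub>A\<^esub>"
  shows "a \<in> Units A"
proof -
  have aA: "a \<in> carrier A" using AD.C_closed[OF \<gamma> a] .
  have 1: "rproj \<Gamma> A \<one>\<^bsub>\<Gamma>\<^esub> (a \<otimes>\<^bsub>A\<^esub> u) = \<one>\<^bsub>A\<^esub>" using u AD.component_same[OF _ one_E] by simp
  show ?thesis
  proof (cases "\<exists>\<delta>\<in>carrier \<Gamma>. \<one>\<^bsub>\<Gamma>\<^esub> = \<gamma> \<otimes>\<^bsub>\<Gamma>\<^esub> \<delta>")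
    case True
    then obtain \<delta> where \<delta>: "\<delta> \<in> carrier \<Gamma>" "\<one>\<^bsub>\<Gamma>\<^esub> = \<gamma> \<otimes>\<^bsub>\<Gamma>\<^esub> \<delta>" by auto
    have c: "rproj \<Gamma> A \<delta> u \<in> rcomp A \<delta>" using AD.component_props(1) u \<delta> by auto
    have ac: "a \<otimes>\<^bsub>A\<^esub> rproj \<Gamma> A \<delta> u = \<one>\<^bsub>A\<^esub>"
      using 1 rproj_homog_mult[OF \<gamma> \<delta>(1) a u(1)] \<delta>(2) by simp
    have "rproj \<Gamma> A \<delta> u \<in> carrier A" using AD.C_closed[OF \<delta>(1) c] .
    then show ?thesis using homog_inverse_commute[OF \<gamma> \<delta>(1) a c ac] ac aA by (auto simp: Units_def)
  next
    case False
    then have "rproj \<Gamma> A \<one>\<^bsub>\<Gamma>\<^esub> (a \<otimes>\<^bsub>A\<^esub> u) = \<zero>\<^bsub>A\<^esub>"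
      using rproj_homog_mult_other[OF \<gamma> _ a u(1)] by auto
    then show ?thesis using 1 one_not_zero by simp
  qed
qed

text \<open>Only one component of \<open>u\<close> contributes to the degree e part of
  \<open>u a\<close>, so that component alone is a left inverse of \<open>a\<close>.\<close>

lemma left_inverse_homog:
  assumes \<gamma>: "\<gamma> \<in> carrier \<Gamma>" and a: "a \<in> rcomp A \<gamma>" and u: "u \<in> carrier A" "u \<otimes>\<^bsub>A\<^esub> a = \<one>\<^bsub>A\<^esub>"
  obtains \<delta> c where "\<delta> \<in> carrier \<Gamma>" "c \<in> rcomp A \<delta>" "\<delta> \<otimes>\<^bsub>\<Gamma>\<^esub> \<gamma> = \<one>\<^bsub>\<Gamma>\<^esub>" "c \<otimes>\<^bsub>A\<^esub> a = \<one>\<^bsub>A\<^esub>"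
proof -
  have aA: "a \<in> carrier A" using AD.C_closed[OF \<gamma> a] .
  have "shift_proj \<Gamma> A \<gamma> \<one>\<^bsub>\<Gamma>\<^esub> u \<otimes>\<^bsub>A\<^esub> a = \<one>\<^bsub>A\<^esub>"
    using u AD.component_same[OF _ one_E] rproj_mult_homog[OF \<gamma> _ a u(1), of "\<one>\<^bsub>\<Gamma>\<^esub>"] by simp
  moreover from this obtain \<delta> where \<delta>: "\<delta> \<in> carrier \<Gamma>" "\<one>\<^bsub>\<Gamma>\<^esub> = \<delta> \<otimes>\<^bsub>\<Gamma>\<^esub> \<gamma>"
    using shift_proj_other[of "\<one>\<^bsub>\<Gamma>\<^esub>" \<gamma> u] aA one_not_zero by (metis R.l_null)
  ultimately show ?thesis
    using that[OF \<delta>(1), of "rproj \<Gamma> A \<delta> u"] shift_proj_mult[OF \<delta>(1) \<gamma>, of u] AD.component_props(1)[OF u(1) \<delta>(1)]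
      \<delta>(2) by simp
qed

lemma left_inverse_unit:
  assumes \<gamma>: "\<gamma> \<in> carrier \<Gamma>" and a: "a \<in> rcomp A \<gamma>" and u: "u \<in> carrier A" "u \<otimes>\<^bsub>A\<^esub> a = \<one>\<^bsub>A\<^esub>"
  shows "a \<in> Units A"
proof -
  obtain \<delta> c where c: "\<delta> \<in> carrier \<Gamma>" "c \<in> rcomp A \<delta>" "c \<otimes>\<^bsub>A\<^esub> a = \<one>\<^bsub>A\<^esub>"
    using left_inverse_homog[OF assms] .
  then have "a \<otimes>\<^bsub>A\<^esub> c = \<one>\<^bsub>A\<^esub>" using homog_inverse_commute[OF c(1) \<gamma> c(2) a] by simp
  then show ?thesis using right_inverse_unit[OF \<gamma> a] AD.C_closed[OF c(1,2)] by simp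
qed

text \<open>A homogeneous left inverse \<open>c\<close> of the sum moves both summands into degree
  e, where \<open>c a + c b = \<one>\<close> and locality of \<open>E\<close> makes one of them left
  invertible.\<close>

lemma homog_unit_add:
  assumes \<gamma>: "\<gamma> \<in> carrier \<Gamma>" and a: "a \<in> rcomp A \<gamma>" and b: "b \<in> rcomp A \<gamma>" and ab: "a \<oplus>\<^bsub>A\<^esub> b \<in> Units A"
  shows "a \<in> Units A \<or> b \<in> Units A"
proof -
  have aA: "a \<in> carrier A" "b \<in> carrier A" using AD.C_closed[OF \<gamma>] a b by auto
  obtain u where "u \<in> carrier A" "u \<otimes>\<^bsub>A\<^esub> (a \<oplus>\<^bsub>A\<^esub> b) = \<one>\<^bsub>A\<^esub>" using ab by (auto simp: Units_def)
  then obtain \<delta> c where c: "\<delta> \<in> carrier \<Gamma>" "c \<in> rcomp A \<delta>" "\<delta> \<otimes>\<^bsub>\<Gamma>\<^esub> \<gamma> = \<one>\<^bsub>\<Gamma>\<^esub>"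
      "c \<otimes>\<^bsub>A\<^esub> (a \<oplus>\<^bsub>A\<^esub> b) = \<one>\<^bsub>A\<^esub>"
    using left_inverse_homog[OF \<gamma> AD.C_add[OF \<gamma> a b]] by blast
  have cA: "c \<in> carrier A" using AD.C_closed[OF c(1,2)] .
  have "c \<otimes>\<^bsub>A\<^esub> a \<oplus>\<^bsub>A\<^esub> c \<otimes>\<^bsub>A\<^esub> b = \<one>\<^bsub>A\<^esub>" using c aA cA by (simp add: R.r_distr)
  moreover have "c \<otimes>\<^bsub>A\<^esub> a \<in> rcomp A \<one>\<^bsub>\<Gamma>\<^esub>" "c \<otimes>\<^bsub>A\<^esub> b \<in> rcomp A \<one>\<^bsub>\<Gamma>\<^esub>"
    using rcomp_mult[OF c(1) \<gamma> c(2)] a b c(3) by auto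
  ultimately obtain v where v: "v \<in> carrier A"
      "v \<otimes>\<^bsub>A\<^esub> (c \<otimes>\<^bsub>A\<^esub> a) = \<one>\<^bsub>A\<^esub> \<or> v \<otimes>\<^bsub>A\<^esub> (c \<otimes>\<^bsub>A\<^esub> b) = \<one>\<^bsub>A\<^esub>"
    using E_add_one by metis
  then have "v \<otimes>\<^bsub>A\<^esub> c \<otimes>\<^bsub>A\<^esub> a = \<one>\<^bsub>A\<^esub> \<or> v \<otimes>\<^bsub>A\<^esub> c \<otimes>\<^bsub>A\<^esub> b = \<one>\<^bsub>A\<^esub>"
    using cA aA by (simp add: R.m_assoc)
  then show ?thesis using left_inverse_unit[OF \<gamma> a] left_inverse_unit[OF \<gamma> b]
      R.m_closed[OF v(1) cA] by fast
qed

text \<open>Sums are handled degree by degree with \<open>homog_unit_add\<close>. For a product with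
  a homogeneous factor, a component of the product is zero or that factor times a component of
  \<open>x\<close>; were it a unit, that component of \<open>x\<close> would have a one-sided
  inverse and so be a unit.\<close>

lemma nonunit_components_ideal: "ideal {x \<in> carrier A. \<forall>\<gamma>\<in>carrier \<Gamma>. rproj \<Gamma> A \<gamma> x \<notin> Units A} A"
  (is "ideal ?N A")
proof -
  have sum: "x \<oplus>\<^bsub>A\<^esub> y \<in> ?N" if "x \<in> ?N" "y \<in> ?N" for x y
  proof -
    have "rproj \<Gamma> A \<gamma> x \<oplus>\<^bsub>A\<^esub> rproj \<Gamma> A \<gamma> y \<notin> Units A" if \<gamma>: "\<gamma> \<in> carrier \<Gamma>" for \<gamma>
      using homog_unit_add[OF \<gamma> AD.component_props(1) AD.component_props(1), of x y]
        \<open>x \<in> ?N\<close> \<open>y \<in> ?N\<close> \<gamma> by blast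
    then show ?thesis using that by (simp add: AD.component_add)
  qed
  have left: "c \<otimes>\<^bsub>A\<^esub> x \<in> ?N" if c: "c \<in> carrier A" and x: "x \<in> ?N" for c x
    using c
  proof (induction c rule: AD.homogeneous_induct)
    case (add c d)
    then show ?case using sum[of "c \<otimes>\<^bsub>A\<^esub> x" "d \<otimes>\<^bsub>A\<^esub> x"] x by (simp add: R.l_distr)
  next
    case (homog c \<eta>)
    note cA = AD.C_closed[OF homog]
    have "rproj \<Gamma> A \<gamma> (c \<otimes>\<^bsub>A\<^esub> x) \<notin> Units A" if \<gamma>: "\<gamma> \<in> carrier \<Gamma>" for \<gamma>
    proof (cases "\<exists>\<delta>\<in>carrier \<Gamma>. \<gamma> = \<eta> \<otimes>\<^bsub>\<Gamma>\<^esub> \<delta>")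
      case True
      then obtain \<delta> where \<delta>: "\<delta> \<in> carrier \<Gamma>" "\<gamma> = \<eta> \<otimes>\<^bsub>\<Gamma>\<^esub> \<delta>" by auto
      have xd: "rproj \<Gamma> A \<delta> x \<in> rcomp A \<delta>" "rproj \<Gamma> A \<delta> x \<in> carrier A"
        using x \<delta> AD.component_props(1) AD.component_closed by auto
      show ?thesis
      proof
        assume "rproj \<Gamma> A \<gamma> (c \<otimes>\<^bsub>A\<^esub> x) \<in> Units A"
        then obtain v where "v \<in> carrier A" "v \<otimes>\<^bsub>A\<^esub> (c \<otimes>\<^bsub>A\<^esub> rproj \<Gamma> A \<delta> x) = \<one>\<^bsub>A\<^esub>"
          using rproj_homog_mult[OF homog(1) \<delta>(1) homog(2)] x \<delta> by (auto simp: Units_def)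
        then have "rproj \<Gamma> A \<delta> x \<in> Units A"
          using left_inverse_unit[OF \<delta>(1) xd(1), of "v \<otimes>\<^bsub>A\<^esub> c"] cA xd by (simp add: R.m_assoc)
        then show False using x \<delta> by auto
      qed
    next
      case False
      then show ?thesis using rproj_homog_mult_other[OF homog(1) \<gamma> homog(2)] x zero_not_unit by auto
    qed
    then show ?case using cA x by auto
  qed (rule Gamma_ne)
  have right: "x \<otimes>\<^bsub>A\<^esub> c \<in> ?N" if c: "c \<in> carrier A" and x: "x \<in> ?N" for c x
    using c
  proof (induction c rule: AD.homogeneous_induct)
    case (add c d)
    then show ?case using sum[of "x \<otimes>\<^bsub>A\<^esub> c" "x \<otimes>\<^bsub>A\<^esub> d"] x by (simp add: R.r_distr)
  next
    case (homog c \<delta>)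
    note cA = AD.C_closed[OF homog]
    have "rproj \<Gamma> A \<gamma> (x \<otimes>\<^bsub>A\<^esub> c) \<notin> Units A" if \<gamma>: "\<gamma> \<in> carrier \<Gamma>" for \<gamma>
    proof (cases "\<exists>\<eta>\<in>carrier \<Gamma>. \<gamma> = \<eta> \<otimes>\<^bsub>\<Gamma>\<^esub> \<delta>")
      case True
      then obtain \<eta> where \<eta>: "\<eta> \<in> carrier \<Gamma>" "\<gamma> = \<eta> \<otimes>\<^bsub>\<Gamma>\<^esub> \<delta>" by auto
      have xd: "rproj \<Gamma> A \<eta> x \<in> rcomp A \<eta>" "rproj \<Gamma> A \<eta> x \<in> carrier A"
        using x \<eta> AD.component_props(1) AD.component_closed by auto
      show ?thesis
      proof
        assume "rproj \<Gamma> A \<gamma> (x \<otimes>\<^bsub>A\<^esub> c) \<in> Units A"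
        then obtain v where "v \<in> carrier A" "(rproj \<Gamma> A \<eta> x \<otimes>\<^bsub>A\<^esub> c) \<otimes>\<^bsub>A\<^esub> v = \<one>\<^bsub>A\<^esub>"
          using rproj_mult_homog[OF homog(1) \<gamma> homog(2)] x \<eta> shift_proj_mult[OF \<eta>(1) homog(1)]
          by (auto simp: Units_def)
        then have "rproj \<Gamma> A \<eta> x \<in> Units A"
          using right_inverse_unit[OF \<eta>(1) xd(1), of "c \<otimes>\<^bsub>A\<^esub> v"] cA xd by (simp add: R.m_assoc)
        then show False using x \<eta> by auto
      qed
    next
      case False
      then show ?thesis using rproj_mult_homog[OF homog(1) \<gamma> homog(2)] x shift_proj_other[OF False]
          zero_not_unit cA by auto
    qed
    then show ?case using cA x by auto
  qed (rule Gamma_ne)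
  show ?thesis
  proof (rule idealI[OF R.ring_axioms])
    have zero: "\<zero>\<^bsub>A\<^esub> \<in> ?N" by (simp add: AD.component_zero zero_not_unit)
    have neg: "\<ominus>\<^bsub>A\<^esub> x \<in> ?N" if "x \<in> ?N" for x
      using left[of "\<ominus>\<^bsub>A\<^esub> \<one>\<^bsub>A\<^esub>" x] that by (simp add: R.l_minus)
    show "subgroup ?N (add_monoid A)"
      by (rule R.add.subgroupI) (use zero sum neg in blast)+
  qed (use left right in auto)
qed

text \<open>A concrete membership test for the generated ideal. The generators satisfy it and it
  defines an ideal; conversely each component of an element that passes it is zero or one of the
  generators.\<close>

lemma max_graded_ideal_iff:
  "x \<in> max_graded_ideal \<Gamma> A \<longleftrightarrow>
    x \<in> carrier A \<and> (\<forall>\<gamma>\<in>carrier \<Gamma>. rproj \<Gamma> A \<gamma> x \<notin> Units A)"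
proof -
  let ?N = "{x \<in> carrier A. \<forall>\<gamma>\<in>carrier \<Gamma>. rproj \<Gamma> A \<gamma> x \<notin> Units A}"
  let ?S = "homog_ring \<Gamma> A - Units A"
  have S: "?S \<subseteq> carrier A" by (auto simp: homog_ring_def AD.C_closed)
  have "?S \<subseteq> ?N"
  proof
    fix x assume x: "x \<in> ?S"
    then obtain \<gamma> where \<gamma>: "\<gamma> \<in> carrier \<Gamma>" "x \<in> rcomp A \<gamma>" by (auto simp: homog_ring_def)
    have "rproj \<Gamma> A \<delta> x \<notin> Units A" if "\<delta> \<in> carrier \<Gamma>" for \<delta>
      using AD.component_same[OF \<gamma>] AD.component_other[OF that \<gamma>] x zero_not_unit
      by (cases "\<delta> = \<gamma>") auto
    then show "x \<in> ?N" using x S by auto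
  qed
  then have 1: "max_graded_ideal \<Gamma> A \<subseteq> ?N"
    unfolding max_graded_ideal_def by (rule R.genideal_minimal[OF nonunit_components_ideal])
  have id: "ideal (max_graded_ideal \<Gamma> A) A"
    unfolding max_graded_ideal_def by (rule R.genideal_ideal[OF S])
  have sg: "subgroup (max_graded_ideal \<Gamma> A) (add_monoid A)"
    using id by (simp add: ideal_def additive_subgroup_def)
  have "x \<in> max_graded_ideal \<Gamma> A" if x: "x \<in> ?N" for x
  proof (rule AD.in_subgroup_of_components[OF sg])
    fix \<gamma> assume \<gamma>: "\<gamma> \<in> carrier \<Gamma>"
    show "rproj \<Gamma> A \<gamma> x \<in> max_graded_ideal \<Gamma> A"
    proof (cases "rproj \<Gamma> A \<gamma> x = \<zero>\<^bsub>A\<^esub>")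
      case True
      then show ?thesis using subgroup.one_closed[OF sg] by simp
    next
      case False
      then have "rproj \<Gamma> A \<gamma> x \<in> ?S"
        using x \<gamma> AD.component_props(1) by (auto simp: homog_ring_def)
      then show ?thesis unfolding max_graded_ideal_def using R.genideal_self[OF S] by auto
    qed
  qed (use x in simp)
  then show ?thesis using 1 by blast
qed

lemma max_graded_ideal: "ideal (max_graded_ideal \<Gamma> A) A"
proof -
  have "max_graded_ideal \<Gamma> A = {x \<in> carrier A. \<forall>\<gamma>\<in>carrier \<Gamma>. rproj \<Gamma> A \<gamma> x \<notin> Units A}"
    using max_graded_ideal_iff by blast
  then show ?thesis using nonunit_components_ideal by simp
qed

text \<open>The degree e part \<open>b\<close> of \<open>a\<close> is a nonunit and
  \<open>b + (\<one> - b) = \<one>\<close>, so locality makes the other summand a unit. This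
  replaces the property of the Jacobson radical; it concerns the degree e part, not \<open>a\<close>
  itself.\<close>

lemma one_minus_max_graded_ideal:
  assumes "a \<in> max_graded_ideal \<Gamma> A"
  shows "\<one>\<^bsub>A\<^esub> \<ominus>\<^bsub>A\<^esub> rproj \<Gamma> A \<one>\<^bsub>\<Gamma>\<^esub> a \<in> Units A"
proof -
  have a: "a \<in> carrier A" "rproj \<Gamma> A \<one>\<^bsub>\<Gamma>\<^esub> a \<notin> Units A" using assms max_graded_ideal_iff by auto
  let ?b = "rproj \<Gamma> A \<one>\<^bsub>\<Gamma>\<^esub> a"
  have b: "?b \<in> rcomp A \<one>\<^bsub>\<Gamma>\<^esub>" "?b \<in> carrier A"
    using AD.component_props(1) AD.component_closed a by auto
  have "\<one>\<^bsub>A\<^esub> \<ominus>\<^bsub>A\<^esub> ?b \<in> rcomp A \<one>\<^bsub>\<Gamma>\<^esub>"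
    using AD.component_in_iff[of "\<one>\<^bsub>\<Gamma>\<^esub>" "\<one>\<^bsub>A\<^esub> \<ominus>\<^bsub>A\<^esub> ?b"] AD.component_same[OF _ one_E]
      AD.component_same[OF _ b(1)] b
    by (simp add: R.minus_eq AD.component_add AD.component_minus)
  moreover have "?b \<oplus>\<^bsub>A\<^esub> (\<one>\<^bsub>A\<^esub> \<ominus>\<^bsub>A\<^esub> ?b) = \<one>\<^bsub>A\<^esub>"
    using b by (subst R.a_comm) (simp_all add: R.minus_eq R.a_assoc R.l_neg)
  ultimately show ?thesis using homog_unit_add[OF _ b(1)] a by auto
qed

end

section \<open>Graded submodules of finitely generated modules\<close>

lemma left_ideal_subgroup: "left_ideal I A \<Longrightarrow> subgroup I (add_monoid A)"
  by (simp add: left_ideal_def submodule_def regular_module_def subgroup_def m_inv_def)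

context gr_mod_loc
begin

text \<open>The coefficients of \<open>b\<close> in elements of \<open>K\<close>, taken modulo
  \<open>V\<close>, in the manner of leading coefficients in Hilbert's basis theorem. Since
  \<open>b\<close> may depend on \<open>V\<close>, a coefficient need not be unique, whence the
  existential form.\<close>

lemma coefficient_left_ideal:
  assumes b: "b \<in> carrier M" and K: "submodule K A M" and V: "submodule V A M"
  shows "left_ideal {a \<in> carrier A. \<exists>y\<in>V. a \<odot>\<^bsub>M\<^esub> b \<oplus>\<^bsub>M\<^esub> y \<in> K} A" (is "left_ideal ?I A")
proof -
  interpret reg: left_module A "regular_module A" by (rule R.regular_left_module)
  note KD = submoduleD[OF K] and VD = submoduleD[OF V]
  have "submodule ?I A (regular_module A)"
  proof (rule reg.submoduleI)
    show "?I \<subseteq> carrier (regular_module A)" by (auto simp: regular_module_def)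
    show "\<zero>\<^bsub>regular_module A\<^esub> \<in> ?I"
      using KD(2) VD(2) b by (auto simp: regular_module_def smult_zero_left intro!: bexI[of _ "\<zero>\<^bsub>M\<^esub>"])
    fix x assume "x \<in> ?I"
    then obtain y where y: "x \<in> carrier A" "y \<in> V" "x \<odot>\<^bsub>M\<^esub> b \<oplus>\<^bsub>M\<^esub> y \<in> K" by auto
    {
      fix x' assume "x' \<in> ?I"
      then obtain y' where y': "x' \<in> carrier A" "y' \<in> V" "x' \<odot>\<^bsub>M\<^esub> b \<oplus>\<^bsub>M\<^esub> y' \<in> K" by auto
      have "(x \<oplus>\<^bsub>A\<^esub> x') \<odot>\<^bsub>M\<^esub> b \<oplus>\<^bsub>M\<^esub> (y \<oplus>\<^bsub>M\<^esub> y') =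
          (x \<odot>\<^bsub>M\<^esub> b \<oplus>\<^bsub>M\<^esub> y) \<oplus>\<^bsub>M\<^esub> (x' \<odot>\<^bsub>M\<^esub> b \<oplus>\<^bsub>M\<^esub> y')"
        using b y y' VD(6)[OF y(2)] VD(6)[OF y'(2)] by (simp add: smult_l_distr smult_closed M.a_ac)
      then have "(x \<oplus>\<^bsub>A\<^esub> x') \<odot>\<^bsub>M\<^esub> b \<oplus>\<^bsub>M\<^esub> (y \<oplus>\<^bsub>M\<^esub> y') \<in> K"
        using KD(3)[OF y(3) y'(3)] by simp
      then show "x \<oplus>\<^bsub>regular_module A\<^esub> x' \<in> ?I"
        using y y' VD(3)[OF y(2) y'(2)] by (auto simp: regular_module_def)
    }
    fix c assume c: "c \<in> carrier A"
    have "(c \<otimes>\<^bsub>A\<^esub> x) \<odot>\<^bsub>M\<^esub> b \<oplus>\<^bsub>M\<^esub> c \<odot>\<^bsub>M\<^esub> y = c \<odot>\<^bsub>M\<^esub> (x \<odot>\<^bsub>M\<^esub> b \<oplus>\<^bsub>M\<^esub> y)"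
      using b y c VD(6)[OF y(2)] by (simp add: smult_r_distr smult_closed smult_assoc)
    then have "(c \<otimes>\<^bsub>A\<^esub> x) \<odot>\<^bsub>M\<^esub> b \<oplus>\<^bsub>M\<^esub> c \<odot>\<^bsub>M\<^esub> y \<in> K" using KD(4)[OF c y(3)] by simp
    then show "c \<odot>\<^bsub>regular_module A\<^esub> x \<in> ?I"
      using y c VD(4)[OF c y(2)] by (auto simp: regular_module_def)
  qed
  then show ?thesis by (simp add: left_ideal_def)
qed

lemma mproj_coefficient:
  assumes \<delta>: "\<delta> \<in> carrier \<Gamma>" and b: "b \<in> mcomp M \<delta>" and \<eta>: "\<eta> \<in> carrier \<Gamma>"
    and a: "a \<in> carrier A" and y: "y \<in> carrier M"
  shows "mproj \<Gamma> M (\<eta> \<otimes>\<^bsub>\<Gamma>\<^esub> \<delta>) (a \<odot>\<^bsub>M\<^esub> b \<oplus>\<^bsub>M\<^esub> y) =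
    rproj \<Gamma> A \<eta> a \<odot>\<^bsub>M\<^esub> b \<oplus>\<^bsub>M\<^esub> mproj \<Gamma> M (\<eta> \<otimes>\<^bsub>\<Gamma>\<^esub> \<delta>) y"
  using mproj_smult_homog[OF \<delta> _ b a, of "\<eta> \<otimes>\<^bsub>\<Gamma>\<^esub> \<delta>"] MD.C_closed[OF \<delta> b] assms
  by (simp add: MD.component_add smult_closed shift_proj_mult)

text \<open>Induction on the generators \<open>Y\<close>: \<open>K\<close> is generated by lifts of
  finitely many generators of its coefficient ideal along \<open>b\<close>, together with generators
  of \<open>K \<inter> ?V\<close>. The resulting \<open>T\<close> need not be homogeneous;
  \<open>fin_gen_homog\<close> restores homogeneity where a cover is built.\<close>

lemma graded_submodule_fin_gen:
  assumes noeth: "left_gr_noetherian \<Gamma> A"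
  shows "finite Y \<Longrightarrow> Y \<subseteq> homog_module \<Gamma> M \<Longrightarrow> graded_submodule \<Gamma> A M K \<Longrightarrow>
    K \<subseteq> module_span A M Y \<Longrightarrow> \<exists>T. finite T \<and> T \<subseteq> K \<and> module_span A M T = K"
proof (induction Y arbitrary: K rule: finite_induct)
  case empty
  then have "K = {\<zero>\<^bsub>M\<^esub>}" using submoduleD(2) by (auto simp: graded_submodule_def span_empty)
  then show ?case by (intro exI[of _ "{}"]) (auto simp: span_empty)
next
  case (insert b Y)
  let ?V = "module_span A M Y"
  obtain \<delta> where \<delta>: "\<delta> \<in> carrier \<Gamma>" "b \<in> mcomp M \<delta>" using insert.prems by (auto simp: homog_module_def)
  have bM: "b \<in> carrier M" using MD.C_closed[OF \<delta>] .
  have YM: "Y \<subseteq> carrier M" using insert.prems homog_closed by auto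
  have V: "submodule ?V A M" "graded_submodule \<Gamma> A M ?V"
    using span_submodule[OF YM] homog_span_graded insert.prems by auto
  have K: "submodule K A M" using insert.prems by (simp add: graded_submodule_def)
  have Kg: "\<And>x \<gamma>. x \<in> K \<Longrightarrow> \<gamma> \<in> carrier \<Gamma> \<Longrightarrow> mproj \<Gamma> M \<gamma> x \<in> K"
    and Vg: "\<And>x \<gamma>. x \<in> ?V \<Longrightarrow> \<gamma> \<in> carrier \<Gamma> \<Longrightarrow> mproj \<Gamma> M \<gamma> x \<in> ?V"
    using insert.prems(2) V(2) by (auto simp: graded_submodule_def)
  note KD = submoduleD[OF K] and VD = submoduleD[OF V(1)]
  define I where "I = {a \<in> carrier A. \<exists>y\<in>?V. a \<odot>\<^bsub>M\<^esub> b \<oplus>\<^bsub>M\<^esub> y \<in> K}"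
  have I: "left_ideal I A" unfolding I_def by (rule coefficient_left_ideal[OF bM K V(1)])
  interpret reg: left_module A "regular_module A" by (rule R.regular_left_module)
  define H where "H = homog_ring \<Gamma> A \<inter> I"
  \<comment> \<open>\<open>noeth\<close> speaks only about ideals with homogeneous generators. The
    part of degree \<open>\<eta> \<otimes> \<delta>\<close> of a witness \<open>a b + y\<close> in
    \<open>K\<close> is a witness for the degree \<open>\<eta>\<close> component of
    \<open>a\<close>, so \<open>I\<close> contains the components of its elements.\<close>
  have gen: "left_ideal_gen A H = I"
  proof
    show "left_ideal_gen A H \<subseteq> I"
      using I reg.span_least by (auto simp: R.left_ideal_gen_span left_ideal_def H_def)
    have "H \<subseteq> carrier (regular_module A)" by (auto simp: H_def I_def regular_module_def)
    then have sg: "subgroup (left_ideal_gen A H) (add_monoid A)"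
      by (intro left_ideal_subgroup) (simp add: left_ideal_def R.left_ideal_gen_span reg.span_submodule)
    show "I \<subseteq> left_ideal_gen A H"
    proof
      fix a assume "a \<in> I"
      then obtain y where a: "a \<in> carrier A" and y: "y \<in> ?V" "a \<odot>\<^bsub>M\<^esub> b \<oplus>\<^bsub>M\<^esub> y \<in> K" by (auto simp: I_def)
      show "a \<in> left_ideal_gen A H"
      proof (rule AD.in_subgroup_of_components[OF sg a])
        fix \<eta> assume \<eta>: "\<eta> \<in> carrier \<Gamma>"
        have "rproj \<Gamma> A \<eta> a \<odot>\<^bsub>M\<^esub> b \<oplus>\<^bsub>M\<^esub> mproj \<Gamma> M (\<eta> \<otimes>\<^bsub>\<Gamma>\<^esub> \<delta>) y \<in> K"
          using mproj_coefficient[OF \<delta> \<eta> a VD(6)[OF y(1)]] Kg[OF y(2), of "\<eta> \<otimes>\<^bsub>\<Gamma>\<^esub> \<delta>"] \<eta> \<delta>(1)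
          by simp
        moreover have "mproj \<Gamma> M (\<eta> \<otimes>\<^bsub>\<Gamma>\<^esub> \<delta>) y \<in> ?V"
          using Vg[OF y(1)] \<eta> \<delta>(1) by simp
        ultimately have "rproj \<Gamma> A \<eta> a \<in> I" unfolding I_def using AD.component_closed[OF a \<eta>] by auto
        then have "rproj \<Gamma> A \<eta> a = \<zero>\<^bsub>A\<^esub> \<or> rproj \<Gamma> A \<eta> a \<in> H"
          using AD.component_props(1)[OF a \<eta>] \<eta> by (auto simp: H_def homog_ring_def)
        then show "rproj \<Gamma> A \<eta> a \<in> left_ideal_gen A H"
          using subgroup.one_closed[OF sg] by (auto simp: left_ideal_gen_def)
      qed
    qed
  qed
  have "graded_left_ideal \<Gamma> A I"
    unfolding graded_left_ideal_def using gen by (intro exI[of _ H]) (auto simp: H_def)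
  then obtain T where T: "finite T" "T \<subseteq> carrier A" "I = left_ideal_gen A T"
    using noeth by (auto simp: left_gr_noetherian_def)
  have "T \<subseteq> I" using T by (auto simp: left_ideal_gen_def)
  then have "\<forall>t\<in>T. \<exists>y. y \<in> ?V \<and> t \<odot>\<^bsub>M\<^esub> b \<oplus>\<^bsub>M\<^esub> y \<in> K" by (auto simp: I_def)
  then obtain y where y: "\<And>t. t \<in> T \<Longrightarrow> y t \<in> ?V" "\<And>t. t \<in> T \<Longrightarrow> t \<odot>\<^bsub>M\<^esub> b \<oplus>\<^bsub>M\<^esub> y t \<in> K"
    by metis
  define S where "S = (\<lambda>t. t \<odot>\<^bsub>M\<^esub> b \<oplus>\<^bsub>M\<^esub> y t) ` T"
  have S: "finite S" "S \<subseteq> K" using T y by (auto simp: S_def)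
  then have SM: "S \<subseteq> carrier M" using KD(1) by auto
  \<comment> \<open>The coefficient ideal of the span of \<open>S\<close> in place of
    \<open>K\<close>. It is a left ideal containing \<open>T\<close>, hence contains
    \<open>I\<close>, and no linear combination of \<open>T\<close> has to be written out.\<close>
  let ?J = "{a \<in> carrier A. \<exists>y\<in>?V. a \<odot>\<^bsub>M\<^esub> b \<oplus>\<^bsub>M\<^esub> y \<in> module_span A M S}"
  have "T \<subseteq> ?J"
  proof
    fix t assume t: "t \<in> T"
    then have "t \<odot>\<^bsub>M\<^esub> b \<oplus>\<^bsub>M\<^esub> y t \<in> module_span A M S"
      using span_superset[of S] by (auto simp: S_def)
    then show "t \<in> ?J" using y(1)[OF t] t T(2) by blast
  qed
  then have IJ: "I \<subseteq> ?J"
    unfolding T(3) using coefficient_left_ideal[OF bM span_submodule[OF SM] V(1)]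
    by (auto simp: left_ideal_gen_def)
  obtain T' where T': "finite T'" "T' \<subseteq> K \<inter> ?V" "module_span A M T' = K \<inter> ?V"
    using insert.IH[OF _ graded_submodule_Int[OF insert.prems(2) V(2)] Int_lower2] insert.prems(1)
    by blast
  have ST: "S \<union> T' \<subseteq> carrier M" using SM T' KD(1) by auto
  note D = submoduleD[OF span_submodule[OF ST]]
  have "K \<subseteq> module_span A M (S \<union> T')"
  proof
    fix x assume x: "x \<in> K"
    then obtain a v where av: "a \<in> carrier A" "v \<in> ?V" "x = a \<odot>\<^bsub>M\<^esub> b \<oplus>\<^bsub>M\<^esub> v"
      using insert.prems(3) span_insert[OF bM YM] by auto
    then have "a \<in> I" using x by (auto simp: I_def)
    then obtain w where w: "w \<in> ?V" "a \<odot>\<^bsub>M\<^esub> b \<oplus>\<^bsub>M\<^esub> w \<in> module_span A M S" using IJ by auto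
    \<comment> \<open>\<open>?x\<close> has the same coefficient at \<open>b\<close> as
      \<open>x\<close> but lies in the span of \<open>S\<close>; the difference of the two is in
      \<open>K \<inter> ?V\<close>, which \<open>T'\<close> spans.\<close>
    let ?x = "a \<odot>\<^bsub>M\<^esub> b \<oplus>\<^bsub>M\<^esub> w"
    have vw: "v \<in> carrier M" "w \<in> carrier M" "v \<oplus>\<^bsub>M\<^esub> \<ominus>\<^bsub>M\<^esub> w \<in> ?V"
      using VD(3,5,6) av(2) w(1) by auto
    have eq: "x = ?x \<oplus>\<^bsub>M\<^esub> (v \<oplus>\<^bsub>M\<^esub> \<ominus>\<^bsub>M\<^esub> w)"
    proof -
      have "?x \<oplus>\<^bsub>M\<^esub> (v \<oplus>\<^bsub>M\<^esub> \<ominus>\<^bsub>M\<^esub> w) = a \<odot>\<^bsub>M\<^esub> b \<oplus>\<^bsub>M\<^esub> (v \<oplus>\<^bsub>M\<^esub> (w \<oplus>\<^bsub>M\<^esub> \<ominus>\<^bsub>M\<^esub> w))"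
        using av(1) bM vw(1,2) by (simp add: smult_closed M.a_ac)
      then show ?thesis using av bM vw(1,2) by (simp add: smult_closed M.r_neg)
    qed
    have xK: "?x \<in> K" using w(2) span_least[OF K S(2)] by auto
    then have "v \<oplus>\<^bsub>M\<^esub> \<ominus>\<^bsub>M\<^esub> w \<in> K"
      using submodule_add_cancel[OF K xK] eq x vw by auto
    then have "v \<oplus>\<^bsub>M\<^esub> \<ominus>\<^bsub>M\<^esub> w \<in> module_span A M T'" using vw T' by auto
    then have "v \<oplus>\<^bsub>M\<^esub> \<ominus>\<^bsub>M\<^esub> w \<in> module_span A M (S \<union> T')" "?x \<in> module_span A M (S \<union> T')"
      using w(2) span_mono[of T' "S \<union> T'"] span_mono[of S "S \<union> T'"] by auto
    then show "x \<in> module_span A M (S \<union> T')" using D(3) eq by metis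
  qed
  moreover have "module_span A M (S \<union> T') \<subseteq> K" by (rule span_least[OF K]) (use S T' in auto)
  ultimately show ?case using S T' by (intro exI[of _ "S \<union> T'"]) auto
qed

end

section \<open>The graded Nakayama lemma\<close>

locale gr_local_mod_loc = gr_local_loc \<Gamma> A + gr_mod_loc \<Gamma> A M
  for \<Gamma> :: "('g, 'k) monoid_scheme" and A :: "('a, 'g) gr_ring" and M :: "('a, 'b, 'g) gr_module"
begin

lemma max_graded_ideal_left: "submodule (max_graded_ideal \<Gamma> A) A (regular_module A)"
proof -
  interpret I: ideal "max_graded_ideal \<Gamma> A" A by (rule max_graded_ideal)
  interpret rm: left_module A "regular_module A" by (rule R.regular_left_module)
  show ?thesis
    by (rule rm.submoduleI) (auto simp: regular_module_def I.I_l_closed I.a_subset[THEN subsetD])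
qed

text \<open>In \<open>c (a b + y) = (c a) b + c y\<close> the product \<open>c a\<close> stays in
  the ideal because the ideal is also closed under multiplication from the right.\<close>

lemma max_graded_ideal_mult_subset:
  assumes b: "b \<in> carrier M" and V: "submodule V A M"
    and gen: "\<And>x. x \<in> carrier M \<Longrightarrow> \<exists>a\<in>carrier A. \<exists>y\<in>V. x = a \<odot>\<^bsub>M\<^esub> b \<oplus>\<^bsub>M\<^esub> y"
  shows "ideal_mult_module M (max_graded_ideal \<Gamma> A) \<subseteq>
    {a \<odot>\<^bsub>M\<^esub> b \<oplus>\<^bsub>M\<^esub> y |a y. a \<in> max_graded_ideal \<Gamma> A \<and> y \<in> V}" (is "_ \<subseteq> ?S")
proof -
  interpret I: ideal "max_graded_ideal \<Gamma> A" A by (rule max_graded_ideal)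
  have "c \<odot>\<^bsub>M\<^esub> x \<in> ?S" if c: "c \<in> max_graded_ideal \<Gamma> A" and x: "x \<in> carrier M" for c x
  proof -
    obtain a y where a: "a \<in> carrier A" and y: "y \<in> V" and eq: "x = a \<odot>\<^bsub>M\<^esub> b \<oplus>\<^bsub>M\<^esub> y"
      using gen[OF x] by blast
    have cA: "c \<in> carrier A" using c max_graded_ideal_iff by blast
    have "c \<odot>\<^bsub>M\<^esub> x = (c \<otimes>\<^bsub>A\<^esub> a) \<odot>\<^bsub>M\<^esub> b \<oplus>\<^bsub>M\<^esub> c \<odot>\<^bsub>M\<^esub> y"
      using eq a cA b submoduleD(6)[OF V y] by (simp add: smult_r_distr smult_assoc smult_closed)
    then show ?thesis using I.I_r_closed[OF c a] submoduleD(4)[OF V cA y] by blast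
  qed
  then show ?thesis
    unfolding ideal_mult_module_def
    by (intro group.generate_subgroup_incl M.a_group
        submoduleD(7)[OF coset_submodule[OF b V max_graded_ideal_left]]) blast
qed

text \<open>One writes \<open>b = a b + v\<close> with \<open>a\<close> in the maximal graded ideal
  and \<open>v\<close> in \<open>V\<close>, passes to the degree of \<open>b\<close>, and divides by
  \<open>\<one>\<close> minus the degree e part of \<open>a\<close>.\<close>

lemma nakayama_step:
  assumes \<delta>: "\<delta> \<in> carrier \<Gamma>" and b: "b \<in> mcomp M \<delta>" and V: "graded_submodule \<Gamma> A M V"
    and gen: "\<And>x. x \<in> carrier M \<Longrightarrow> \<exists>a\<in>carrier A. \<exists>y\<in>V. x = a \<odot>\<^bsub>M\<^esub> b \<oplus>\<^bsub>M\<^esub> y"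
    and top: "\<And>x. x \<in> carrier M \<Longrightarrow>
      \<exists>v\<in>V. \<exists>w\<in>ideal_mult_module M (max_graded_ideal \<Gamma> A). x = v \<oplus>\<^bsub>M\<^esub> w"
  shows "b \<in> V"
proof -
  have bM: "b \<in> carrier M" using MD.C_closed[OF \<delta> b] .
  have Vs: "submodule V A M" using V by (simp add: graded_submodule_def)
  note VD = submoduleD[OF Vs]
  obtain v w where vw: "v \<in> V" "w \<in> ideal_mult_module M (max_graded_ideal \<Gamma> A)" "b = v \<oplus>\<^bsub>M\<^esub> w"
    using top[OF bM] by blast
  then obtain a y where ay: "a \<in> max_graded_ideal \<Gamma> A" "y \<in> V" "w = a \<odot>\<^bsub>M\<^esub> b \<oplus>\<^bsub>M\<^esub> y"
    using max_graded_ideal_mult_subset[OF bM Vs gen] by blast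
  have aA: "a \<in> carrier A" using ay max_graded_ideal_iff by blast
  have eq: "b = a \<odot>\<^bsub>M\<^esub> b \<oplus>\<^bsub>M\<^esub> (v \<oplus>\<^bsub>M\<^esub> y)"
  proof -
    have "b = v \<oplus>\<^bsub>M\<^esub> (a \<odot>\<^bsub>M\<^esub> b \<oplus>\<^bsub>M\<^esub> y)" using vw(3) ay(3) by simp
    also have "\<dots> = a \<odot>\<^bsub>M\<^esub> b \<oplus>\<^bsub>M\<^esub> (v \<oplus>\<^bsub>M\<^esub> y)"
      using VD(6) vw(1) ay(2) aA bM by (simp add: smult_closed M.a_lcomm)
    finally show ?thesis .
  qed
  let ?a = "rproj \<Gamma> A \<one>\<^bsub>\<Gamma>\<^esub> a" and ?y = "mproj \<Gamma> M \<delta> (v \<oplus>\<^bsub>M\<^esub> y)"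
  have vy: "v \<oplus>\<^bsub>M\<^esub> y \<in> V" by (rule VD(3)[OF vw(1) ay(2)])
  have yV: "?y \<in> V" using vy V \<delta> by (auto simp: graded_submodule_def)
  have a1: "?a \<in> carrier A" using AD.component_closed[OF aA] by simp
  \<comment> \<open>Since \<open>\<one> - a\<close> may fail to be invertible, the equation is
    projected to degree \<open>\<delta>\<close>: there only the degree e part of \<open>a\<close>
    survives, and \<open>V\<close> is graded, so the remainder stays in \<open>V\<close>.\<close>
  have "mproj \<Gamma> M \<delta> b = ?a \<odot>\<^bsub>M\<^esub> b \<oplus>\<^bsub>M\<^esub> ?y"
    using mproj_coefficient[OF \<delta> b G.one_closed aA VD(6)[OF vy]] arg_cong[OF eq, of "mproj \<Gamma> M \<delta>"] \<delta>
    by simp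
  then have "?a \<odot>\<^bsub>M\<^esub> b \<oplus>\<^bsub>M\<^esub> ?y = b" using MD.component_same[OF \<delta> b] by simp
  moreover have "(\<ominus>\<^bsub>A\<^esub> ?a) \<odot>\<^bsub>M\<^esub> b \<oplus>\<^bsub>M\<^esub> (?a \<odot>\<^bsub>M\<^esub> b \<oplus>\<^bsub>M\<^esub> ?y) = ?y"
    using a1 bM VD(6)[OF yV]
    by (simp add: smult_closed M.a_assoc[symmetric] smult_l_distr[symmetric] R.l_neg smult_zero_left)
  ultimately have "(\<ominus>\<^bsub>A\<^esub> ?a) \<odot>\<^bsub>M\<^esub> b \<oplus>\<^bsub>M\<^esub> b = ?y" by simp
  moreover have "(\<one>\<^bsub>A\<^esub> \<ominus>\<^bsub>A\<^esub> ?a) \<odot>\<^bsub>M\<^esub> b = (\<ominus>\<^bsub>A\<^esub> ?a) \<odot>\<^bsub>M\<^esub> b \<oplus>\<^bsub>M\<^esub> b"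
    using a1 bM by (simp add: R.minus_eq smult_l_distr smult_one smult_closed M.a_comm)
  ultimately have "(\<one>\<^bsub>A\<^esub> \<ominus>\<^bsub>A\<^esub> ?a) \<odot>\<^bsub>M\<^esub> b \<in> V" using yV by simp
  moreover obtain u where "u \<in> carrier A" "u \<otimes>\<^bsub>A\<^esub> (\<one>\<^bsub>A\<^esub> \<ominus>\<^bsub>A\<^esub> ?a) = \<one>\<^bsub>A\<^esub>"
    using one_minus_max_graded_ideal[OF ay(1)] by (auto simp: Units_def)
  ultimately show "b \<in> V"
    using VD(4)[of u "(\<one>\<^bsub>A\<^esub> \<ominus>\<^bsub>A\<^esub> ?a) \<odot>\<^bsub>M\<^esub> b"] smult_assoc[of u "\<one>\<^bsub>A\<^esub> \<ominus>\<^bsub>A\<^esub> ?a" b] a1 bM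
    by (simp add: smult_one)
qed

text \<open>No quotient by \<open>N\<close> is formed: homogeneous generators of \<open>M\<close>
  are adjoined to \<open>N\<close> and then discarded one at a time, since
  \<open>nakayama_step\<close> shows that each lies in the span of \<open>N\<close> and the
  remaining ones.\<close>

lemma nakayama:
  assumes fg: "fin_gen_module A M" and N: "graded_submodule \<Gamma> A M N"
    and top: "\<And>x. x \<in> carrier M \<Longrightarrow>
      \<exists>v\<in>N. \<exists>w\<in>ideal_mult_module M (max_graded_ideal \<Gamma> A). x = v \<oplus>\<^bsub>M\<^esub> w"
  shows "N = carrier M"
proof -
  obtain Y where Y: "finite Y" "Y \<subseteq> homog_module \<Gamma> M" "module_span A M Y = carrier M"
    using fin_gen_homog[OF fg] .
  have Ns: "submodule N A M" using N by (simp add: graded_submodule_def)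
  have NM: "N \<subseteq> carrier M" using submoduleD(1)[OF Ns] .
  have "finite Z \<Longrightarrow> Z \<subseteq> homog_module \<Gamma> M \<Longrightarrow> module_span A M (N \<union> Z) = carrier M \<Longrightarrow> N = carrier M" for Z
  proof (induction Z rule: finite_induct)
    case empty
    then show ?case using span_submodule_eq[OF Ns] by simp
  next
    case (insert b Z)
    obtain \<delta> where \<delta>: "\<delta> \<in> carrier \<Gamma>" "b \<in> mcomp M \<delta>" using insert.prems by (auto simp: homog_module_def)
    have ZM: "Z \<subseteq> carrier M" using insert.prems homog_closed by auto
    have NZ: "N \<union> Z \<subseteq> carrier M" using NM ZM by auto
    let ?V = "module_span A M (N \<union> Z)"
    have V: "graded_submodule \<Gamma> A M ?V"
    proof (rule span_graded[OF NZ])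
      fix y \<gamma> assume "y \<in> N \<union> Z" and \<gamma>: "\<gamma> \<in> carrier \<Gamma>"
      then have "mproj \<Gamma> M \<gamma> y \<in> N \<or> mproj \<Gamma> M \<gamma> y \<in> module_span A M Z"
        using N homog_span_graded[of Z] insert.prems(1) span_superset[of Z]
        by (auto simp: graded_submodule_def)
      then show "mproj \<Gamma> M \<gamma> y \<in> ?V"
        using span_mono[of Z "N \<union> Z"] span_superset[of "N \<union> Z"] by auto
    qed
    have all: "carrier M = {a \<odot>\<^bsub>M\<^esub> b \<oplus>\<^bsub>M\<^esub> y |a y. a \<in> carrier A \<and> y \<in> ?V}"
      using span_insert[OF MD.C_closed[OF \<delta>] NZ] insert.prems(2) by simp
    have NV: "N \<subseteq> ?V" using span_superset[of "N \<union> Z"] by auto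
    have "b \<in> ?V"
    proof (rule nakayama_step[OF \<delta> V])
      show "\<exists>a\<in>carrier A. \<exists>y\<in>?V. x = a \<odot>\<^bsub>M\<^esub> b \<oplus>\<^bsub>M\<^esub> y" if "x \<in> carrier M" for x
        using that unfolding all by blast
      show "\<exists>v\<in>?V. \<exists>w\<in>ideal_mult_module M (max_graded_ideal \<Gamma> A). x = v \<oplus>\<^bsub>M\<^esub> w"
        if "x \<in> carrier M" for x using top[OF that] NV by blast
    qed
    then have "module_span A M (N \<union> insert b Z) \<subseteq> ?V"
      using span_superset[of "N \<union> Z"] by (intro span_subset_span[OF NZ]) auto
    then have "?V = carrier M" using insert.prems(2) submoduleD(1)[OF span_submodule[OF NZ]] by auto
    then show ?case using insert by auto
  qed
  moreover have "module_span A M (N \<union> Y) = carrier M"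
  proof
    have NY: "N \<union> Y \<subseteq> carrier M" using Y(2) NM homog_closed by auto
    show "module_span A M (N \<union> Y) \<subseteq> carrier M" by (rule submoduleD(1)[OF span_submodule[OF NY]])
  qed (use span_mono[of Y "N \<union> Y"] Y in auto)
  ultimately show ?thesis using Y by blast
qed

end

section \<open>Graded homomorphisms and graded submodules\<close>

locale gr_hom_loc = S: gr_mod_loc \<Gamma> A M + T: gr_mod_loc \<Gamma> A N
  for \<Gamma> :: "('g, 'k) monoid_scheme" and A :: "('a, 'g) gr_ring"
    and M :: "('a, 'b, 'g) gr_module" and N :: "('a, 'c, 'g) gr_module" +
  fixes f
  assumes hom: "f \<in> graded_hom \<Gamma> A M N"
begin

lemma hom_closed: "x \<in> carrier M \<Longrightarrow> f x \<in> carrier N"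
  and hom_add: "x \<in> carrier M \<Longrightarrow> y \<in> carrier M \<Longrightarrow> f (x \<oplus>\<^bsub>M\<^esub> y) = f x \<oplus>\<^bsub>N\<^esub> f y"
  and hom_smult: "a \<in> carrier A \<Longrightarrow> x \<in> carrier M \<Longrightarrow> f (a \<odot>\<^bsub>M\<^esub> x) = a \<odot>\<^bsub>N\<^esub> f x"
  and hom_mcomp: "\<gamma> \<in> carrier \<Gamma> \<Longrightarrow> x \<in> mcomp M \<gamma> \<Longrightarrow> f x \<in> mcomp N \<gamma>"
  using hom by (auto simp: graded_hom_def module_hom_def image_subset_iff)

lemma hom_zero: "f \<zero>\<^bsub>M\<^esub> = \<zero>\<^bsub>N\<^esub>"
  by (rule T.M.additive_zero[OF _ S.M.abelian_group_axioms]) (auto simp: hom_closed hom_add)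

lemma hom_minus: "x \<in> carrier M \<Longrightarrow> f (\<ominus>\<^bsub>M\<^esub> x) = \<ominus>\<^bsub>N\<^esub> f x"
  using hom_smult[of "\<ominus>\<^bsub>A\<^esub> \<one>\<^bsub>A\<^esub>" x] by (simp add: S.smult_minus_one T.smult_minus_one hom_closed)

text \<open>Commutation with the projections is what makes kernels and images graded
  submodules.\<close>

lemma hom_mproj:
  assumes x: "x \<in> carrier M" and \<gamma>: "\<gamma> \<in> carrier \<Gamma>"
  shows "f (mproj \<Gamma> M \<gamma> x) = mproj \<Gamma> N \<gamma> (f x)"
  using x
proof (induction x rule: S.MD.homogeneous_induct)
  case (add x y)
  then show ?case using \<gamma>
    by (simp add: S.MD.component_add T.MD.component_add hom_add hom_closed S.MD.component_closed)
next
  case (homog x \<delta>)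
  note fx = hom_mcomp[OF homog]
  show ?case
  proof (cases "\<gamma> = \<delta>")
    case True
    then show ?thesis using S.MD.component_same[OF homog] T.MD.component_same[OF homog(1) fx] by simp
  next
    case False
    then show ?thesis using S.MD.component_other[OF \<gamma> homog] T.MD.component_other[OF \<gamma> homog(1) fx]
      by (simp add: hom_zero)
  qed
qed (rule S.Gamma_ne)

lemma kernel_graded: "graded_submodule \<Gamma> A M {x \<in> carrier M. f x = \<zero>\<^bsub>N\<^esub>}"
proof -
  have "submodule {x \<in> carrier M. f x = \<zero>\<^bsub>N\<^esub>} A M"
    by (rule S.submoduleI) (auto simp: hom_zero hom_add hom_smult S.smult_closed T.smult_zero_right)
  then show ?thesis
    by (auto simp: graded_submodule_def hom_mproj S.MD.component_closed T.MD.component_zero)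
qed

lemma image_graded: "graded_submodule \<Gamma> A N (f ` carrier M)"
proof -
  have "submodule (f ` carrier M) A N"
  proof (rule T.submoduleI)
    show "f ` carrier M \<subseteq> carrier N" using hom_closed by auto
    show "\<zero>\<^bsub>N\<^esub> \<in> f ` carrier M" using hom_zero S.M.zero_closed by (metis imageI)
    fix x y assume "x \<in> f ` carrier M" "y \<in> f ` carrier M"
    then obtain u v where "x = f u" "y = f v" "u \<in> carrier M" "v \<in> carrier M" by auto
    then show "x \<oplus>\<^bsub>N\<^esub> y \<in> f ` carrier M" by (auto simp: hom_add[symmetric])
  next
    fix a x assume "a \<in> carrier A" "x \<in> f ` carrier M"
    then obtain u where "x = f u" "a \<in> carrier A" "u \<in> carrier M" by auto
    then show "a \<odot>\<^bsub>N\<^esub> x \<in> f ` carrier M" by (auto simp: hom_smult[symmetric] S.smult_closed)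
  qed
  then show ?thesis
    by (auto simp: graded_submodule_def hom_mproj[symmetric] S.MD.component_closed)
qed

end

lemma graded_hom_comp:
  assumes "f \<in> graded_hom \<Gamma> A M N" "g \<in> graded_hom \<Gamma> A N P"
  shows "(\<lambda>x. g (f x)) \<in> graded_hom \<Gamma> A M P"
  using assms by (simp add: graded_hom_def module_hom_def Pi_iff image_subset_iff)

lemma graded_hom_id: "(\<lambda>x. x) \<in> graded_hom \<Gamma> A M M"
  by (auto simp: graded_hom_def module_hom_def)

section \<open>Graded submodules as graded modules\<close>

definition gr_submodule_of :: "('a, 'b, 'g) gr_module \<Rightarrow> 'b set \<Rightarrow> ('a, 'b, 'g) gr_module"
  where "gr_submodule_of M N = M\<lparr>carrier := N, mcomp := \<lambda>\<gamma>. mcomp M \<gamma> \<inter> N\<rparr>"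

lemma gr_submodule_of_simps [simp]:
  "carrier (gr_submodule_of M N) = N" "ring.zero (gr_submodule_of M N) = ring.zero M"
  "ring.add (gr_submodule_of M N) = ring.add M" "module.smult (gr_submodule_of M N) = module.smult M"
  "mcomp (gr_submodule_of M N) = (\<lambda>\<gamma>. mcomp M \<gamma> \<inter> N)"
  by (auto simp: gr_submodule_of_def)

context gr_mod_loc
begin

text \<open>The projections of \<open>M\<close> restrict to \<open>N\<close> because
  \<open>N\<close> is graded, and \<open>direct_decompI\<close> turns the restrictions into a
  grading.\<close>

lemma gr_submodule_of_graded:
  assumes N: "graded_submodule \<Gamma> A M N"
  shows "graded_module \<Gamma> A (gr_submodule_of M N)"
proof -
  let ?N = "gr_submodule_of M N"
  have Ns: "submodule N A M" using N by (simp add: graded_submodule_def)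
  have Ng: "\<And>x \<gamma>. x \<in> N \<Longrightarrow> \<gamma> \<in> carrier \<Gamma> \<Longrightarrow> mproj \<Gamma> M \<gamma> x \<in> N"
    using N by (simp add: graded_submodule_def)
  note D = submoduleD[OF Ns]
  have ag: "abelian_group ?N"
  proof (rule abelian_groupI, simp_all add: D(2,3))
    fix x assume x: "x \<in> N"
    then show "\<exists>y\<in>N. y \<oplus>\<^bsub>M\<^esub> x = \<zero>\<^bsub>M\<^esub>"
      using D(5,6) by (intro bexI[of _ "\<ominus>\<^bsub>M\<^esub> x"]) (auto simp: M.l_neg)
  qed (use D(6) in \<open>auto simp: M.a_ac\<close>)
  have lm: "left_module A ?N"
    by (intro left_module.intro left_module_axioms.intro R.ring_axioms ag)
      (use D in \<open>auto simp: smult_l_distr smult_r_distr smult_assoc smult_one\<close>)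
  interpret N: abelian_group ?N by (rule ag)
  \<comment> \<open>The inclusion is additive, so finite sums formed in the submodule agree with
    those formed in \<open>M\<close>.\<close>
  have fs: "finsum ?N g J = finsum M g J" if "g \<in> J \<rightarrow> N" for g :: "'g \<Rightarrow> 'b" and J
    using M.additive_finsum[of "\<lambda>x. x" ?N g J] that ag D(1) by auto
  have "direct_decomp ?N (carrier \<Gamma>) (mcomp ?N)"
  proof (rule direct_decompI(1)[where P = "mproj \<Gamma> M", OF ag])
    fix \<gamma> assume \<gamma>: "\<gamma> \<in> carrier \<Gamma>"
    show "mproj \<Gamma> M \<gamma> \<in> carrier ?N \<rightarrow> carrier ?N" using Ng \<gamma> by auto
    show "mproj \<Gamma> M \<gamma> (x \<oplus>\<^bsub>?N\<^esub> y) = mproj \<Gamma> M \<gamma> x \<oplus>\<^bsub>?N\<^esub> mproj \<Gamma> M \<gamma> y"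
      if "x \<in> carrier ?N" "y \<in> carrier ?N" for x y using that D(6) \<gamma> MD.component_add by auto
    show "mcomp ?N \<gamma> = {x \<in> carrier ?N. mproj \<Gamma> M \<gamma> x = x}"
      using D(6) \<gamma> MD.component_in_iff by auto
    show "mproj \<Gamma> M \<gamma> (mproj \<Gamma> M \<delta> x) = (if \<gamma> = \<delta> then mproj \<Gamma> M \<gamma> x else \<zero>\<^bsub>?N\<^esub>)"
      if "\<delta> \<in> carrier \<Gamma>" "x \<in> carrier ?N" for \<delta> x using that \<gamma> D(6) MD.component_component by auto
  next
    fix x assume "x \<in> carrier ?N"
    then have x: "x \<in> N" by simp
    let ?J = "{\<gamma> \<in> carrier \<Gamma>. mproj \<Gamma> M \<gamma> x \<noteq> \<zero>\<^bsub>M\<^esub>}"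
    have "finsum ?N (\<lambda>\<gamma>. mproj \<Gamma> M \<gamma> x) ?J = x"
      using MD.component_props(3)[OF D(6)[OF x]] fs[of "\<lambda>\<gamma>. mproj \<Gamma> M \<gamma> x" ?J] Ng[OF x] by auto
    then show "\<exists>J. finite J \<and> J \<subseteq> carrier \<Gamma> \<and> (\<forall>\<gamma>\<in>carrier \<Gamma> - J. mproj \<Gamma> M \<gamma> x = \<zero>\<^bsub>?N\<^esub>) \<and>
        x = finsum ?N (\<lambda>\<gamma>. mproj \<Gamma> M \<gamma> x) J"
      using MD.component_props(2)[OF D(6)[OF x]] by (intro exI[of _ ?J]) auto
  qed
  then show ?thesis
    using lm mcomp_smult D(4) AD.C_closed by (simp add: graded_module_def)
qed

text \<open>A submodule of \<open>N\<close> is also one of \<open>M\<close>, so the span of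
  \<open>T\<close> inside \<open>N\<close> is no smaller than its span inside
  \<open>M\<close>.\<close>

lemma gr_submodule_of_fin_gen:
  assumes N: "graded_submodule \<Gamma> A M N" and T: "finite T" "T \<subseteq> N" "module_span A M T = N"
  shows "fin_gen_module A (gr_submodule_of M N)"
proof -
  interpret N: gr_mod_loc \<Gamma> A "gr_submodule_of M N"
    by unfold_locales (rule gr_submodule_of_graded[OF N])
  have NM: "N \<subseteq> carrier M" using N submoduleD(1) by (auto simp: graded_submodule_def)
  have TN: "T \<subseteq> carrier (gr_submodule_of M N)" using T by simp
  let ?S = "module_span A (gr_submodule_of M N) T"
  note D = N.submoduleD[OF N.span_submodule[OF TN]]
  have "submodule ?S A M"
    by (rule submoduleI) (use D NM in auto)
  then have "N \<subseteq> ?S" using span_least[of ?S T] N.span_superset T(3) by auto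
  then have "?S = N" using D(1) by auto
  then show ?thesis using T by (auto simp: fin_gen_module_def)
qed

end

section \<open>Bases of graded free modules\<close>

lemma (in left_module) free_basis_finite_iff:
  assumes B: "finite B" "B \<subseteq> carrier M"
  shows "free_basis R M B \<longleftrightarrow>
    (\<forall>x\<in>carrier M. \<exists>!c. c \<in> B \<rightarrow>\<^sub>E carrier R \<and> x = finsum M (\<lambda>b. c b \<odot>\<^bsub>M\<^esub> b) B)"
proof -
  have eq: "finsum M (\<lambda>b. c b \<odot>\<^bsub>M\<^esub> b) {b \<in> B. c b \<noteq> \<zero>} = finsum M (\<lambda>b. c b \<odot>\<^bsub>M\<^esub> b) B"
    if "c \<in> B \<rightarrow>\<^sub>E carrier R" for c
  proof (rule M.finsum_mono_neutral[OF B(1)])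
    show "(\<lambda>b. c b \<odot>\<^bsub>M\<^esub> b) \<in> B \<rightarrow> carrier M"
      using that B by (auto intro!: smult_closed)
  qed (use B in \<open>auto simp: smult_zero_left\<close>)
  have "(c \<in> B \<rightarrow>\<^sub>E carrier R \<and> finite {b \<in> B. c b \<noteq> \<zero>} \<and>
        x = finsum M (\<lambda>b. c b \<odot>\<^bsub>M\<^esub> b) {b \<in> B. c b \<noteq> \<zero>}) \<longleftrightarrow>
      (c \<in> B \<rightarrow>\<^sub>E carrier R \<and> x = finsum M (\<lambda>b. c b \<odot>\<^bsub>M\<^esub> b) B)" for c x
    using eq B(1) by auto
  then show ?thesis using B(2) by (simp add: free_basis_def)
qed

definition basis_coord ::
    "('a, 'r) ring_scheme \<Rightarrow> ('a, 'b, 'm) module_scheme \<Rightarrow> 'b set \<Rightarrow> 'b \<Rightarrow> 'b \<Rightarrow> 'a"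
  where "basis_coord A M B x =
    (THE c. c \<in> B \<rightarrow>\<^sub>E carrier A \<and> x = finsum M (\<lambda>b. c b \<odot>\<^bsub>M\<^esub> b) B)"

locale gr_free_loc = gr_mod_loc \<Gamma> A F
  for \<Gamma> :: "('g, 'k) monoid_scheme" and A :: "('a, 'g) gr_ring" and F :: "('a, 'b, 'g) gr_module" +
  fixes B
  assumes fin: "finite B" and homog: "B \<subseteq> homog_module \<Gamma> F" and basis: "free_basis A F B"
begin

lemma B_closed: "b \<in> B \<Longrightarrow> b \<in> carrier F"
  using basis by (auto simp: free_basis_def)

lemma basis_coord_ex1:
  assumes "x \<in> carrier F"
  shows "\<exists>!c. c \<in> B \<rightarrow>\<^sub>E carrier A \<and> x = finsum F (\<lambda>b. c b \<odot>\<^bsub>F\<^esub> b) B"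
proof -
  have "B \<subseteq> carrier F" using B_closed by auto
  from basis[unfolded free_basis_finite_iff[OF fin this]] show ?thesis using assms by (rule bspec)
qed

lemma basis_coord:
  assumes "x \<in> carrier F"
  shows "basis_coord A F B x \<in> B \<rightarrow>\<^sub>E carrier A"
    and "finsum F (\<lambda>b. basis_coord A F B x b \<odot>\<^bsub>F\<^esub> b) B = x"
  using theI'[OF basis_coord_ex1[OF assms]] unfolding basis_coord_def by auto

lemma basis_coord_closed: "x \<in> carrier F \<Longrightarrow> b \<in> B \<Longrightarrow> basis_coord A F B x b \<in> carrier A"
  using basis_coord(1) by blast

lemma basis_coord_unique:
  assumes c: "\<And>b. b \<in> B \<Longrightarrow> c b \<in> carrier A" and b: "b \<in> B"
  shows "basis_coord A F B (finsum F (\<lambda>b. c b \<odot>\<^bsub>F\<^esub> b) B) b = c b"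
proof -
  let ?x = "finsum F (\<lambda>b. c b \<odot>\<^bsub>F\<^esub> b) B"
  have cl: "(\<lambda>b. c b \<odot>\<^bsub>F\<^esub> b) \<in> B \<rightarrow> carrier F" using c B_closed by (auto intro!: smult_closed)
  then have x: "?x \<in> carrier F" by (rule M.finsum_closed)
  have "?x = finsum F (\<lambda>b. restrict c B b \<odot>\<^bsub>F\<^esub> b) B"
    using cl by (intro M.finsum_cong') auto
  moreover have "restrict c B \<in> B \<rightarrow>\<^sub>E carrier A" using c by auto
  ultimately have "basis_coord A F B ?x = restrict c B"
    unfolding basis_coord_def using basis_coord_ex1[OF x] by (intro the1_equality) auto
  then show ?thesis using b by simp
qed

lemma span_basis: "module_span A F B = carrier F"
proof
  have BF: "B \<subseteq> carrier F" using B_closed by auto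
  note D = submoduleD[OF span_submodule[OF BF]]
  show "module_span A F B \<subseteq> carrier F" using D(1) .
  show "carrier F \<subseteq> module_span A F B"
  proof
    fix x assume x: "x \<in> carrier F"
    have "finsum F (\<lambda>b. basis_coord A F B x b \<odot>\<^bsub>F\<^esub> b) B \<in> module_span A F B"
      using basis_coord_closed[OF x] span_superset[of B]
      by (intro M.finsum_in_subgroup[OF D(7)] D(4)) auto
    then show "x \<in> module_span A F B" using basis_coord(2)[OF x] by simp
  qed
qed

lemma fin_gen: "fin_gen_module A F"
  using span_basis fin B_closed by (auto simp: fin_gen_module_def)

text \<open>Projecting the expansion of \<open>x\<close> to degree \<open>\<gamma>\<close> gives a
  second expansion of the same \<open>x\<close>; uniqueness of coefficients makes every coordinate
  equal to its shifted component.\<close>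

lemma basis_coord_homog:
  assumes \<gamma>: "\<gamma> \<in> carrier \<Gamma>" and x: "x \<in> mcomp F \<gamma>" and b: "b \<in> B" "b \<in> mcomp F \<delta>" "\<delta> \<in> carrier \<Gamma>"
  shows "shift_proj \<Gamma> A \<delta> \<gamma> (basis_coord A F B x b) = basis_coord A F B x b"
proof -
  have xF: "x \<in> carrier F" using MD.C_closed[OF \<gamma> x] .
  have "\<forall>b\<in>B. \<exists>\<delta>. \<delta> \<in> carrier \<Gamma> \<and> b \<in> mcomp F \<delta>" using homog by (auto simp: homog_module_def)
  then obtain g where g: "\<And>b. b \<in> B \<Longrightarrow> g b \<in> carrier \<Gamma>" "\<And>b. b \<in> B \<Longrightarrow> b \<in> mcomp F (g b)" by metis
  \<comment> \<open>A nonzero element lies in only one component, so the degree chosen by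
    \<open>g\<close> for \<open>b\<close> is the given \<open>\<delta>\<close>.\<close>
  have "b \<noteq> \<zero>\<^bsub>F\<^esub>" using homog b by (auto simp: homog_module_def)
  then have gb: "g b = \<delta>"
    using MD.component_same[OF b(3,2)] MD.component_other[OF b(3) g(1)[OF b(1)] g(2)[OF b(1)]] by metis
  let ?c = "basis_coord A F B x"
  have "x = mproj \<Gamma> F \<gamma> (finsum F (\<lambda>b. ?c b \<odot>\<^bsub>F\<^esub> b) B)"
    using basis_coord(2)[OF xF] MD.component_same[OF \<gamma> x] by simp
  also have "\<dots> = finsum F (\<lambda>b. mproj \<Gamma> F \<gamma> (?c b \<odot>\<^bsub>F\<^esub> b)) B"
    by (rule M.additive_finsum[OF _ M.abelian_group_axioms])
      (use \<gamma> basis_coord_closed[OF xF] B_closed in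
        \<open>auto simp: MD.component_closed MD.component_add smult_closed\<close>)
  also have "\<dots> = finsum F (\<lambda>b. shift_proj \<Gamma> A (g b) \<gamma> (?c b) \<odot>\<^bsub>F\<^esub> b) B"
    by (intro M.finsum_cong')
      (use \<gamma> g basis_coord_closed[OF xF] B_closed in
        \<open>auto simp: mproj_smult_homog smult_closed shift_proj_closed\<close>)
  finally have "basis_coord A F B x b = shift_proj \<Gamma> A (g b) \<gamma> (?c b)"
    using basis_coord_unique[of "\<lambda>b. shift_proj \<Gamma> A (g b) \<gamma> (?c b)" b] b
      shift_proj_closed[OF g(1) basis_coord_closed[OF xF]] by simp
  then show ?thesis using gb by simp
qed

text \<open>The linear extension of \<open>v\<close> preserves degrees because
  \<open>basis_coord_homog\<close> fixes the degree of each coordinate of a homogeneous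
  element.\<close>

lemma free_lift:
  assumes N: "graded_module \<Gamma> A N"
    and v: "\<And>b \<delta>. b \<in> B \<Longrightarrow> \<delta> \<in> carrier \<Gamma> \<Longrightarrow> b \<in> mcomp F \<delta> \<Longrightarrow> v b \<in> mcomp N \<delta>"
  shows "\<exists>f\<in>graded_hom \<Gamma> A F N. \<forall>b\<in>B. f b = v b"
proof -
  interpret N: gr_mod_loc \<Gamma> A N by unfold_locales fact
  have "\<forall>b\<in>B. \<exists>\<delta>. \<delta> \<in> carrier \<Gamma> \<and> b \<in> mcomp F \<delta>" using homog by (auto simp: homog_module_def)
  then obtain g where g: "\<And>b. b \<in> B \<Longrightarrow> g b \<in> carrier \<Gamma>" "\<And>b. b \<in> B \<Longrightarrow> b \<in> mcomp F (g b)" by metis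
  have vN: "v b \<in> carrier N" if "b \<in> B" for b
    using N.MD.C_closed[OF g(1) v[OF that g]] that by simp
  let ?c = "basis_coord A F B"
  note cc = basis_coord_closed
  define f where "f x = finsum N (\<lambda>b. ?c x b \<odot>\<^bsub>N\<^esub> v b) B" for x
  have cl: "(\<lambda>b. ?c x b \<odot>\<^bsub>N\<^esub> v b) \<in> B \<rightarrow> carrier N" if "x \<in> carrier F" for x
    using that cc vN by (auto intro!: N.smult_closed)
  have clF: "(\<lambda>b. ?c x b \<odot>\<^bsub>F\<^esub> b) \<in> B \<rightarrow> carrier F" if "x \<in> carrier F" for x
    using that cc B_closed by (auto intro!: smult_closed)
  have fN: "f x \<in> carrier N" if "x \<in> carrier F" for x
    unfolding f_def by (rule N.M.finsum_closed[OF cl[OF that]])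
  have add: "f (x \<oplus>\<^bsub>F\<^esub> y) = f x \<oplus>\<^bsub>N\<^esub> f y" if x: "x \<in> carrier F" and y: "y \<in> carrier F" for x y
  proof -
    have "x \<oplus>\<^bsub>F\<^esub> y = finsum F (\<lambda>b. ?c x b \<odot>\<^bsub>F\<^esub> b \<oplus>\<^bsub>F\<^esub> ?c y b \<odot>\<^bsub>F\<^esub> b) B"
      using basis_coord(2)[OF x] basis_coord(2)[OF y] clF[OF x] clF[OF y] by (simp add: M.finsum_addf)
    also have "\<dots> = finsum F (\<lambda>b. (?c x b \<oplus>\<^bsub>A\<^esub> ?c y b) \<odot>\<^bsub>F\<^esub> b) B"
      by (intro M.finsum_cong') (use x y cc B_closed in \<open>auto simp: smult_l_distr smult_closed\<close>)
    finally have "?c (x \<oplus>\<^bsub>F\<^esub> y) b = ?c x b \<oplus>\<^bsub>A\<^esub> ?c y b" if "b \<in> B" for b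
      using basis_coord_unique[of "\<lambda>b. ?c x b \<oplus>\<^bsub>A\<^esub> ?c y b" b] cc x y that by simp
    then have "f (x \<oplus>\<^bsub>F\<^esub> y) = finsum N (\<lambda>b. ?c x b \<odot>\<^bsub>N\<^esub> v b \<oplus>\<^bsub>N\<^esub> ?c y b \<odot>\<^bsub>N\<^esub> v b) B"
      unfolding f_def
      by (intro N.M.finsum_cong') (use x y cc vN in \<open>auto simp: N.smult_l_distr N.smult_closed\<close>)
    then show ?thesis unfolding f_def using cl[OF x] cl[OF y] by (simp add: N.M.finsum_addf)
  qed
  have smult: "f (a \<odot>\<^bsub>F\<^esub> x) = a \<odot>\<^bsub>N\<^esub> f x" if a: "a \<in> carrier A" and x: "x \<in> carrier F" for a x
  proof -
    have "a \<odot>\<^bsub>F\<^esub> x = finsum F (\<lambda>b. a \<odot>\<^bsub>F\<^esub> (?c x b \<odot>\<^bsub>F\<^esub> b)) B"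
      using basis_coord(2)[OF x] smult_finsum_right[OF clF[OF x] a] by simp
    also have "\<dots> = finsum F (\<lambda>b. (a \<otimes>\<^bsub>A\<^esub> ?c x b) \<odot>\<^bsub>F\<^esub> b) B"
      by (intro M.finsum_cong') (use a x cc B_closed in \<open>auto simp: smult_assoc smult_closed\<close>)
    finally have "?c (a \<odot>\<^bsub>F\<^esub> x) b = a \<otimes>\<^bsub>A\<^esub> ?c x b" if "b \<in> B" for b
      using basis_coord_unique[of "\<lambda>b. a \<otimes>\<^bsub>A\<^esub> ?c x b" b] cc a x that by simp
    then have "f (a \<odot>\<^bsub>F\<^esub> x) = finsum N (\<lambda>b. a \<odot>\<^bsub>N\<^esub> (?c x b \<odot>\<^bsub>N\<^esub> v b)) B"
      unfolding f_def
      by (intro N.M.finsum_cong') (use x a cc vN in \<open>auto simp: N.smult_assoc N.smult_closed\<close>)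
    then show ?thesis unfolding f_def using N.smult_finsum_right[OF cl[OF x] a] by simp
  qed
  have deg: "f x \<in> mcomp N \<gamma>" if \<gamma>: "\<gamma> \<in> carrier \<Gamma>" and x: "x \<in> mcomp F \<gamma>" for \<gamma> x
    unfolding f_def
  proof (rule N.M.finsum_in_subgroup[OF N.MD.C_subgroup[OF \<gamma>]])
    fix b assume b: "b \<in> B"
    have xF: "x \<in> carrier F" using MD.C_closed[OF \<gamma> x] .
    have "mproj \<Gamma> N \<gamma> (?c x b \<odot>\<^bsub>N\<^esub> v b) = ?c x b \<odot>\<^bsub>N\<^esub> v b"
      using N.mproj_smult_homog[OF g(1)[OF b] \<gamma> v[OF b g(1)[OF b] g(2)[OF b]] cc[OF xF b]]
        basis_coord_homog[OF \<gamma> x b g(2)[OF b] g(1)[OF b]] by simp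
    then show "?c x b \<odot>\<^bsub>N\<^esub> v b \<in> mcomp N \<gamma>"
      using N.MD.component_in_iff[OF \<gamma> N.smult_closed[OF cc[OF xF b] vN[OF b]]] by simp
  qed
  have "f b = v b" if b: "b \<in> B" for b
  proof -
    have "finsum F (\<lambda>b'. (if b = b' then \<one>\<^bsub>A\<^esub> else \<zero>\<^bsub>A\<^esub>) \<odot>\<^bsub>F\<^esub> b') B =
        finsum F (\<lambda>b'. if b = b' then b' else \<zero>\<^bsub>F\<^esub>) B"
      using B_closed by (intro M.finsum_cong') (auto simp: smult_one smult_zero_left)
    also have "\<dots> = b" using M.finsum_singleton[OF b fin, of "\<lambda>b. b"] B_closed by auto
    finally have "?c b b' = (if b = b' then \<one>\<^bsub>A\<^esub> else \<zero>\<^bsub>A\<^esub>)" if "b' \<in> B" for b'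
      using basis_coord_unique[of "\<lambda>b'. if b = b' then \<one>\<^bsub>A\<^esub> else \<zero>\<^bsub>A\<^esub>" b'] that by simp
    then have "f b = finsum N (\<lambda>b'. if b = b' then v b' else \<zero>\<^bsub>N\<^esub>) B"
      unfolding f_def using vN
      by (intro N.M.finsum_cong') (auto simp: N.smult_one N.smult_zero_left)
    also have "\<dots> = v b" using N.M.finsum_singleton[OF b fin, of v] vN by auto
    finally show ?thesis .
  qed
  moreover have "f \<in> graded_hom \<Gamma> A F N"
    using fN add smult deg by (auto simp: graded_hom_def module_hom_def)
  ultimately show ?thesis by blast
qed

lemma hom_eq_on_basis:
  assumes N: "graded_module \<Gamma> A N" and f: "f \<in> graded_hom \<Gamma> A F N" and g: "g \<in> graded_hom \<Gamma> A F N"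
    and eq: "\<And>b. b \<in> B \<Longrightarrow> f b = g b" and x: "x \<in> carrier F"
  shows "f x = g x"
proof -
  interpret N: gr_mod_loc \<Gamma> A N by unfold_locales fact
  interpret f: gr_hom_loc \<Gamma> A F N f by unfold_locales fact
  interpret g: gr_hom_loc \<Gamma> A F N g by unfold_locales fact
  have "submodule {x \<in> carrier F. f x = g x} A F"
    by (rule submoduleI)
      (auto simp: f.hom_zero g.hom_zero f.hom_add g.hom_add f.hom_smult g.hom_smult smult_closed)
  then have "module_span A F B \<subseteq> {x \<in> carrier F. f x = g x}"
    by (rule span_least) (use eq B_closed in auto)
  then show ?thesis using x span_basis by auto
qed

text \<open>Projectivity of gr-free modules. Instead of surjectivity of \<open>q\<close> only
  containment of images is assumed, which is what differentials offer.\<close>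

lemma lift_through:
  assumes N: "graded_module \<Gamma> A N" and P: "graded_module \<Gamma> A P"
    and p: "p \<in> graded_hom \<Gamma> A F P" and q: "q \<in> graded_hom \<Gamma> A N P"
    and im: "p ` carrier F \<subseteq> q ` carrier N"
  shows "\<exists>f\<in>graded_hom \<Gamma> A F N. \<forall>x\<in>carrier F. q (f x) = p x"
proof -
  interpret N: gr_mod_loc \<Gamma> A N by unfold_locales fact
  interpret P: gr_mod_loc \<Gamma> A P by unfold_locales fact
  interpret p: gr_hom_loc \<Gamma> A F P p by unfold_locales fact
  interpret q: gr_hom_loc \<Gamma> A N P q by unfold_locales fact
  have "\<exists>w. q w = p b \<and> (\<forall>\<delta>\<in>carrier \<Gamma>. b \<in> mcomp F \<delta> \<longrightarrow> w \<in> mcomp N \<delta>)" if b: "b \<in> B" for b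
  proof -
    obtain \<delta> where \<delta>: "\<delta> \<in> carrier \<Gamma>" "b \<in> mcomp F \<delta>" "b \<noteq> \<zero>\<^bsub>F\<^esub>"
      using homog b by (auto simp: homog_module_def)
    have "p b \<in> q ` carrier N" using im B_closed[OF b] by auto
    then obtain w where w: "w \<in> carrier N" "q w = p b" by auto
    \<comment> \<open>An arbitrary preimage of \<open>p b\<close> is replaced by its component in
      the degree of \<open>b\<close>; \<open>q\<close> commutes with projections and
      \<open>p b\<close> is homogeneous of that degree.\<close>
    have "q (mproj \<Gamma> N \<delta> w) = p b"
      using q.hom_mproj[OF w(1) \<delta>(1)] w(2) P.MD.component_same[OF \<delta>(1) p.hom_mcomp[OF \<delta>(1,2)]] by simp
    moreover have "\<delta>' = \<delta>" if "\<delta>' \<in> carrier \<Gamma>" "b \<in> mcomp F \<delta>'" for \<delta>'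
    proof (rule ccontr)
      assume "\<delta>' \<noteq> \<delta>"
      then show False using MD.component_same[OF that] MD.component_other[OF that(1) \<delta>(1,2)] \<delta>(3) by simp
    qed
    ultimately show ?thesis using N.MD.component_props(1)[OF w(1) \<delta>(1)] by metis
  qed
  then obtain w where w: "\<And>b. b \<in> B \<Longrightarrow> q (w b) = p b"
      "\<And>b \<delta>. b \<in> B \<Longrightarrow> \<delta> \<in> carrier \<Gamma> \<Longrightarrow> b \<in> mcomp F \<delta> \<Longrightarrow> w b \<in> mcomp N \<delta>" by metis
  obtain f where f: "f \<in> graded_hom \<Gamma> A F N" "\<And>b. b \<in> B \<Longrightarrow> f b = w b"
    using free_lift[OF N, of w] w(2) by blast
  have "q (f x) = p x" if "x \<in> carrier F" for x
    by (rule hom_eq_on_basis[OF P graded_hom_comp[OF f(1) q] p _ that]) (use f(2) w(1) in simp)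
  then show ?thesis using f(1) by blast
qed

end

section \<open>Free modules with prescribed degrees\<close>

text \<open>The direct sum of \<open>n\<close> copies of \<open>A\<close>, twisted so that the i-th
  basis vector has degree \<open>\<delta> i\<close>. Vectors are sequences vanishing from
  \<open>n\<close> on, so all ranks share one type and covers can be iterated. A coordinate fixed by
  \<open>shift_proj\<close> is homogeneous of the degree \<open>\<eta>\<close> with
  \<open>\<gamma> = \<eta> \<otimes> \<delta> i\<close>, and zero if there is no such
  \<open>\<eta>\<close>.\<close>

definition std_free ::
    "('g, 'k) monoid_scheme \<Rightarrow> ('a, 'g) gr_ring \<Rightarrow> nat \<Rightarrow> (nat \<Rightarrow> 'g) \<Rightarrow> ('a, nat \<Rightarrow> 'a, 'g) gr_module"
  where "std_free \<Gamma> A n \<delta> =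
    \<lparr>carrier = {f. (\<forall>i. f i \<in> carrier A) \<and> (\<forall>i\<ge>n. f i = \<zero>\<^bsub>A\<^esub>)},
     monoid.mult = undefined, monoid.one = undefined,
     ring.zero = (\<lambda>_. \<zero>\<^bsub>A\<^esub>), ring.add = (\<lambda>f g i. f i \<oplus>\<^bsub>A\<^esub> g i),
     module.smult = (\<lambda>a f i. a \<otimes>\<^bsub>A\<^esub> f i),
     mcomp = (\<lambda>\<gamma>. {f. (\<forall>i. f i \<in> carrier A) \<and> (\<forall>i\<ge>n. f i = \<zero>\<^bsub>A\<^esub>) \<and>
                    (\<forall>i<n. shift_proj \<Gamma> A (\<delta> i) \<gamma> (f i) = f i)})\<rparr>"

definition std_vec :: "('a, 'r) ring_scheme \<Rightarrow> nat \<Rightarrow> nat \<Rightarrow> 'a"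
  where "std_vec A i = (\<lambda>j. if j = i then \<one>\<^bsub>A\<^esub> else \<zero>\<^bsub>A\<^esub>)"

locale std_free_loc = gr_local_loc \<Gamma> A for \<Gamma> :: "('g, 'k) monoid_scheme" and A :: "('a, 'g) gr_ring" +
  fixes n :: nat and \<delta> :: "nat \<Rightarrow> 'g"
  assumes deg: "\<And>i. i < n \<Longrightarrow> \<delta> i \<in> carrier \<Gamma>"
begin

abbreviation F where "F \<equiv> std_free \<Gamma> A n \<delta>"

lemma F_simps:
  "f \<in> carrier F \<longleftrightarrow> (\<forall>i. f i \<in> carrier A) \<and> (\<forall>i\<ge>n. f i = \<zero>\<^bsub>A\<^esub>)"
  "\<zero>\<^bsub>F\<^esub> = (\<lambda>_. \<zero>\<^bsub>A\<^esub>)" "f \<oplus>\<^bsub>F\<^esub> g = (\<lambda>i. f i \<oplus>\<^bsub>A\<^esub> g i)" "a \<odot>\<^bsub>F\<^esub> f = (\<lambda>i. a \<otimes>\<^bsub>A\<^esub> f i)"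
  "f \<in> mcomp F \<gamma> \<longleftrightarrow> f \<in> carrier F \<and> (\<forall>i<n. shift_proj \<Gamma> A (\<delta> i) \<gamma> (f i) = f i)"
  by (auto simp: std_free_def)

lemma F_abelian_group: "abelian_group F"
proof (rule abelian_groupI)
  fix f assume f: "f \<in> carrier F"
  show "\<exists>g\<in>carrier F. g \<oplus>\<^bsub>F\<^esub> f = \<zero>\<^bsub>F\<^esub>"
    by (rule bexI[of _ "\<lambda>i. \<ominus>\<^bsub>A\<^esub> f i"]) (use f in \<open>auto simp: F_simps R.l_neg\<close>)
qed (auto simp: F_simps R.a_ac)

lemma F_left_module: "left_module A F"
  by (intro left_module.intro left_module_axioms.intro R.ring_axioms F_abelian_group)
    (auto simp: F_simps R.l_distr R.r_distr R.m_assoc)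

sublocale F: left_module A F by (rule F_left_module)

lemma F_finsum: "g \<in> J \<rightarrow> carrier F \<Longrightarrow> finsum F g J i = finsum A (\<lambda>j. g j i) J"
  by (rule R.additive_finsum[OF _ F_abelian_group, of "\<lambda>f. f i"]) (auto simp: F_simps)

definition proj :: "'g \<Rightarrow> (nat \<Rightarrow> 'a) \<Rightarrow> nat \<Rightarrow> 'a"
  where "proj \<gamma> f = (\<lambda>i. if i < n then shift_proj \<Gamma> A (\<delta> i) \<gamma> (f i) else \<zero>\<^bsub>A\<^esub>)"

lemma F_decomp: "direct_decomp F (carrier \<Gamma>) (mcomp F)"
proof (rule direct_decompI(1)[where P = proj, OF F_abelian_group])
  fix \<gamma> assume \<gamma>: "\<gamma> \<in> carrier \<Gamma>"
  show "proj \<gamma> \<in> carrier F \<rightarrow> carrier F"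
    using deg by (auto simp: F_simps proj_def shift_proj_closed)
  show "proj \<gamma> (f \<oplus>\<^bsub>F\<^esub> g) = proj \<gamma> f \<oplus>\<^bsub>F\<^esub> proj \<gamma> g" if "f \<in> carrier F" "g \<in> carrier F" for f g
    using that deg by (auto simp: F_simps proj_def shift_proj_add)
  show "mcomp F \<gamma> = {f \<in> carrier F. proj \<gamma> f = f}"
    by (auto simp: F_simps(1,5) proj_def fun_eq_iff)
  show "proj \<gamma> (proj \<gamma>' f) = (if \<gamma> = \<gamma>' then proj \<gamma> f else \<zero>\<^bsub>F\<^esub>)"
    if "\<gamma>' \<in> carrier \<Gamma>" "f \<in> carrier F" for \<gamma>' f
    using that deg by (auto simp: F_simps proj_def shift_proj_shift_proj)
next
  fix f assume f: "f \<in> carrier F"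
  define Q where "Q i J \<longleftrightarrow> finite J \<and> J \<subseteq> carrier \<Gamma> \<and>
      (\<forall>\<gamma>. \<gamma> \<notin> J \<longrightarrow> shift_proj \<Gamma> A (\<delta> i) \<gamma> (f i) = \<zero>\<^bsub>A\<^esub>) \<and>
      (\<forall>J'. finite J' \<longrightarrow> J \<subseteq> J' \<longrightarrow> finsum A (\<lambda>\<gamma>. shift_proj \<Gamma> A (\<delta> i) \<gamma> (f i)) J' = f i)" for i J
  have "\<exists>J. Q i J" if "i < n" for i
  proof -
    have "f i \<in> carrier A" using f by (simp add: F_simps)
    from shift_proj_sum[OF deg[OF that] this] show ?thesis unfolding Q_def by metis
  qed
  then obtain J where QJ: "\<And>i. i < n \<Longrightarrow> Q i (J i)" by metis
  then have J: "\<And>i. i < n \<Longrightarrow> finite (J i)" "\<And>i. i < n \<Longrightarrow> J i \<subseteq> carrier \<Gamma>"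
      "\<And>i \<gamma>. i < n \<Longrightarrow> \<gamma> \<notin> J i \<Longrightarrow> shift_proj \<Gamma> A (\<delta> i) \<gamma> (f i) = \<zero>\<^bsub>A\<^esub>"
      "\<And>i J'. i < n \<Longrightarrow> finite J' \<Longrightarrow> J i \<subseteq> J' \<Longrightarrow>
        finsum A (\<lambda>\<gamma>. shift_proj \<Gamma> A (\<delta> i) \<gamma> (f i)) J' = f i"
    unfolding Q_def by blast+
  \<comment> \<open>A common index set for all coordinates; the last clause of \<open>Q\<close> lets
    each coordinate be summed over more than its own support.\<close>
  let ?J = "\<Union>i<n. J i"
  have fin: "finite ?J" using J(1) by auto
  have cl: "(\<lambda>\<gamma>. proj \<gamma> f) \<in> ?J \<rightarrow> carrier F"
    using f deg by (auto simp: F_simps proj_def shift_proj_closed)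
  have "finsum F (\<lambda>\<gamma>. proj \<gamma> f) ?J = f"
  proof
    fix i
    show "finsum F (\<lambda>\<gamma>. proj \<gamma> f) ?J i = f i"
    proof (cases "i < n")
      case True
      then have "J i \<subseteq> ?J" by auto
      then show ?thesis using J(4)[OF True fin] True F_finsum[OF cl] by (simp add: proj_def)
    next
      case False
      then show ?thesis using F_finsum[OF cl] f by (simp add: proj_def F_simps R.finsum_zero)
    qed
  qed
  moreover have "\<forall>\<gamma>\<in>carrier \<Gamma> - ?J. proj \<gamma> f = \<zero>\<^bsub>F\<^esub>" using J(3) by (auto simp: proj_def F_simps)
  moreover have "?J \<subseteq> carrier \<Gamma>" using J(2) by auto
  ultimately show "\<exists>J. finite J \<and> J \<subseteq> carrier \<Gamma> \<and> (\<forall>\<gamma>\<in>carrier \<Gamma> - J. proj \<gamma> f = \<zero>\<^bsub>F\<^esub>) \<and>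
      f = finsum F (\<lambda>\<gamma>. proj \<gamma> f) J"
    using fin by (intro exI[of _ ?J]) simp
qed

text \<open>If \<open>\<zeta> = \<eta> \<epsilon>\<close>, then
  \<open>\<gamma> \<zeta> = (\<gamma> \<eta>) \<epsilon>\<close>, and the claim is the component
  formula in \<open>A\<close>; if \<open>\<zeta>\<close> has no such factorization, \<open>x\<close>
  is zero.\<close>

lemma shift_proj_homog_mult:
  assumes \<epsilon>: "\<epsilon> \<in> carrier \<Gamma>" and \<gamma>: "\<gamma> \<in> carrier \<Gamma>" and \<zeta>: "\<zeta> \<in> carrier \<Gamma>" and a: "a \<in> rcomp A \<gamma>"
    and x: "x \<in> carrier A" "shift_proj \<Gamma> A \<epsilon> \<zeta> x = x"
  shows "shift_proj \<Gamma> A \<epsilon> (\<gamma> \<otimes>\<^bsub>\<Gamma>\<^esub> \<zeta>) (a \<otimes>\<^bsub>A\<^esub> x) = a \<otimes>\<^bsub>A\<^esub> x"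
proof (cases "\<exists>\<eta>\<in>carrier \<Gamma>. \<zeta> = \<eta> \<otimes>\<^bsub>\<Gamma>\<^esub> \<epsilon>")
  case True
  then obtain \<eta> where \<eta>: "\<eta> \<in> carrier \<Gamma>" "\<zeta> = \<eta> \<otimes>\<^bsub>\<Gamma>\<^esub> \<epsilon>" by auto
  then have "rproj \<Gamma> A \<eta> x = x" using x shift_proj_mult[OF \<eta>(1) \<epsilon>] by simp
  moreover have "shift_proj \<Gamma> A \<epsilon> (\<gamma> \<otimes>\<^bsub>\<Gamma>\<^esub> \<zeta>) (a \<otimes>\<^bsub>A\<^esub> x) = rproj \<Gamma> A (\<gamma> \<otimes>\<^bsub>\<Gamma>\<^esub> \<eta>) (a \<otimes>\<^bsub>A\<^esub> x)"
    using shift_proj_mult[of "\<gamma> \<otimes>\<^bsub>\<Gamma>\<^esub> \<eta>" \<epsilon>] \<eta> \<gamma> \<epsilon> by (simp add: G.m_assoc)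
  ultimately show ?thesis using rproj_homog_mult[OF \<gamma> \<eta>(1) a x(1)] by simp
next
  case False
  then have "x = \<zero>\<^bsub>A\<^esub>" using x(2) shift_proj_other[OF False] by simp
  then show ?thesis
    using shift_proj_add[OF \<epsilon>, of "\<zero>\<^bsub>A\<^esub>" "\<zero>\<^bsub>A\<^esub>"] shift_proj_closed[OF \<epsilon>, of "\<zero>\<^bsub>A\<^esub>"] AD.C_closed[OF \<gamma> a]
    by simp
qed

lemma F_graded: "graded_module \<Gamma> A F"
proof -
  have "a \<odot>\<^bsub>F\<^esub> f \<in> mcomp F (\<gamma> \<otimes>\<^bsub>\<Gamma>\<^esub> \<zeta>)"
    if "\<gamma> \<in> carrier \<Gamma>" "\<zeta> \<in> carrier \<Gamma>" "a \<in> rcomp A \<gamma>" "f \<in> mcomp F \<zeta>" for \<gamma> \<zeta> a f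
    using that deg AD.C_closed[OF that(1,3)] shift_proj_homog_mult by (auto simp: F_simps)
  then show ?thesis using F_left_module F_decomp by (simp add: graded_module_def)
qed

sublocale F: gr_mod_loc \<Gamma> A F using F_graded by unfold_locales

lemma std_vec_closed: "i < n \<Longrightarrow> std_vec A i \<in> carrier F"
  by (auto simp: F_simps std_vec_def)

lemma std_vec_mcomp: "i < n \<Longrightarrow> std_vec A i \<in> mcomp F (\<delta> i)"
proof -
  assume i: "i < n"
  have "shift_proj \<Gamma> A (\<delta> i) (\<delta> i) \<one>\<^bsub>A\<^esub> = \<one>\<^bsub>A\<^esub>"
    using shift_proj_mult[of "\<one>\<^bsub>\<Gamma>\<^esub>" "\<delta> i" "\<one>\<^bsub>A\<^esub>"] deg[OF i] AD.component_same[OF _ one_E] by simp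
  moreover have "shift_proj \<Gamma> A (\<delta> j) (\<delta> i) \<zero>\<^bsub>A\<^esub> = \<zero>\<^bsub>A\<^esub>" if "j < n" for j
    using shift_proj_add[OF deg[OF that], of "\<zero>\<^bsub>A\<^esub>" "\<zero>\<^bsub>A\<^esub>"] shift_proj_closed[OF deg[OF that], of "\<zero>\<^bsub>A\<^esub>"]
    by simp
  ultimately show ?thesis using i by (auto simp: F_simps std_vec_def)
qed

lemma std_vec_inj: "inj (std_vec A)"
  using one_not_zero by (auto intro!: injI simp: std_vec_def fun_eq_iff split: if_splits)

lemma std_vec_combination:
  assumes c: "\<And>i. i < n \<Longrightarrow> c i \<in> carrier A"
  shows "finsum F (\<lambda>i. c i \<odot>\<^bsub>F\<^esub> std_vec A i) {..<n} = (\<lambda>i. if i < n then c i else \<zero>\<^bsub>A\<^esub>)"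
proof
  fix i
  have cl: "(\<lambda>i. c i \<odot>\<^bsub>F\<^esub> std_vec A i) \<in> {..<n} \<rightarrow> carrier F"
    using c std_vec_closed by (auto intro!: F.smult_closed)
  have "finsum F (\<lambda>i. c i \<odot>\<^bsub>F\<^esub> std_vec A i) {..<n} i =
      finsum A (\<lambda>j. if i = j then c j else \<zero>\<^bsub>A\<^esub>) {..<n}"
    unfolding F_finsum[OF cl] using c by (intro R.finsum_cong') (auto simp: F_simps std_vec_def)
  also have "\<dots> = (if i < n then c i else \<zero>\<^bsub>A\<^esub>)"
  proof (cases "i < n")
    case True
    then show ?thesis using R.finsum_singleton[of i "{..<n}" c] c by auto
  next
    case False
    then have "finsum A (\<lambda>j. if i = j then c j else \<zero>\<^bsub>A\<^esub>) {..<n} = finsum A (\<lambda>j. \<zero>\<^bsub>A\<^esub>) {..<n}"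
      by (intro R.finsum_cong') auto
    then show ?thesis using False by (simp add: R.finsum_zero)
  qed
  finally show "finsum F (\<lambda>i. c i \<odot>\<^bsub>F\<^esub> std_vec A i) {..<n} i = (if i < n then c i else \<zero>\<^bsub>A\<^esub>)" .
qed

lemma F_free_basis: "free_basis A F (std_vec A ` {..<n})"
proof -
  let ?B = "std_vec A ` {..<n}"
  have BF: "?B \<subseteq> carrier F" using std_vec_closed by auto
  have inj: "inj_on (std_vec A) {..<n}" using std_vec_inj by (rule inj_on_subset) auto
  have comb: "finsum F (\<lambda>b. c b \<odot>\<^bsub>F\<^esub> b) ?B = (\<lambda>i. if i < n then c (std_vec A i) else \<zero>\<^bsub>A\<^esub>)"
    if "c \<in> ?B \<rightarrow>\<^sub>E carrier A" for c
  proof -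
    have "finsum F (\<lambda>b. c b \<odot>\<^bsub>F\<^esub> b) ?B = finsum F (\<lambda>i. c (std_vec A i) \<odot>\<^bsub>F\<^esub> std_vec A i) {..<n}"
      using that BF inj by (intro F.M.finsum_reindex) (auto intro!: F.smult_closed)
    also have "\<dots> = (\<lambda>i. if i < n then c (std_vec A i) else \<zero>\<^bsub>A\<^esub>)"
      using that by (intro std_vec_combination) auto
    finally show ?thesis .
  qed
  have "\<exists>!c. c \<in> ?B \<rightarrow>\<^sub>E carrier A \<and> f = finsum F (\<lambda>b. c b \<odot>\<^bsub>F\<^esub> b) ?B" if f: "f \<in> carrier F" for f
  proof (rule ex1I)
    let ?c = "\<lambda>b\<in>?B. f (inv_into {..<n} (std_vec A) b)"
    have c: "?c \<in> ?B \<rightarrow>\<^sub>E carrier A" using f by (auto simp: F_simps)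
    moreover have "?c (std_vec A i) = f i" if "i < n" for i using that inj by simp
    ultimately show "?c \<in> ?B \<rightarrow>\<^sub>E carrier A \<and> f = finsum F (\<lambda>b. ?c b \<odot>\<^bsub>F\<^esub> b) ?B"
      using f unfolding comb[OF c] by (auto simp: F_simps fun_eq_iff)
    fix c assume c: "c \<in> ?B \<rightarrow>\<^sub>E carrier A \<and> f = finsum F (\<lambda>b. c b \<odot>\<^bsub>F\<^esub> b) ?B"
    then have "f = (\<lambda>i. if i < n then c (std_vec A i) else \<zero>\<^bsub>A\<^esub>)" using comb by simp
    then have "c (std_vec A i) = f i" if "i < n" for i using that by simp
    then show "c = ?c" using c inj by (intro extensionalityI[of _ ?B]) (auto simp: PiE_def)
  qed
  then show ?thesis using F.free_basis_finite_iff[OF _ BF] by simp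
qed

lemma F_gr_free: "gr_free_finite \<Gamma> A F"
proof -
  have "std_vec A i \<noteq> \<zero>\<^bsub>F\<^esub>" for i using one_not_zero by (auto simp: F_simps std_vec_def fun_eq_iff)
  then have "std_vec A ` {..<n} \<subseteq> homog_module \<Gamma> F"
    using std_vec_mcomp deg by (auto simp: homog_module_def)
  then show ?thesis using F_graded F_free_basis by (auto simp: gr_free_finite_def)
qed

lemma max_graded_ideal_mult_F:
  assumes f: "f \<in> carrier F" and m: "\<And>i. i < n \<Longrightarrow> f i \<in> max_graded_ideal \<Gamma> A"
  shows "f \<in> ideal_mult_module F (max_graded_ideal \<Gamma> A)"
proof -
  let ?G = "{a \<odot>\<^bsub>F\<^esub> x |a x. a \<in> max_graded_ideal \<Gamma> A \<and> x \<in> carrier F}"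
  have "?G \<subseteq> carrier F" using max_graded_ideal_iff F.smult_closed by blast
  then have sg: "subgroup (ideal_mult_module F (max_graded_ideal \<Gamma> A)) (add_monoid F)"
    unfolding ideal_mult_module_def by (intro group.generate_is_subgroup F.M.a_group) simp
  have "f = finsum F (\<lambda>i. f i \<odot>\<^bsub>F\<^esub> std_vec A i) {..<n}"
    using f by (subst std_vec_combination) (auto simp: F_simps fun_eq_iff)
  moreover have "finsum F (\<lambda>i. f i \<odot>\<^bsub>F\<^esub> std_vec A i) {..<n} \<in> ideal_mult_module F (max_graded_ideal \<Gamma> A)"
  proof (rule F.M.finsum_in_subgroup[OF sg])
    fix i assume "i \<in> {..<n}"
    then show "f i \<odot>\<^bsub>F\<^esub> std_vec A i \<in> ideal_mult_module F (max_graded_ideal \<Gamma> A)"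
      unfolding ideal_mult_module_def using m std_vec_closed by (intro generate.incl) blast
  qed
  ultimately show ?thesis by simp
qed

end

section \<open>Minimal covers\<close>

text \<open>Minimality is put on the kernel of \<open>p\<close>, which in a resolution is the image
  of the next differential. The image of \<open>p\<close> is left free, so that both the
  augmentation and the differentials are instances.\<close>

definition minimal_cover ::
    "('g, 'k) monoid_scheme \<Rightarrow> ('a, 'g) gr_ring \<Rightarrow> ('a, 'f, 'g) gr_module \<Rightarrow> ('a, 'b, 'g) gr_module \<Rightarrow>
      ('f \<Rightarrow> 'b) \<Rightarrow> bool"
  where "minimal_cover \<Gamma> A F M p \<longleftrightarrow> gr_free_finite \<Gamma> A F \<and> p \<in> graded_hom \<Gamma> A F M \<and>
    {x \<in> carrier F. p x = \<zero>\<^bsub>M\<^esub>} \<subseteq> ideal_mult_module F (max_graded_ideal \<Gamma> A)"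

context gr_local_mod_loc
begin

text \<open>A homogeneous generating set of least cardinality: an element in the span of the others
  could be removed. It is enumerated injectively by an initial segment of the naturals to index the
  coordinates of \<open>std_free\<close>.\<close>

lemma irredundant_generators:
  assumes "fin_gen_module A M"
  obtains n :: nat and m where "\<And>i. i < n \<Longrightarrow> m i \<in> homog_module \<Gamma> M"
    "module_span A M (m ` {..<n}) = carrier M"
    "\<And>i. i < n \<Longrightarrow> m i \<notin> module_span A M (m ` ({..<n} - {i}))"
proof -
  let ?P = "\<lambda>Y. finite Y \<and> Y \<subseteq> homog_module \<Gamma> M \<and> module_span A M Y = carrier M"
  obtain Y0 where "?P Y0" using fin_gen_homog[OF assms] by metis
  from ex_has_least_nat[of ?P Y0 card, OF this]
  obtain Y where Y: "?P Y" and least: "\<And>Z. ?P Z \<Longrightarrow> card Y \<le> card Z" by (elim exE conjE) simp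
  obtain m :: "nat \<Rightarrow> 'b" and n where m: "Y = m ` {i. i < n}" "inj_on m {i. i < n}"
    using finite_imp_nat_seg_image_inj_on[of Y] Y by auto
  have m: "Y = m ` {..<n}" "inj_on m {..<n}" using m by (auto simp: lessThan_def)
  have "m i \<notin> module_span A M (m ` ({..<n} - {i}))" if i: "i < n" for i
  proof
    assume mem: "m i \<in> module_span A M (m ` ({..<n} - {i}))"
    let ?Z = "m ` ({..<n} - {i})"
    have ZY: "?Z = Y - {m i}" using m i by (auto simp: inj_on_def)
    have ZM: "?Z \<subseteq> carrier M" using ZY Y homog_closed by auto
    have "Y \<subseteq> module_span A M ?Z" using mem span_superset[of ?Z] ZY by auto
    then have "carrier M \<subseteq> module_span A M ?Z" using span_subset_span[OF ZM, of Y] Y by simp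
    then have "module_span A M ?Z = carrier M" using submoduleD(1)[OF span_submodule[OF ZM]] by auto
    then have "?P ?Z" using ZY Y by auto
    then have "card Y \<le> card ?Z" by (rule least)
    moreover have "card ?Z < card Y" unfolding ZY using m i Y by (intro card_Diff1_less) auto
    ultimately show False by simp
  qed
  then show ?thesis using that[of n m] m Y by auto
qed

lemma minimal_cover_exists:
  assumes fg: "fin_gen_module A M"
  shows "\<exists>(F :: ('a, nat \<Rightarrow> 'a, 'g) gr_module) p. minimal_cover \<Gamma> A F M p \<and> p ` carrier F = carrier M"
proof -
  obtain n :: nat and m where hom: "\<And>i. i < n \<Longrightarrow> m i \<in> homog_module \<Gamma> M"
    and gen: "module_span A M (m ` {..<n}) = carrier M"
    and irr: "\<And>i. i < n \<Longrightarrow> m i \<notin> module_span A M (m ` ({..<n} - {i}))"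
    by (rule irredundant_generators[OF fg]) blast
  have mM: "m i \<in> carrier M" if "i < n" for i using homog_closed hom that by blast
  have "\<forall>i. \<exists>\<delta>. i < n \<longrightarrow> \<delta> \<in> carrier \<Gamma> \<and> m i \<in> mcomp M \<delta>" using hom by (auto simp: homog_module_def)
  then obtain \<delta> where \<delta>: "\<And>i. i < n \<Longrightarrow> \<delta> i \<in> carrier \<Gamma>" "\<And>i. i < n \<Longrightarrow> m i \<in> mcomp M (\<delta> i)" by metis
  interpret std_free_loc \<Gamma> A n \<delta> by unfold_locales (rule \<delta>(1))
  define p where "p f = finsum M (\<lambda>i. f i \<odot>\<^bsub>M\<^esub> m i) {..<n}" for f
  have cl: "(\<lambda>i. f i \<odot>\<^bsub>M\<^esub> m i) \<in> {..<n} \<rightarrow> carrier M" if "f \<in> carrier F" for f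
    using that mM by (auto simp: F_simps intro!: smult_closed)
  have pM: "p f \<in> carrier M" if "f \<in> carrier F" for f
    unfolding p_def using cl[OF that] by (rule M.finsum_closed)
  have p_add: "p (f \<oplus>\<^bsub>F\<^esub> g) = p f \<oplus>\<^bsub>M\<^esub> p g" if "f \<in> carrier F" "g \<in> carrier F" for f g
  proof -
    have "p (f \<oplus>\<^bsub>F\<^esub> g) = finsum M (\<lambda>i. f i \<odot>\<^bsub>M\<^esub> m i \<oplus>\<^bsub>M\<^esub> g i \<odot>\<^bsub>M\<^esub> m i) {..<n}"
      unfolding p_def using that mM
      by (intro M.finsum_cong') (auto simp: F_simps smult_l_distr smult_closed)
    then show ?thesis using cl that by (simp add: p_def M.finsum_addf)
  qed
  have p_smult: "p (a \<odot>\<^bsub>F\<^esub> f) = a \<odot>\<^bsub>M\<^esub> p f" if "a \<in> carrier A" "f \<in> carrier F" for a f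
  proof -
    have "p (a \<odot>\<^bsub>F\<^esub> f) = finsum M (\<lambda>i. a \<odot>\<^bsub>M\<^esub> (f i \<odot>\<^bsub>M\<^esub> m i)) {..<n}"
      unfolding p_def using that mM
      by (intro M.finsum_cong') (auto simp: F_simps smult_assoc smult_closed)
    then show ?thesis using smult_finsum_right[OF cl[OF that(2)] that(1)] by (simp add: p_def)
  qed
  have p_deg: "p f \<in> mcomp M \<gamma>" if \<gamma>: "\<gamma> \<in> carrier \<Gamma>" and f: "f \<in> mcomp F \<gamma>" for \<gamma> f
    unfolding p_def
  proof (rule M.finsum_in_subgroup[OF MD.C_subgroup[OF \<gamma>]])
    fix i assume "i \<in> {..<n}"
    then have i: "i < n" by simp
    have fA: "f i \<in> carrier A" and sh: "shift_proj \<Gamma> A (\<delta> i) \<gamma> (f i) = f i" using f i by (auto simp: F_simps)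
    have "mproj \<Gamma> M \<gamma> (f i \<odot>\<^bsub>M\<^esub> m i) = f i \<odot>\<^bsub>M\<^esub> m i"
      using mproj_smult_homog[OF \<delta>(1)[OF i] \<gamma> \<delta>(2)[OF i] fA] sh by simp
    then show "f i \<odot>\<^bsub>M\<^esub> m i \<in> mcomp M \<gamma>"
      using MD.component_in_iff[OF \<gamma> smult_closed[OF fA mM[OF i]]] by simp
  qed
  have p: "p \<in> graded_hom \<Gamma> A F M"
    using pM p_add p_smult p_deg by (auto simp: graded_hom_def module_hom_def)
  interpret p: gr_hom_loc \<Gamma> A F M p by unfold_locales (rule p)
  have p_vec: "p (std_vec A i) = m i" if i: "i < n" for i
  proof -
    have "p (std_vec A i) = finsum M (\<lambda>j. if i = j then m j else \<zero>\<^bsub>M\<^esub>) {..<n}"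
      unfolding p_def using mM
      by (intro M.finsum_cong') (auto simp: std_vec_def smult_one smult_zero_left)
    also have "\<dots> = m i" using M.finsum_singleton[of i "{..<n}" m] mM i by auto
    finally show ?thesis .
  qed
  have surj: "p ` carrier F = carrier M"
  proof
    have "m ` {..<n} \<subseteq> p ` carrier F" using p_vec std_vec_closed by (force simp: image_iff)
    then have "module_span A M (m ` {..<n}) \<subseteq> p ` carrier F"
      using p.image_graded by (intro span_least) (auto simp: graded_submodule_def)
    then show "carrier M \<subseteq> p ` carrier F" using gen by simp
  qed (use pM in auto)
  have "f \<in> ideal_mult_module F (max_graded_ideal \<Gamma> A)" if f: "f \<in> carrier F" and p0: "p f = \<zero>\<^bsub>M\<^esub>" for f
  proof (rule max_graded_ideal_mult_F[OF f], rule ccontr)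
    fix i assume i: "i < n" and "f i \<notin> max_graded_ideal \<Gamma> A"
    moreover have fA: "f j \<in> carrier A" for j using f by (simp add: F_simps)
    \<comment> \<open>By \<open>max_graded_ideal_iff\<close>, a coefficient outside the maximal
      graded ideal has a component that is a unit.\<close>
    ultimately obtain \<eta> where \<eta>: "\<eta> \<in> carrier \<Gamma>" and unit: "rproj \<Gamma> A \<eta> (f i) \<in> Units A"
      using max_graded_ideal_iff by blast
    let ?V = "module_span A M (m ` ({..<n} - {i}))"
    have ZM: "m ` ({..<n} - {i}) \<subseteq> carrier M" using mM by auto
    note D = submoduleD[OF span_submodule[OF ZM]]
    \<comment> \<open>The degree in which the relation \<open>p f = 0\<close> shows exactly this
      unit as the coefficient of \<open>m i\<close>.\<close>
    define \<gamma> where "\<gamma> = \<eta> \<otimes>\<^bsub>\<Gamma>\<^esub> \<delta> i"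
    have \<gamma>: "\<gamma> \<in> carrier \<Gamma>" using \<eta> \<delta>(1)[OF i] by (simp add: \<gamma>_def)
    define y where "y = finsum M (\<lambda>j. f j \<odot>\<^bsub>M\<^esub> m j) ({..<n} - {i})"
    have yV: "y \<in> ?V"
      unfolding y_def using span_superset[of "m ` ({..<n} - {i})"] fA
      by (intro M.finsum_in_subgroup[OF D(7)] D(4)) auto
    have Vg: "graded_submodule \<Gamma> A M ?V" using hom by (intro homog_span_graded) auto
    have "p f = finsum M (\<lambda>j. f j \<odot>\<^bsub>M\<^esub> m j) (insert i ({..<n} - {i}))"
      unfolding p_def using i by (simp add: insert_absorb)
    also have "\<dots> = f i \<odot>\<^bsub>M\<^esub> m i \<oplus>\<^bsub>M\<^esub> y"
      unfolding y_def using fA mM i by (intro M.finsum_insert) (auto intro!: smult_closed)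
    finally have "mproj \<Gamma> M \<gamma> (f i \<odot>\<^bsub>M\<^esub> m i \<oplus>\<^bsub>M\<^esub> y) = \<zero>\<^bsub>M\<^esub>"
      using p0 MD.component_zero[OF \<gamma>] by simp
    then have sum0: "rproj \<Gamma> A \<eta> (f i) \<odot>\<^bsub>M\<^esub> m i \<oplus>\<^bsub>M\<^esub> mproj \<Gamma> M \<gamma> y = \<zero>\<^bsub>M\<^esub>"
      using mproj_coefficient[OF \<delta>(1)[OF i] \<delta>(2)[OF i] \<eta> fA D(6)[OF yV]] by (simp add: \<gamma>_def)
    \<comment> \<open>The span of the other generators is graded, so in degree
      \<open>\<gamma>\<close> the other terms still contribute an element of it. Dividing by the
      unit puts \<open>m i\<close> into that span, against irredundancy.\<close>
    have y': "mproj \<Gamma> M \<gamma> y \<in> ?V" using Vg yV \<gamma> by (auto simp: graded_submodule_def)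
    let ?u = "rproj \<Gamma> A \<eta> (f i)"
    have uA: "?u \<in> carrier A" using AD.component_closed[OF fA \<eta>] .
    have "?u \<odot>\<^bsub>M\<^esub> m i \<in> ?V"
    proof (rule submodule_add_cancel[OF span_submodule[OF ZM] y'])
      show "mproj \<Gamma> M \<gamma> y \<oplus>\<^bsub>M\<^esub> ?u \<odot>\<^bsub>M\<^esub> m i \<in> ?V"
        using sum0 D(2) D(6)[OF y'] uA mM[OF i] by (simp add: M.a_comm smult_closed)
    qed (use uA mM[OF i] in \<open>simp add: smult_closed\<close>)
    moreover obtain v where v: "v \<in> carrier A" "v \<otimes>\<^bsub>A\<^esub> ?u = \<one>\<^bsub>A\<^esub>" using unit by (auto simp: Units_def)
    ultimately have "v \<odot>\<^bsub>M\<^esub> (?u \<odot>\<^bsub>M\<^esub> m i) \<in> ?V" using D(4) by blast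
    moreover have "v \<odot>\<^bsub>M\<^esub> (?u \<odot>\<^bsub>M\<^esub> m i) = m i"
      using smult_assoc[OF v(1) uA mM[OF i]] v(2) mM[OF i] by (simp add: smult_one)
    ultimately show False using irr[OF i] by simp
  qed
  then have "minimal_cover \<Gamma> A F M p" using F_gr_free p by (auto simp: minimal_cover_def)
  then show ?thesis using surj by blast
qed

end

section \<open>Uniqueness of minimal covers\<close>

lemma graded_iso_bij:
  assumes "f \<in> graded_iso \<Gamma> A M N"
  shows "f \<in> graded_hom \<Gamma> A M N" "inj_on f (carrier M)" "f ` carrier M = carrier N"
proof -
  obtain g where f: "f \<in> graded_hom \<Gamma> A M N" and g: "g \<in> graded_hom \<Gamma> A N M"
      "\<And>x. x \<in> carrier M \<Longrightarrow> g (f x) = x" "\<And>y. y \<in> carrier N \<Longrightarrow> f (g y) = y"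
    using assms by (auto simp: graded_iso_def)
  show "f \<in> graded_hom \<Gamma> A M N" by fact
  show "inj_on f (carrier M)" using g(2) by (rule inj_on_inverseI)
  have "f \<in> carrier M \<rightarrow> carrier N" "g \<in> carrier N \<rightarrow> carrier M"
    using f g(1) by (auto simp: graded_hom_def module_hom_def)
  then show "f ` carrier M = carrier N" using g(3) by (force simp: image_iff)
qed

lemma graded_iso_kernel_image:
  assumes f: "f \<in> graded_iso \<Gamma> A M N" and eq: "\<And>x. x \<in> carrier M \<Longrightarrow> q (f x) = p x"
  shows "f ` {x \<in> carrier M. p x = z} = {y \<in> carrier N. q y = z}"
proof
  show "f ` {x \<in> carrier M. p x = z} \<subseteq> {y \<in> carrier N. q y = z}"
    using graded_iso_bij(3)[OF f] eq by auto
  show "{y \<in> carrier N. q y = z} \<subseteq> f ` {x \<in> carrier M. p x = z}"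
  proof
    fix y assume y: "y \<in> {y \<in> carrier N. q y = z}"
    then obtain x where "x \<in> carrier M" "y = f x" using graded_iso_bij(3)[OF f] by blast
    then show "y \<in> f ` {x \<in> carrier M. p x = z}" using eq[of x] y by auto
  qed
qed

context gr_local_loc
begin

text \<open>For \<open>y\<close> and \<open>x\<close> with \<open>q (f x) = q y\<close>, the
  difference \<open>y - f x\<close> is in the kernel of \<open>q\<close>, hence in the maximal
  graded ideal times \<open>F'\<close>. So the image of \<open>f\<close> satisfies the hypothesis of
  Nakayama.\<close>

lemma lift_surjective:
  assumes F: "graded_module \<Gamma> A F" and P: "graded_module \<Gamma> A P" and cov: "minimal_cover \<Gamma> A F' P q"
    and f: "f \<in> graded_hom \<Gamma> A F F'"
    and im: "\<And>y. y \<in> carrier F' \<Longrightarrow> \<exists>x\<in>carrier F. q (f x) = q y"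
  shows "f ` carrier F = carrier F'"
proof -
  obtain B where "finite B" "B \<subseteq> homog_module \<Gamma> F'" "free_basis A F' B"
    and F': "graded_module \<Gamma> A F'" and q: "q \<in> graded_hom \<Gamma> A F' P"
    and ker: "{x \<in> carrier F'. q x = \<zero>\<^bsub>P\<^esub>} \<subseteq> ideal_mult_module F' (max_graded_ideal \<Gamma> A)"
    using cov by (auto simp: minimal_cover_def gr_free_finite_def)
  then interpret F': gr_free_loc \<Gamma> A F' B by unfold_locales
  interpret F': gr_local_mod_loc \<Gamma> A F' by unfold_locales
  interpret F: gr_mod_loc \<Gamma> A F by unfold_locales fact
  interpret P: gr_mod_loc \<Gamma> A P by unfold_locales fact
  interpret f: gr_hom_loc \<Gamma> A F F' f by unfold_locales fact
  interpret q: gr_hom_loc \<Gamma> A F' P q by unfold_locales fact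
  show ?thesis
  proof (rule F'.nakayama[OF F'.fin_gen f.image_graded])
    fix y assume y: "y \<in> carrier F'"
    then obtain x where x: "x \<in> carrier F" "q (f x) = q y" using im by blast
    have fx: "f x \<in> carrier F'" using f.hom_closed x by simp
    let ?w = "\<ominus>\<^bsub>F'\<^esub> f x \<oplus>\<^bsub>F'\<^esub> y"
    have "q ?w = \<ominus>\<^bsub>P\<^esub> q (f x) \<oplus>\<^bsub>P\<^esub> q y" using fx y by (simp add: q.hom_add q.hom_minus)
    also have "\<dots> = \<zero>\<^bsub>P\<^esub>" using x(2) q.hom_closed[OF y] by (simp add: P.M.l_neg)
    finally have "?w \<in> ideal_mult_module F' (max_graded_ideal \<Gamma> A)" using ker fx y by auto
    moreover have "y = f x \<oplus>\<^bsub>F'\<^esub> ?w" using fx y by (simp add: F'.M.r_neg2)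
    ultimately show "\<exists>v\<in>f ` carrier F. \<exists>w\<in>ideal_mult_module F' (max_graded_ideal \<Gamma> A). y = v \<oplus>\<^bsub>F'\<^esub> w"
      using x(1) by blast
  qed
qed

text \<open>A lift \<open>f\<close> of one cover to the other is surjective by Nakayama, hence splits by freeness; the
  splitting \<open>g\<close> is again a lift, so it is surjective too and is the inverse of \<open>f\<close>.\<close>

lemma minimal_cover_unique:
  assumes P: "graded_module \<Gamma> A P" and c: "minimal_cover \<Gamma> A F P p" and c': "minimal_cover \<Gamma> A F' P q"
    and im: "p ` carrier F = q ` carrier F'"
  shows "\<exists>f\<in>graded_iso \<Gamma> A F F'. \<forall>x\<in>carrier F. q (f x) = p x"
proof -
  obtain B where "finite B" "B \<subseteq> homog_module \<Gamma> F" "free_basis A F B"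
    and F: "graded_module \<Gamma> A F" and p: "p \<in> graded_hom \<Gamma> A F P"
    using c by (auto simp: minimal_cover_def gr_free_finite_def)
  then interpret F: gr_free_loc \<Gamma> A F B by unfold_locales
  obtain B' where "finite B'" "B' \<subseteq> homog_module \<Gamma> F'" "free_basis A F' B'"
    and F': "graded_module \<Gamma> A F'" and q: "q \<in> graded_hom \<Gamma> A F' P"
    using c' by (auto simp: minimal_cover_def gr_free_finite_def)
  then interpret F': gr_free_loc \<Gamma> A F' B' by unfold_locales
  obtain f where f: "f \<in> graded_hom \<Gamma> A F F'" and qf: "\<And>x. x \<in> carrier F \<Longrightarrow> q (f x) = p x"
    using F.lift_through[OF F' P p q] im by blast
  have fim: "f ` carrier F = carrier F'"
  proof (rule lift_surjective[OF F P c' f])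
    fix y assume "y \<in> carrier F'"
    then have "q y \<in> p ` carrier F" using im by auto
    then show "\<exists>x\<in>carrier F. q (f x) = q y" using qf by fastforce
  qed
  \<comment> \<open>The identity of the free module \<open>F'\<close> is lifted along the surjection
    \<open>f\<close>.\<close>
  obtain g where g: "g \<in> graded_hom \<Gamma> A F' F" and fg: "\<And>y. y \<in> carrier F' \<Longrightarrow> f (g y) = y"
    using F'.lift_through[OF F F' graded_hom_id f] fim by auto
  have fcl: "f x \<in> carrier F'" if "x \<in> carrier F" for x using fim that by auto
  have gcl: "g y \<in> carrier F" if "y \<in> carrier F'" for y
    using g that by (auto simp: graded_hom_def module_hom_def)
  have gim: "g ` carrier F' = carrier F"
  proof (rule lift_surjective[OF F' P c g])
    fix x assume x: "x \<in> carrier F"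
    have "p (g (f x)) = q (f (g (f x)))" using qf[OF gcl[OF fcl[OF x]]] by simp
    also have "\<dots> = p x" using fg[OF fcl[OF x]] qf[OF x] by simp
    finally show "\<exists>y\<in>carrier F'. p (g y) = p x" using fcl[OF x] by blast
  qed
  have "g (f x) = x" if "x \<in> carrier F" for x
  proof -
    obtain y where "y \<in> carrier F'" "x = g y" using gim \<open>x \<in> carrier F\<close> by auto
    then show ?thesis using fg by simp
  qed
  then have "f \<in> graded_iso \<Gamma> A F F'" using f g fg by (auto simp: graded_iso_def)
  then show ?thesis using qf by blast
qed

section \<open>Minimal resolutions\<close>

text \<open>\<open>K\<close> is finitely generated by the Noetherian hypothesis and is covered as a
  module in its own right; enlarging the codomain to \<open>F\<close> keeps the zero element and
  hence the kernel.\<close>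

lemma minimal_cover_of_submodule:
  fixes F :: "('a, nat \<Rightarrow> 'a, 'g) gr_module"
  assumes noeth: "left_gr_noetherian \<Gamma> A" and F: "gr_free_finite \<Gamma> A F" and K: "graded_submodule \<Gamma> A F K"
  shows "\<exists>(F' :: ('a, nat \<Rightarrow> 'a, 'g) gr_module) d. minimal_cover \<Gamma> A F' F d \<and> d ` carrier F' = K"
proof -
  obtain B where B: "finite B" "B \<subseteq> homog_module \<Gamma> F" "free_basis A F B" "graded_module \<Gamma> A F"
    using F by (auto simp: gr_free_finite_def)
  then interpret F: gr_free_loc \<Gamma> A F B by unfold_locales
  have KF: "K \<subseteq> carrier F" using K F.submoduleD(1) by (auto simp: graded_submodule_def)
  obtain T where T: "finite T" "T \<subseteq> K" "module_span A F T = K"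
    using F.graded_submodule_fin_gen[OF noeth B(1,2) K] KF F.span_basis by auto
  let ?K = "gr_submodule_of F K"
  interpret K: gr_local_mod_loc \<Gamma> A ?K
    by unfold_locales (rule F.gr_submodule_of_graded[OF K])
  obtain F' :: "('a, nat \<Rightarrow> 'a, 'g) gr_module" and d
    where d: "minimal_cover \<Gamma> A F' ?K d" "d ` carrier F' = carrier ?K"
    using K.minimal_cover_exists[OF F.gr_submodule_of_fin_gen[OF K T]] by blast
  have "d \<in> graded_hom \<Gamma> A F' F"
    using d(1) KF by (auto simp: minimal_cover_def graded_hom_def module_hom_def Pi_iff image_subset_iff)
  then have "minimal_cover \<Gamma> A F' F d" using d(1) by (simp add: minimal_cover_def)
  then show ?thesis using d(2) by auto
qed

lemma minimal_cover_kernel_graded: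
  assumes "minimal_cover \<Gamma> A F N d" "graded_module \<Gamma> A N"
  shows "graded_submodule \<Gamma> A F {x \<in> carrier F. d x = \<zero>\<^bsub>N\<^esub>}"
proof -
  interpret gr_hom_loc \<Gamma> A F N d
    using assms by unfold_locales (auto simp: minimal_cover_def gr_free_finite_def)
  show ?thesis by (rule kernel_graded)
qed

lemma minimal_resolution_exists:
  fixes M :: "('a, 'm, 'g) gr_module"
  assumes noeth: "left_gr_noetherian \<Gamma> A" and M: "graded_module \<Gamma> A M" and fg: "fin_gen_module A M"
  shows "\<exists>(F :: nat \<Rightarrow> ('a, nat \<Rightarrow> 'a, 'g) gr_module) d \<epsilon>. minimal_gr_free_resolution \<Gamma> A M F d \<epsilon>"
proof -
  interpret M: gr_local_mod_loc \<Gamma> A M by unfold_locales fact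
  obtain F0 :: "('a, nat \<Rightarrow> 'a, 'g) gr_module" and \<epsilon>
    where F0: "minimal_cover \<Gamma> A F0 M \<epsilon>" "\<epsilon> ` carrier F0 = carrier M"
    using M.minimal_cover_exists[OF fg] by blast
  define K0 where "K0 = {x \<in> carrier F0. \<epsilon> x = \<zero>\<^bsub>M\<^esub>}"
  \<comment> \<open>The state is a free module with the submodule that the next differential must
    have as its image; the invariant keeps that submodule graded and inside the maximal graded ideal
    times the module.\<close>
  define good where "good = (\<lambda>(F :: ('a, nat \<Rightarrow> 'a, 'g) gr_module, K).
    gr_free_finite \<Gamma> A F \<and> graded_submodule \<Gamma> A F K \<and>
    K \<subseteq> ideal_mult_module F (max_graded_ideal \<Gamma> A))"
  define step where "step = (\<lambda>(F :: ('a, nat \<Rightarrow> 'a, 'g) gr_module, K)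
      (F' :: ('a, nat \<Rightarrow> 'a, 'g) gr_module, K').
    \<exists>d\<in>graded_hom \<Gamma> A F' F. d ` carrier F' = K \<and> K' = {x \<in> carrier F'. d x = \<zero>\<^bsub>F\<^esub>})"
  have good0: "good (F0, K0)"
    using F0(1) minimal_cover_kernel_graded[OF F0(1) M] by (auto simp: good_def K0_def minimal_cover_def)
  have "\<exists>y. good y \<and> step x y" if "good x" for x
  proof -
    obtain F K where x: "x = (F, K)" by (cases x)
    have F: "gr_free_finite \<Gamma> A F" and K: "graded_submodule \<Gamma> A F K"
      using that by (auto simp: x good_def)
    obtain F' :: "('a, nat \<Rightarrow> 'a, 'g) gr_module" and d
      where d: "minimal_cover \<Gamma> A F' F d" "d ` carrier F' = K"
      using minimal_cover_of_submodule[OF noeth F K] by blast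
    have "graded_module \<Gamma> A F" using F by (simp add: gr_free_finite_def)
    then have "good (F', {x \<in> carrier F'. d x = \<zero>\<^bsub>F\<^esub>})"
      using d minimal_cover_kernel_graded[OF d(1)] by (auto simp: good_def minimal_cover_def)
    moreover have "step x (F', {x \<in> carrier F'. d x = \<zero>\<^bsub>F\<^esub>})"
      using d by (auto simp: step_def x minimal_cover_def)
    ultimately show ?thesis by blast
  qed
  \<comment> \<open>Dependent choice builds only the modules and submodules; the differentials are
    selected afterwards from \<open>step\<close>. The clause for \<open>n = 0\<close> pins the start
    to the cover of \<open>M\<close>.\<close>
  then have "\<exists>s. \<forall>n. (good (s n) \<and> (n = 0 \<longrightarrow> s n = (F0, K0))) \<and> step (s n) (s (Suc n))"
    using good0 by (intro dependent_nat_choice) auto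
  then obtain s where s: "\<And>n. good (s n)" "s 0 = (F0, K0)" "\<And>n. step (s n) (s (Suc n))" by auto
  define F where "F n = fst (s n)" for n
  define K where "K n = snd (s n)" for n
  have sFK: "s n = (F n, K n)" for n by (simp add: F_def K_def)
  define Q where "Q n d \<longleftrightarrow> d \<in> graded_hom \<Gamma> A (F (Suc n)) (F n) \<and> d ` carrier (F (Suc n)) = K n \<and>
      K (Suc n) = {x \<in> carrier (F (Suc n)). d x = \<zero>\<^bsub>F n\<^esub>}" for n d
  have "\<exists>d. Q n d" for n
    using s(3)[of n] unfolding sFK step_def Q_def by auto
  then obtain d where "\<And>n. Q n (d n)" by metis
  then have d: "\<And>n. d n \<in> graded_hom \<Gamma> A (F (Suc n)) (F n)"
      "\<And>n. d n ` carrier (F (Suc n)) = K n"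
      "\<And>n. K (Suc n) = {x \<in> carrier (F (Suc n)). d n x = \<zero>\<^bsub>F n\<^esub>}"
    unfolding Q_def by blast+
  have gd: "gr_free_finite \<Gamma> A (F n)" "K n \<subseteq> ideal_mult_module (F n) (max_graded_ideal \<Gamma> A)" for n
    using s(1)[of n] unfolding sFK good_def by auto
  have F0': "F 0 = F0" "K 0 = K0" using s(2) sFK[of 0] by auto
  have "minimal_gr_free_resolution \<Gamma> A M F d \<epsilon>"
    unfolding minimal_gr_free_resolution_def
    using gd F0 d(1) by (simp add: d(2) d(3)[symmetric] F0' K0_def[symmetric] minimal_cover_def)
  then show ?thesis by blast
qed

text \<open>Exactness rewrites each kernel as the image of the next differential, which minimality
  of the resolution bounds.\<close>

lemma resolution_minimal_cover:
  assumes "minimal_gr_free_resolution \<Gamma> A M F d \<epsilon>"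
  shows "minimal_cover \<Gamma> A (F 0) M \<epsilon>" "minimal_cover \<Gamma> A (F (Suc n)) (F n) (d n)"
proof -
  have 0: "{x \<in> carrier (F 0). \<epsilon> x = \<zero>\<^bsub>M\<^esub>} = d 0 ` carrier (F (Suc 0))"
    and Suc: "{x \<in> carrier (F (Suc n)). d n x = \<zero>\<^bsub>F n\<^esub>} = d (Suc n) ` carrier (F (Suc (Suc n)))"
    and r: "gr_free_finite \<Gamma> A (F n)" "\<epsilon> \<in> graded_hom \<Gamma> A (F 0) M" "d n \<in> graded_hom \<Gamma> A (F (Suc n)) (F n)"
      "d n ` carrier (F (Suc n)) \<subseteq> ideal_mult_module (F n) (max_graded_ideal \<Gamma> A)" for n
    using assms by (auto simp: minimal_gr_free_resolution_def)
  show "minimal_cover \<Gamma> A (F 0) M \<epsilon>"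
    unfolding minimal_cover_def 0 by (intro conjI r)
  show "minimal_cover \<Gamma> A (F (Suc n)) (F n) (d n)"
    unfolding minimal_cover_def Suc by (intro conjI r)
qed

lemma minimal_resolution_unique:
  assumes M: "graded_module \<Gamma> A M" and r: "minimal_gr_free_resolution \<Gamma> A M F d \<epsilon>"
    and r': "minimal_gr_free_resolution \<Gamma> A M F' d' \<epsilon>'"
  shows "\<exists>\<alpha>. resolution_iso \<Gamma> A F d \<epsilon> F' d' \<epsilon>' \<alpha>"
proof -
  have gm: "graded_module \<Gamma> A (F n)" "graded_module \<Gamma> A (F' n)" for n
    using r r' by (auto simp: minimal_gr_free_resolution_def gr_free_finite_def)
  let ?Z = "\<lambda>n. d n ` carrier (F (Suc n))" and ?Z' = "\<lambda>n. d' n ` carrier (F' (Suc n))"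
  have Z0: "{x \<in> carrier (F 0). \<epsilon> x = \<zero>\<^bsub>M\<^esub>} = ?Z 0" "{x \<in> carrier (F' 0). \<epsilon>' x = \<zero>\<^bsub>M\<^esub>} = ?Z' 0"
    using r r' by (auto simp: minimal_gr_free_resolution_def)
  have ZS: "{x \<in> carrier (F (Suc n)). d n x = \<zero>\<^bsub>F n\<^esub>} = ?Z (Suc n)"
    "{x \<in> carrier (F' (Suc n)). d' n x = \<zero>\<^bsub>F' n\<^esub>} = ?Z' (Suc n)" for n
    using r r' by (auto simp: minimal_gr_free_resolution_def)
  \<comment> \<open>The isomorphism must also match the images of the incoming differentials: this
    is the equality of images that \<open>minimal_cover_unique\<close> demands at the next
    stage.\<close>
  define P where "P n \<alpha> \<longleftrightarrow> \<alpha> \<in> graded_iso \<Gamma> A (F n) (F' n) \<and> \<alpha> ` ?Z n = ?Z' n \<and>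
    (n = 0 \<longrightarrow> (\<forall>x\<in>carrier (F 0). \<epsilon>' (\<alpha> x) = \<epsilon> x))" for n \<alpha>
  have "\<exists>\<alpha>. \<forall>n. P n (\<alpha> n) \<and> (\<forall>x\<in>carrier (F (Suc n)). d' n (\<alpha> (Suc n) x) = \<alpha> n (d n x))"
  proof (rule dependent_nat_choice)
    have "\<epsilon> ` carrier (F 0) = \<epsilon>' ` carrier (F' 0)"
      using r r' by (simp add: minimal_gr_free_resolution_def)
    then obtain \<alpha> where \<alpha>: "\<alpha> \<in> graded_iso \<Gamma> A (F 0) (F' 0)"
        "\<And>x. x \<in> carrier (F 0) \<Longrightarrow> \<epsilon>' (\<alpha> x) = \<epsilon> x"
      using minimal_cover_unique[OF M resolution_minimal_cover(1)[OF r] resolution_minimal_cover(1)[OF r']]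
      by blast
    have "\<alpha> ` ?Z 0 = ?Z' 0"
      using graded_iso_kernel_image[where q = \<epsilon>' and p = \<epsilon> and z = "\<zero>\<^bsub>M\<^esub>", OF \<alpha>] by (simp only: Z0)
    then show "\<exists>\<alpha>. P 0 \<alpha>" using \<alpha> by (auto simp: P_def)
  next
    fix \<alpha> n assume "P n \<alpha>"
    then have iso: "\<alpha> \<in> graded_iso \<Gamma> A (F n) (F' n)" and im: "\<alpha> ` ?Z n = ?Z' n" by (auto simp: P_def)
    note bij = graded_iso_bij[OF iso]
    interpret \<alpha>: gr_hom_loc \<Gamma> A "F n" "F' n" \<alpha> using gm bij(1) by unfold_locales
    have dn: "d n \<in> graded_hom \<Gamma> A (F (Suc n)) (F n)"
      using r by (simp add: minimal_gr_free_resolution_def)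
    then have dcl: "d n x \<in> carrier (F n)" if "x \<in> carrier (F (Suc n))" for x
      using that by (auto simp: graded_hom_def module_hom_def)
    \<comment> \<open>\<open>\<alpha>\<close> is injective, so composing with it leaves the kernel
      of \<open>d n\<close> unchanged and minimality survives.\<close>
    have ker: "{x \<in> carrier (F (Suc n)). \<alpha> (d n x) = \<zero>\<^bsub>F' n\<^esub>} =
        {x \<in> carrier (F (Suc n)). d n x = \<zero>\<^bsub>F n\<^esub>}"
      using inj_on_eq_iff[OF bij(2) dcl \<alpha>.S.M.zero_closed] \<alpha>.hom_zero by auto
    \<comment> \<open>After composition with \<open>\<alpha>\<close> both differentials map to
      \<open>F' n\<close> and have the same image, so the isomorphism given by
      \<open>minimal_cover_unique\<close> makes the square commute.\<close>
    have cov: "minimal_cover \<Gamma> A (F (Suc n)) (F' n) (\<lambda>x. \<alpha> (d n x))"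
      using resolution_minimal_cover(2)[OF r, of n] graded_hom_comp[OF dn bij(1)]
      by (simp add: minimal_cover_def ker)
    have "(\<lambda>x. \<alpha> (d n x)) ` carrier (F (Suc n)) = d' n ` carrier (F' (Suc n))"
      using im by (simp add: image_image)
    from minimal_cover_unique[OF gm(2) cov resolution_minimal_cover(2)[OF r'] this]
    obtain \<beta> where \<beta>: "\<beta> \<in> graded_iso \<Gamma> A (F (Suc n)) (F' (Suc n))"
        "\<And>x. x \<in> carrier (F (Suc n)) \<Longrightarrow> d' n (\<beta> x) = \<alpha> (d n x)" by blast
    have "\<beta> ` ?Z (Suc n) = ?Z' (Suc n)"
      using graded_iso_kernel_image[where q = "d' n" and p = "\<lambda>x. \<alpha> (d n x)" and z = "\<zero>\<^bsub>F' n\<^esub>", OF \<beta>] by (simp only: ker ZS)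
    then show "\<exists>\<beta>. P (Suc n) \<beta> \<and> (\<forall>x\<in>carrier (F (Suc n)). d' n (\<beta> x) = \<alpha> (d n x))"
      using \<beta> by (auto simp: P_def)
  qed
  then obtain \<alpha> where \<alpha>: "\<And>n. P n (\<alpha> n)"
      "\<And>n x. x \<in> carrier (F (Suc n)) \<Longrightarrow> d' n (\<alpha> (Suc n) x) = \<alpha> n (d n x)" by blast
  have "resolution_iso \<Gamma> A F d \<epsilon> F' d' \<epsilon>' \<alpha>"
    using \<alpha> by (simp add: resolution_iso_def P_def)
  then show ?thesis by blast
qed

end

theorem theorem5p3:
  fixes \<Gamma> :: "('g, 'k) monoid_scheme"
    and A :: "('a, 'g) gr_ring"
    and M :: "('a, 'm, 'g) gr_module"
  assumes "monoid_cancel \<Gamma>"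
    and "graded_local_ring \<Gamma> A"
    and "left_gr_noetherian \<Gamma> A"
    and "graded_module \<Gamma> A M"
    and "fin_gen_module A M"
  shows "(\<exists>(F :: nat \<Rightarrow> ('a, nat \<Rightarrow> 'a, 'g) gr_module) d \<epsilon>.
            minimal_gr_free_resolution \<Gamma> A M F d \<epsilon>) \<and>
         (\<forall>(F :: nat \<Rightarrow> ('a, 'f, 'g) gr_module) d \<epsilon>
           (F' :: nat \<Rightarrow> ('a, 'h, 'g) gr_module) d' \<epsilon>'.
            minimal_gr_free_resolution \<Gamma> A M F d \<epsilon> \<and>
            minimal_gr_free_resolution \<Gamma> A M F' d' \<epsilon>' \<longrightarrow>
            (\<exists>\<alpha>. resolution_iso \<Gamma> A F d \<epsilon> F' d' \<epsilon>' \<alpha>))"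
proof -
  interpret gr_local_loc \<Gamma> A
    using assms(1,2)
    by (simp add: gr_local_loc_def gr_ring_loc_def gr_local_loc_axioms_def graded_local_ring_def)
  show ?thesis
    using minimal_resolution_exists[OF assms(3-5)] minimal_resolution_unique[OF assms(4)] by blast
qed

end
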